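(* Let $F$ be a real birational map with a rational first integral $V$, preserving the genus $0$ fibration given by $\{V=h\}_{h\in\mathcal{H}}$, with $\mathcal{H}$ and $\mathcal{U}$ as described in the context (with $\mathbb{K}=\mathbb{R}$). Then there are open disjoint sets $\mathcal{U}^+,\mathcal{U}^-\subset\mathcal{U}$ (possibly one of them, but not both, empty) such that: (a) If $F$ preserves orientation on $\mathcal{U}$, then on each of the sets $\mathcal{U}^+$ and $\mathcal{U}^-$ the map $F$ preserves a measure absolutely continuous with respect to the Lebesgue measure. (b) On each of the sets $\mathcal{U}^+$ and $\mathcal{U}^-$, the map $F^2=F\circ F$ preserves a measure absolutely continuous with respect to the Lebesgue measure.
   Context: A planar rational map $F$ defined on an open subset of $\mathbb{R}^2$ is birational if it has a rational inverse. A first integral of $F$ is a non-constant function $V$ with $V(F(x,y))=V(x,y)$. Standing assumptions: $V=V_1/V_2$ is rational; $F$ and $V$ are defined on the good set $\mathcal{G}(F)\subset\mathbb{R}^2$, an open set which is the domain of definition of the dynamical system generated by $F$ (all iterates are well defined there); there is a set $\mathcal{H}\subset\mathrm{Im}(V)\subset\mathbb{R}$ such that $\mathcal{U}:=\{(x,y)\in\mathbb{R}^2: V(x,y)\in\mathcal{H}\}\cap\mathcal{G}(F)$ is a nonempty open subset of $\mathbb{R}^2$, and each curve $C_h:=\{V_1(x,y)-hV_2(x,y)=0\}$, $h\in\mathcal{H}$ (also denoted $\{V=h\}$), is irreducible over $\mathbb{C}$ and has genus $0$. A map $F$ defined on an open set of $\mathbb{R}^2$ preserves a measure absolutely continuous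 with respect to the Lebesgue measure, with non-vanishing density $\nu$, if $m(F^{-1}(B))=m(B)$ for any Lebesgue measurable set $B$, where $m(B)=\int_B\nu(x,y)\,dx\,dy$. *)

theory Defs
  imports
    "HOL-Analysis.Analysis"
    "HOL-Algebra.QuotRing"
    "HOL-Algebra.Embedded_Algebras"
    "HOL-Computational_Algebra.Computational_Algebra"
    "HOL-Computational_Algebra.Field_as_Ring"
begin

section \<open>Real rational functions and rational maps of the plane\<close>

text \<open>A bivariate polynomial is an element of K[x][y]: the outer variable is y, the coefficients
  are polynomials in x.\<close>

definition eval2 :: "'a::comm_ring_1 poly poly \<Rightarrow> 'a \<Rightarrow> 'a \<Rightarrow> 'a" where
  "eval2 P x y = poly (poly P [:y:]) x"

type_synonym ratfun = "real poly poly fract"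

text \<open>The library function \<^const>\<open>quot_of_fract\<close> returns the representation in lowest terms, so a
  rational function is defined exactly where its reduced denominator does not vanish.\<close>

definition rf_numer :: "ratfun \<Rightarrow> real poly poly" where
  "rf_numer r = fst (quot_of_fract r)"

definition rf_denom :: "ratfun \<Rightarrow> real poly poly" where
  "rf_denom r = snd (quot_of_fract r)"

definition rf_domain :: "ratfun \<Rightarrow> (real^2) set" where
  "rf_domain r = {p. eval2 (rf_denom r) (p$1) (p$2) \<noteq> 0}"

definition rf_eval :: "ratfun \<Rightarrow> real^2 \<Rightarrow> real" where
  "rf_eval r p = eval2 (rf_numer r) (p$1) (p$2) / eval2 (rf_denom r) (p$1) (p$2)"

type_synonym ratmap = "ratfun \<times> ratfun"

definition rm_domain :: "ratmap \<Rightarrow> (real^2) set" where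
  "rm_domain F = rf_domain (fst F) \<inter> rf_domain (snd F)"

definition rm_eval :: "ratmap \<Rightarrow> real^2 \<Rightarrow> real^2" where
  "rm_eval F p = vector [rf_eval (fst F) p, rf_eval (snd F) p]"

text \<open>Equality of rational maps is agreement on a nonempty Zariski open set; here
  \<open>F\<close> after \<open>G\<close> is the identity as a rational map.\<close>

definition rm_comp_is_id :: "ratmap \<Rightarrow> ratmap \<Rightarrow> bool" where
  "rm_comp_is_id F G \<longleftrightarrow> (\<exists>Q. Q \<noteq> 0 \<and>
     (\<forall>p. eval2 Q (p$1) (p$2) \<noteq> 0 \<longrightarrow>
        p \<in> rm_domain G \<and> rm_eval G p \<in> rm_domain F \<and> rm_eval F (rm_eval G p) = p))"

definition birational :: "ratmap \<Rightarrow> bool" where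
  "birational F \<longleftrightarrow> (\<exists>G. rm_comp_is_id F G \<and> rm_comp_is_id G F)"

definition good_set :: "ratmap \<Rightarrow> (real^2) set" where
  "good_set F = {p. \<forall>n. (rm_eval F ^^ n) p \<in> rm_domain F}"

definition first_integral :: "ratmap \<Rightarrow> ratfun \<Rightarrow> bool" where
  "first_integral F V \<longleftrightarrow> good_set F \<subseteq> rf_domain V \<and> \<not> rf_eval V constant_on good_set F \<and>
     (\<forall>p\<in>good_set F. rf_eval V (rm_eval F p) = rf_eval V p)"

section \<open>Function fields of plane curves and their genus\<close>

text \<open>The function field of the irreducible curve \<open>f = 0\<close> is the residue field of the local ring of
  C(x,y) at the prime ideal (f); this also covers vertical lines, where \<open>f\<close> has degree 0 in y.\<close>

definition curve_ideal :: "complex poly poly \<Rightarrow> complex poly poly fract set" where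
  "curve_ideal f = {Fract a b | a b. f dvd a \<and> \<not> f dvd b}"

definition curve_local_ring :: "complex poly poly \<Rightarrow> complex poly poly fract ring" where
  "curve_local_ring f =
     \<lparr>carrier = {Fract a b | a b. \<not> f dvd b}, mult = (*), one = 1, zero = 0, add = (+)\<rparr>"

definition function_field :: "complex poly poly \<Rightarrow> complex poly poly fract set ring" where
  "function_field f = curve_local_ring f Quot curve_ideal f"

definition curve_constants :: "complex poly poly \<Rightarrow> complex poly poly fract set set" where
  "curve_constants f = range (\<lambda>c. curve_ideal f +>\<^bsub>curve_local_ring f\<^esub> Fract [:[:c:]:] 1)"

text \<open>For a field \<open>K\<close> with subfield of constants \<open>k\<close>, the places of \<open>K\<close> over \<open>k\<close> are
  represented by the surjective discrete valuations of \<open>K\<close> that are trivial on \<open>k\<close>.\<close>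

definition places :: "('a, 'b) ring_scheme \<Rightarrow> 'a set \<Rightarrow> ('a \<Rightarrow> int) set" where
  "places K k = {v \<in> extensional (carrier K - {\<zero>\<^bsub>K\<^esub>}).
     (\<forall>x\<in>carrier K - {\<zero>\<^bsub>K\<^esub>}. \<forall>y\<in>carrier K - {\<zero>\<^bsub>K\<^esub>}.
        v (x \<otimes>\<^bsub>K\<^esub> y) = v x + v y \<and>
        (x \<oplus>\<^bsub>K\<^esub> y \<noteq> \<zero>\<^bsub>K\<^esub> \<longrightarrow> min (v x) (v y) \<le> v (x \<oplus>\<^bsub>K\<^esub> y))) \<and>
     (\<forall>c\<in>k - {\<zero>\<^bsub>K\<^esub>}. v c = 0) \<and>
     (\<exists>x\<in>carrier K - {\<zero>\<^bsub>K\<^esub>}. v x = 1)}"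

definition divisors :: "('a, 'b) ring_scheme \<Rightarrow> 'a set \<Rightarrow> (('a \<Rightarrow> int) \<Rightarrow> int) set" where
  "divisors K k = {D. finite {v. D v \<noteq> 0} \<and> {v. D v \<noteq> 0} \<subseteq> places K k}"

text \<open>No residue degrees enter: the constant field will be (a copy of) the complex numbers, over
  which every place has degree one.\<close>

definition divisor_degree :: "(('a \<Rightarrow> int) \<Rightarrow> int) \<Rightarrow> int" where
  "divisor_degree D = (\<Sum>v | D v \<noteq> 0. D v)"

definition riemann_roch_space ::
    "('a, 'b) ring_scheme \<Rightarrow> 'a set \<Rightarrow> (('a \<Rightarrow> int) \<Rightarrow> int) \<Rightarrow> 'a set" where
  "riemann_roch_space K k D =
     {x \<in> carrier K. x = \<zero>\<^bsub>K\<^esub> \<or> (\<forall>v\<in>places K k. 0 \<le> v x + D v)}"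

text \<open>The genus is the maximum of deg D - dim L(D) + 1 over all divisors D (Riemann's definition).
  It is stated as a relation, so that it carries the existence of the maximum.\<close>

definition has_genus :: "('a, 'b) ring_scheme \<Rightarrow> 'a set \<Rightarrow> int \<Rightarrow> bool" where
  "has_genus K k g \<longleftrightarrow>
     (\<exists>D\<in>divisors K k.
        divisor_degree D - int (ring.dim K k (riemann_roch_space K k D)) + 1 = g) \<and>
     (\<forall>D\<in>divisors K k.
        divisor_degree D - int (ring.dim K k (riemann_roch_space K k D)) + 1 \<le> g)"

definition curve_has_genus :: "complex poly poly \<Rightarrow> int \<Rightarrow> bool" where
  "curve_has_genus f g \<longleftrightarrow> has_genus (function_field f) (curve_constants f) g"

definition level_curve :: "ratfun \<Rightarrow> real \<Rightarrow> complex poly poly" where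
  "level_curve V h =
     map_poly (map_poly complex_of_real) (rf_numer V - Polynomial.smult [:h:] (rf_denom V))"

section \<open>Orientation and invariant measures\<close>

definition preserves_orientation_on :: "(real^2 \<Rightarrow> real^2) \<Rightarrow> (real^2) set \<Rightarrow> bool" where
  "preserves_orientation_on f S \<longleftrightarrow>
     (\<forall>p\<in>S. f differentiable (at p) \<and> det (matrix (frechet_derivative f (at p))) > 0)"

text \<open>Measurability of \<open>f\<close> as a self-map contains the invariance of \<open>W\<close> under \<open>f\<close>, and that the
  preimages of Lebesgue measurable sets are Lebesgue measurable.\<close>

definition preserves_ac_measure_on :: "(real^2 \<Rightarrow> real^2) \<Rightarrow> (real^2) set \<Rightarrow> bool" where
  "preserves_ac_measure_on f W \<longleftrightarrow>
     (\<exists>\<nu> :: real^2 \<Rightarrow> real. \<nu> \<in> borel_measurable (lebesgue_on W) \<and> (\<forall>p\<in>W. 0 < \<nu> p) \<and>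
        (let m = density (lebesgue_on W) (\<lambda>p. ennreal (\<nu> p)) in
           f \<in> m \<rightarrow>\<^sub>M m \<and> (\<forall>B\<in>sets m. emeasure m (f -` B \<inter> W) = emeasure m B)))"

end

theory Submission
  imports Defs
begin

text \<open>
  The set \<open>U\<close> itself carries an invariant measure, so one can take \<open>U\<^sup>+ = U\<close> and \<open>U\<^sup>- = {}\<close>.

  Up to a null set \<open>F\<close> is a bijection of \<open>U\<close> whose inverse is the rational inverse \<open>G\<close>. Take the
  density \<open>\<bar>V\<^sub>y\<bar> / (1 + x\<^sup>2)\<close>, transport it by all iterates of \<open>F\<close> and \<open>G\<close>, and let \<open>\<nu>\<close> be the
  pointwise supremum of the transported densities. Applying \<open>F\<close> only shifts the family, so
  \<open>\<nu> (F p) \<bar>det DF p\<bar> = \<nu> p\<close>, and by the change of variables formula \<open>\<nu>\<close> is the density of an invariant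
  measure (\<open>finite_osup_preserves_ac_measure\<close>). What
  has to be shown is that \<open>\<nu>\<close> is finite almost everywhere, and this is where genus \<open>0\<close> enters.

  Work on one level curve and differentiate along the Hamiltonian vector field of \<open>V\<close>, which \<open>F\<close>
  transports up to its Jacobian determinant (\<open>tan_transport\<close>). A transported density is then the
  derivative of \<open>arctan (x \<circ> F\<^sup>n)\<close>. Suppose that the curve has a coordinate \<open>t\<close> in which \<open>F\<close> is a
  Moebius transformation and \<open>x = P(t) / Q(t)\<close>. The derivative of \<open>arctan (P / Q)\<close> is bounded by a
  multiple of \<open>1 / (1 + \<bar>t\<bar>\<^sup>2)\<close> (\<open>spherical_bound\<close>). If \<open>q\<close> is the quadratic polynomial whose roots are
  the fixed points of the transformation, the vector field \<open>q \<partial>/\<partial>t\<close> is invariant. As \<open>q\<close> is bounded by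
  a multiple of \<open>1 + \<bar>t\<bar>\<^sup>2\<close>, all transported densities at a point are bounded by a multiple of
  \<open>\<bar>dt / q(t)\<bar>\<close> there, independently of the iterate (\<open>moebius_transport\<close>). Hence \<open>\<nu>\<close> is finite at
  every point whose orbit avoids a finite subset of the curve. The exceptional points form a set that
  meets every level curve in a countable set, and such a set is null
  (\<open>negligible_countable_fibres\<close>).

  The coordinate \<open>t\<close> is a function with a single simple pole, at a smooth point of the curve.
  Riemann's inequality for divisors supported at that point gives it (\<open>genus0_coordinate\<close>). The
  functions with poles at the point only are the polynomials in \<open>t\<close> (\<open>pole_le_cpoly\<close>). An
  automorphism of the function field moves the pole of \<open>t\<close> to another place, and clearing that new
  pole by a linear factor shows that it acts as a Moebius transformation (\<open>automorphism_moebius\<close>).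
  Since \<open>x\<close> is algebraic over \<open>C(t)\<close>, some polynomial multiple of it in \<open>t\<close> is integral over \<open>C[t]\<close>,
  hence again a polynomial in \<open>t\<close> (\<open>x_rational_in_t\<close>).

  If \<open>V\<close> does not depend on \<open>y\<close>, the irreducible level curves are vertical lines. Then \<open>y\<close> replaces
  \<open>x\<close>, and a rational function of one variable with a rational inverse is a Moebius transformation
  for elementary reasons (\<open>fibre_vertical\<close>).
\<close>

(* from here on the symbol $ denotes vector components only *)
no_notation fps_nth (infixl "$" 75)

section \<open>Bivariate polynomials\<close>

lemma eval2_hom [simp]:
  "eval2 0 x y = 0" "eval2 1 x y = 1" "eval2 (P + Q) x y = eval2 P x y + eval2 Q x y"
  "eval2 (P - Q) x y = eval2 P x y - eval2 Q x y" "eval2 (- P) x y = - eval2 P x y"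
  "eval2 (P * Q) x y = eval2 P x y * eval2 Q x y" "eval2 (P ^ n) x y = eval2 P x y ^ n"
  by (simp_all add: eval2_def)

lemma eval2_pCons [simp]: "eval2 (pCons c P) x y = poly c x + y * eval2 P x y"
  by (simp add: eval2_def)

lemma eval2_smult [simp]: "eval2 (Polynomial.smult r P) x y = poly r x * eval2 P x y"
  by (simp add: eval2_def)

text \<open>An element of least degree of the ideal generated by \<open>f\<close> and \<open>a\<close> divides nonzero constant multiples of
  both by pseudo-division. If its degree were positive, the prime \<open>f\<close> would divide it or cancel in the
  quotient.\<close>

lemma prime_elimination:
  fixes f a :: "'a::idom poly"
  assumes f: "prime_elem f" "degree f > 0" and a: "\<not> f dvd a"
  obtains r \<alpha> \<beta> where "r \<noteq> 0" "[:r:] = \<alpha> * f + \<beta> * a"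
proof -
  define S where "S = {\<alpha> * f + \<beta> * a | \<alpha> \<beta>. \<alpha> * f + \<beta> * a \<noteq> 0}"
  have fS: "f \<in> S"
  proof -
    have "f = 1 * f + 0 * a" "1 * f + 0 * a \<noteq> 0" using f by auto
    thus ?thesis unfolding S_def by blast
  qed
  have "\<exists>d. d \<in> S \<and> (\<forall>s. s \<in> S \<longrightarrow> degree d \<le> degree s)"
    using ex_has_least_nat[of "\<lambda>s. s \<in> S" f degree] fS by blast
  then obtain d where d: "d \<in> S" "\<And>s. s \<in> S \<Longrightarrow> degree d \<le> degree s" by blast
  obtain \<alpha>0 \<beta>0 where d_eq: "d = \<alpha>0 * f + \<beta>0 * a" and d0: "d \<noteq> 0"
    using d(1) unfolding S_def by blast
  \<comment> \<open>a remainder of pseudo-division by \<open>d\<close> lies in the ideal and has smaller degree\<close>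
  have div: "\<exists>c q. c \<noteq> 0 \<and> Polynomial.smult c s = d * q" if s: "s = \<alpha> * f + \<beta> * a" for s \<alpha> \<beta>
  proof -
    obtain c q where cq: "c \<noteq> 0" "Polynomial.smult c s = d * q + pseudo_mod s d"
      using pseudo_mod(1)[OF d0, of s] by blast
    have r: "pseudo_mod s d = ([:c:] * \<alpha> - q * \<alpha>0) * f + ([:c:] * \<beta> - q * \<beta>0) * a"
    proof -
      have "pseudo_mod s d = [:c:] * s - d * q" using cq(2) by (simp add: algebra_simps)
      thus ?thesis unfolding s d_eq by (simp add: algebra_simps)
    qed
    have "pseudo_mod s d = 0"
    proof (rule ccontr)
      assume n: "pseudo_mod s d \<noteq> 0"
      hence "pseudo_mod s d \<in> S" using r unfolding S_def by auto
      thus False using pseudo_mod(2)[OF d0, of s] n d(2) by fastforce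
    qed
    thus ?thesis using cq by auto
  qed
  obtain c q where cq: "c \<noteq> 0" "Polynomial.smult c f = d * q" using div[of f 1 0] by auto
  obtain c' q' where cq': "c' \<noteq> 0" "Polynomial.smult c' a = d * q'" using div[of a 0 1] by auto
  have const: "\<not> f dvd [:k:]" if "k \<noteq> 0" for k
  proof
    assume "f dvd [:k:]"
    hence "degree f \<le> degree [:k:]" using that dvd_imp_degree_le by (metis pCons_eq_0_iff)
    thus False using f by simp
  qed
  have "f dvd d * q" using cq(2) by (metis dvd_smult dvd_refl)
  hence "f dvd d \<or> f dvd q" using f(1) by (simp add: prime_elem_dvd_mult_iff)
  moreover have "\<not> f dvd d"
  proof
    assume "f dvd d"
    hence "f dvd [:c':] * a" using cq'(2) by (simp add: dvd_mult2)
    thus False using const[OF cq'(1)] a f(1) prime_elem_dvd_mult_iff by blast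
  qed
  ultimately obtain s where s: "q = f * s" by (auto elim: dvdE)
  have "[:c:] * f = (d * s) * f" using cq(2) s by (simp add: algebra_simps)
  hence "[:c:] = d * s" using f(1) by (metis mult_right_cancel not_prime_elem_zero)
  hence "degree d + degree s = 0" using cq(1) d0
    by (metis degree_mult_eq degree_pCons_0 mult_zero_right pCons_eq_0_iff)
  hence "degree d = 0" by simp
  then obtain r where r: "d = [:r:]" by (rule degree_eq_zeroE)
  have "r \<noteq> 0" using d0 r by auto
  thus ?thesis using that r d_eq by metis
qed


text \<open>The eliminant leaves finitely many values of \<open>x\<close>. Over each of them lie finitely many zeros of \<open>f\<close>,
  because \<open>f\<close> is not divisible by a linear polynomial in \<open>x\<close>.\<close>

lemma finite_common_zeros:
  fixes f a :: "'a::{idom} poly poly"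
  assumes f: "prime_elem f" "degree f > 0" and a: "\<not> f dvd a"
  shows "finite {(x,y). eval2 f x y = 0 \<and> eval2 a x y = 0}"
proof -
  obtain r \<alpha> \<beta> where r: "r \<noteq> 0" "[:r:] = \<alpha> * f + \<beta> * a"
    using prime_elimination[OF f a] by blast
  have rx: "poly r x = 0" if "eval2 f x y = 0" "eval2 a x y = 0" for x y
  proof -
    have "poly r x = eval2 [:r:] x y" by simp
    also have "\<dots> = 0" unfolding r(2) using that by simp
    finally show ?thesis .
  qed
  have fin_y: "finite {y. eval2 f x y = 0}" for x
  proof -
    define g where "g = map_poly (\<lambda>c. poly c x) f"
    have ev: "eval2 f x y = poly g y" for y
    proof -
      show ?thesis unfolding g_def by (induction f) (simp_all add: map_poly_pCons)
    qed
    have "g \<noteq> 0"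
    proof
      assume "g = 0"
      hence c0: "poly (poly.coeff f i) x = 0" for i
        by (metis coeff_0 coeff_map_poly g_def poly_0)
      have "[:[:-x,1:]:] dvd f"
        unfolding const_poly_dvd_iff using c0 by (simp add: poly_eq_0_iff_dvd)
      then obtain s where s: "f = [:[:-x,1:]:] * s" by (elim dvdE)
      have "f dvd [:[:-x,1:]:] \<or> f dvd s" using f(1) s
        by (metis dvd_refl prime_elem_dvd_mult_iff)
      moreover have "\<not> f dvd [:[:-x,1:]:]"
      proof
        assume "f dvd [:[:-x,1:]:]"
        hence "degree f \<le> degree [:[:-x,1:]:]" by (rule dvd_imp_degree_le) simp
        thus False using f(2) by simp
      qed
      ultimately obtain t where "s = f * t" by (auto elim: dvdE)
      hence "f * 1 = f * ([:[:-x,1:]:] * t)" using s by (simp add: algebra_simps)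
      hence "1 = [:[:-x,1:]:] * t" using f(1) by (metis mult_left_cancel not_prime_elem_zero)
      hence "[:[:-x,1:]:] dvd 1" by (rule dvdI)
      then obtain w where "[:[:-x,1:]:] * w = 1" by (metis dvdE)
      hence "poly (poly ([:[:-x,1:]:] * w) 0) x = 1" by simp
      thus False by simp
    qed
    thus ?thesis unfolding ev by (rule poly_roots_finite)
  qed
  have "{(x,y). eval2 f x y = 0 \<and> eval2 a x y = 0}
      \<subseteq> (\<Union>x\<in>{x. poly r x = 0}. Pair x ` {y. eval2 f x y = 0})"
    using rx by auto
  moreover have "finite \<dots>" using poly_roots_finite[OF r(1)] fin_y by blast
  ultimately show ?thesis by (rule finite_subset)
qed

lemma eval2_eq_0_decomp:
  fixes a :: "'a::comm_ring_1 poly poly"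
  assumes "eval2 a x0 y0 = 0"
  obtains A B where "a = A * [:[:-x0,1:]:] + B * [:[:-y0:],1:]"
proof -
  obtain B where B: "a = B * [:[:-y0:],1:] + [:poly a [:y0:]:]"
  proof -
    have "[:-[:y0:],1:] dvd a - [:poly a [:y0:]:]"
      by (subst poly_eq_0_iff_dvd[symmetric]) simp
    then obtain B where "a - [:poly a [:y0:]:] = [:-[:y0:],1:] * B" by (elim dvdE)
    hence "a = B * [:[:-y0:],1:] + [:poly a [:y0:]:]" by (simp add: algebra_simps)
    thus ?thesis using that by blast
  qed
  have "poly (poly a [:y0:]) x0 = 0" using assms by (simp add: eval2_def)
  then obtain s where "poly a [:y0:] = [:-x0,1:] * s" by (auto simp: poly_eq_0_iff_dvd elim: dvdE)
  hence "[:poly a [:y0:]:] = [:s:] * [:[:-x0,1:]:]" by simp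
  hence "a = [:s:] * [:[:-x0,1:]:] + B * [:[:-y0:],1:]" using B by (simp add: add.commute)
  thus ?thesis by (rule that)
qed

section \<open>The local ring of a curve\<close>

locale prime_curve =
  fixes f :: "complex poly poly"
  assumes prime: "prime_elem f"
begin

abbreviation loc_ring where "loc_ring \<equiv> carrier (curve_local_ring f)"
abbreviation max_ideal where "max_ideal \<equiv> curve_ideal f"

lemma dvd_mult_iff: "f dvd a * b \<longleftrightarrow> f dvd a \<or> f dvd b"
  using prime by (rule prime_elem_dvd_mult_iff)

lemma not_dvd_nz: "\<not> f dvd b \<Longrightarrow> b \<noteq> 0"
  by auto

lemma not_dvd_1: "\<not> f dvd 1"
  using prime by (simp add: prime_elem_def)

lemma loc_ring_iff: "r \<in> loc_ring \<longleftrightarrow> (\<exists>a b. r = Fract a b \<and> \<not> f dvd b)"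
  by (auto simp: curve_local_ring_def)

lemma max_ideal_iff: "r \<in> max_ideal \<longleftrightarrow> (\<exists>a b. r = Fract a b \<and> f dvd a \<and> \<not> f dvd b)"
  by (auto simp: curve_ideal_def)

lemma loc_ringE: assumes "r \<in> loc_ring" obtains a b where "r = Fract a b" "\<not> f dvd b"
  using assms loc_ring_iff by blast

lemma Fract_loc_ring [intro]: "\<not> f dvd b \<Longrightarrow> Fract a b \<in> loc_ring"
  using loc_ring_iff by blast

lemma Fract_max_ideal_iff: assumes "\<not> f dvd b" shows "Fract a b \<in> max_ideal \<longleftrightarrow> f dvd a"
proof
  assume "Fract a b \<in> max_ideal"
  then obtain c d where cd: "Fract a b = Fract c d" "f dvd c" "\<not> f dvd d"
    using max_ideal_iff by blast
  hence "a * d = c * b" using assms by (simp add: eq_fract not_dvd_nz)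
  hence "f dvd a * d" using cd(2) by simp
  thus "f dvd a" using cd(3) dvd_mult_iff by blast
qed (use assms max_ideal_iff in blast)

lemma max_ideal_subset: "r \<in> max_ideal \<Longrightarrow> r \<in> loc_ring"
  unfolding loc_ring_iff max_ideal_iff by blast

lemma loc_ring_add [intro]:
  assumes "r \<in> loc_ring" "s \<in> loc_ring" shows "r + s \<in> loc_ring"
proof -
  obtain a b where "r = Fract a b" "\<not> f dvd b" using assms(1) by (rule loc_ringE)
  moreover obtain c d where "s = Fract c d" "\<not> f dvd d" using assms(2) by (rule loc_ringE)
  ultimately show ?thesis by (simp add: not_dvd_nz Fract_loc_ring dvd_mult_iff)
qed

lemma loc_ring_mult [intro]:
  assumes "r \<in> loc_ring" "s \<in> loc_ring" shows "r * s \<in> loc_ring"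
proof -
  obtain a b where "r = Fract a b" "\<not> f dvd b" using assms(1) by (rule loc_ringE)
  moreover obtain c d where "s = Fract c d" "\<not> f dvd d" using assms(2) by (rule loc_ringE)
  ultimately show ?thesis by (simp add: not_dvd_nz Fract_loc_ring dvd_mult_iff)
qed

lemma loc_ring_uminus [intro]: "r \<in> loc_ring \<Longrightarrow> - r \<in> loc_ring"
  by (erule loc_ringE) (simp add: Fract_loc_ring)

lemma loc_ring_diff [intro]: "r \<in> loc_ring \<Longrightarrow> s \<in> loc_ring \<Longrightarrow> r - s \<in> loc_ring"
  using loc_ring_add[of r "- s"] by auto

lemma loc_ring_poly [intro, simp]: "Fract a 1 \<in> loc_ring"
  using not_dvd_1 by blast

lemma loc_ring_0 [intro, simp]: "0 \<in> loc_ring"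
  and loc_ring_1 [intro, simp]: "1 \<in> loc_ring"
  by (simp_all add: fract_collapse[symmetric] Zero_fract_def One_fract_def)

lemma max_ideal_0 [intro, simp]: "0 \<in> max_ideal"
  unfolding Zero_fract_def by (simp add: Fract_max_ideal_iff not_dvd_1)

lemma max_ideal_add [intro]: "r \<in> max_ideal \<Longrightarrow> s \<in> max_ideal \<Longrightarrow> r + s \<in> max_ideal"
  unfolding max_ideal_iff[of r] max_ideal_iff[of s]
  by (elim exE conjE) (simp add: not_dvd_nz Fract_max_ideal_iff dvd_mult_iff)

lemma max_ideal_uminus [intro]: "r \<in> max_ideal \<Longrightarrow> - r \<in> max_ideal"
  unfolding max_ideal_iff[of r] by (elim exE conjE) (simp add: Fract_max_ideal_iff)

lemma max_ideal_diff [intro]: "r \<in> max_ideal \<Longrightarrow> s \<in> max_ideal \<Longrightarrow> r - s \<in> max_ideal"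
  using max_ideal_add[of r "- s"] by auto

lemma max_ideal_mult_iff:
  assumes "r \<in> loc_ring" "s \<in> loc_ring"
  shows "r * s \<in> max_ideal \<longleftrightarrow> r \<in> max_ideal \<or> s \<in> max_ideal"
proof -
  obtain a b where "r = Fract a b" "\<not> f dvd b" using assms(1) by (rule loc_ringE)
  moreover obtain c d where "s = Fract c d" "\<not> f dvd d" using assms(2) by (rule loc_ringE)
  ultimately show ?thesis by (simp add: not_dvd_nz Fract_max_ideal_iff dvd_mult_iff)
qed

lemma one_notin_max_ideal [simp]: "1 \<notin> max_ideal"
  unfolding One_fract_def using not_dvd_1 by (simp add: Fract_max_ideal_iff)

lemma inverse_loc_ring: assumes "r \<in> loc_ring" "r \<notin> max_ideal" shows "inverse r \<in> loc_ring"
proof -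
  obtain a b where ab: "r = Fract a b" "\<not> f dvd b" using assms(1) by (rule loc_ringE)
  hence "\<not> f dvd a" using assms(2) by (simp add: Fract_max_ideal_iff)
  thus ?thesis using ab by auto
qed

lemma inverse_notin: assumes "r \<in> loc_ring" "r \<notin> max_ideal" shows "inverse r \<notin> max_ideal"
proof
  assume "inverse r \<in> max_ideal"
  hence "r * inverse r \<in> max_ideal" using assms max_ideal_mult_iff inverse_loc_ring by blast
  moreover have "r \<noteq> 0" using assms by auto
  ultimately show False by simp
qed

end

definition const :: "complex \<Rightarrow> complex poly poly fract" where "const c = Fract [:[:c:]:] 1"

section \<open>The place of a smooth point\<close>

text \<open>A point where \<open>f\<^sub>y\<close> does not vanish, so that \<open>x - x0\<close> is a local parameter.\<close>

locale smooth_point = prime_curve +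
  fixes x0 y0 :: complex
  assumes on_curve: "eval2 f x0 y0 = 0" and smooth: "eval2 (pderiv f) x0 y0 \<noteq> 0"
begin

lemma degree_pos: "degree f > 0"
proof (rule ccontr)
  assume "\<not> degree f > 0"
  hence "pderiv f = 0" by (simp add: pderiv_eq_0_iff)
  thus False using smooth by simp
qed

definition X :: "complex poly poly" where "X = [:[:-x0,1:]:]"

lemma eval2_X [simp]: "eval2 X x0 y0 = 0"
  by (simp add: X_def)

lemma not_dvd_of_eval: "eval2 b x0 y0 \<noteq> 0 \<Longrightarrow> \<not> f dvd b"
  using on_curve by (auto elim!: dvdE)

lemma not_dvd_X: "\<not> f dvd X"
proof
  assume "f dvd X"
  hence "degree f \<le> degree X" by (rule dvd_imp_degree_le) (simp add: X_def)
  thus False using degree_pos by (simp add: X_def)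
qed

lemma not_dvd_X_pow: "\<not> f dvd X ^ n"
  using not_dvd_X prime prime_elem_dvd_power by blast

text \<open>The maximal ideal of the local ring at a smooth point with \<open>f\<^sub>y \<noteq> 0\<close> is generated by
  \<open>x - x0\<close>: eliminate \<open>y - y0\<close> using the equation of the curve.\<close>

lemma uniformizer_step:
  assumes "eval2 a x0 y0 = 0"
  shows "\<exists>b c. eval2 b x0 y0 \<noteq> 0 \<and> f dvd b * a - X * c"
proof -
  obtain A B where a: "a = A * X + B * [:[:-y0:],1:]"
    using eval2_eq_0_decomp[OF assms, folded X_def] .
  obtain A0 B0 where f: "f = A0 * X + B0 * [:[:-y0:],1:]"
    using eval2_eq_0_decomp[OF on_curve, folded X_def] .
  have pX: "pderiv X = 0" by (simp add: X_def pderiv_pCons)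
  have "pderiv f = pderiv (A0 * X) + pderiv (B0 * [:[:-y0:],1:])" by (subst f) (rule pderiv_add)
  hence "eval2 (pderiv f) x0 y0 = eval2 B0 x0 y0"
    by (simp only: pderiv_mult pX pderiv_pCons eval2_hom) simp
  hence "eval2 B0 x0 y0 \<noteq> 0" using smooth by simp
  moreover have "f dvd B0 * a - X * (A * B0 - A0 * B)"
  proof -
    have "B0 * (A * X + B * Y) - X * (A * B0 - A0 * B) = B * (A0 * X + B0 * Y)"
      for Y :: "complex poly poly" by (simp add: algebra_simps)
    from this[of "[:[:-y0:],1:]"] have "B0 * a - X * (A * B0 - A0 * B) = B * f"
      by (simp only: a[symmetric] f[symmetric])
    thus ?thesis by (simp only: dvd_triv_right)
  qed
  ultimately show ?thesis by blast
qed

text \<open>\<open>ord_rel a n\<close>: up to a unit of the local ring of the point, \<open>a\<close> is the \<open>n\<close>-th power of the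
  uniformizer on the curve.\<close>

definition ord_rel :: "complex poly poly \<Rightarrow> nat \<Rightarrow> bool" where
  "ord_rel a n \<longleftrightarrow> (\<exists>b c. eval2 b x0 y0 \<noteq> 0 \<and> eval2 c x0 y0 \<noteq> 0 \<and> f dvd b * a - X ^ n * c)"

lemma ord_rel_le:
  assumes "eval2 c x0 y0 \<noteq> 0" "f dvd b * a - X ^ n * c"
    and "eval2 b' x0 y0 \<noteq> 0" "f dvd b' * a - X ^ m * c'"
  shows "m \<le> n"
proof (rule ccontr)
  assume "\<not> m \<le> n"
  then obtain k where k: "m = n + Suc k" using less_iff_Suc_add by (metis add_Suc_right not_le)
  have "f dvd b' * (b * a - X ^ n * c) - b * (b' * a - X ^ m * c')"
    by (intro dvd_diff[OF dvd_mult dvd_mult] assms)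
  also have "\<dots> = X ^ n * (X ^ Suc k * c' * b - c * b')"
    unfolding k by (simp add: algebra_simps power_add)
  finally have "f dvd X ^ Suc k * c' * b - c * b'" using not_dvd_X_pow dvd_mult_iff by blast
  then obtain s where "X ^ Suc k * c' * b - c * b' = f * s" by (elim dvdE)
  hence "eval2 (X ^ Suc k * c' * b - c * b') x0 y0 = 0" using on_curve by simp
  thus False using assms by simp
qed

lemma ord_rel_unique: "ord_rel a n \<Longrightarrow> ord_rel a m \<Longrightarrow> n = m"
  unfolding ord_rel_def using ord_rel_le by (meson le_antisym)

text \<open>As long as \<open>c\<close> vanishes at the point, another power of the parameter can be split off. This stops
  because the parameter occurs in an eliminant of \<open>f\<close> and \<open>a\<close> to a finite power only.\<close>

lemma ord_rel_exists:
  assumes "\<not> f dvd a"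
  shows "\<exists>n. ord_rel a n"
proof (rule ccontr)
  assume no: "\<not> (\<exists>n. ord_rel a n)"
  have step: "\<exists>b c. eval2 b x0 y0 \<noteq> 0 \<and> f dvd b * a - X ^ n * c" for n
  proof (induction n)
    case 0
    show ?case by (rule exI[of _ 1], rule exI[of _ a]) simp
  next
    case (Suc n)
    then obtain b c where bc: "eval2 b x0 y0 \<noteq> 0" "f dvd b * a - X ^ n * c" by blast
    have "eval2 c x0 y0 = 0" using bc no unfolding ord_rel_def by blast
    then obtain b' c' where bc': "eval2 b' x0 y0 \<noteq> 0" "f dvd b' * c - X * c'"
      using uniformizer_step by blast
    have "f dvd b' * (b * a - X ^ n * c) + X ^ n * (b' * c - X * c')"
      by (rule dvd_add[OF dvd_mult[OF bc(2)] dvd_mult[OF bc'(2)]])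
    also have "\<dots> = (b' * b) * a - X ^ Suc n * c'" by (simp add: algebra_simps)
    finally have "f dvd (b' * b) * a - X ^ Suc n * c'" .
    moreover have "eval2 (b' * b) x0 y0 \<noteq> 0" using bc bc' by simp
    ultimately show ?case by blast
  qed
  \<comment> \<open>the multiplicity of \<open>x0\<close> as a root of an eliminant bounds the exponents\<close>
  obtain r \<alpha> \<beta> where r: "r \<noteq> 0" "[:r:] = \<alpha> * f + \<beta> * a"
    using prime_elimination[OF prime degree_pos assms] by blast
  define e where "e = Polynomial.order x0 r"
  obtain r1 where r1: "r = [:-x0,1:] ^ e * r1" "\<not> [:-x0,1:] dvd r1"
    using order_decomp[OF r(1), of x0] unfolding e_def by blast
  have r1x: "poly r1 x0 \<noteq> 0" using r1(2) by (simp add: poly_eq_0_iff_dvd)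
  have rX0: "[:r:] = X ^ e * [:r1:]" unfolding r1(1) X_def poly_const_pow by simp
  have rX: "\<beta> * a - X ^ e * [:r1:] = f * (- \<alpha>)" unfolding rX0[symmetric] r(2) by simp
  obtain b c where bc: "eval2 b x0 y0 \<noteq> 0" "f dvd b * a - X ^ Suc e * c" using step by blast
  have "Suc e \<le> e"
  proof (rule ord_rel_le[of "[:r1:]" \<beta> a e b "Suc e" c])
    show "f dvd \<beta> * a - X ^ e * [:r1:]" unfolding rX by simp
  next
    show "eval2 [:r1:] x0 y0 \<noteq> 0" using r1x by simp
  qed (fact bc)+
  thus False by simp
qed

definition ordP :: "complex poly poly \<Rightarrow> nat" where "ordP a = (THE n. ord_rel a n)"

lemma ord_relI: "ord_rel a n \<Longrightarrow> ordP a = n"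
  unfolding ordP_def using ord_rel_unique by blast

lemma ord_rel_ordP: "\<not> f dvd a \<Longrightarrow> ord_rel a (ordP a)"
  using ord_rel_exists ord_relI by metis

lemma ord_rel_cong:
  assumes "ord_rel a n" "f dvd a - a'"
  shows "ord_rel a' n"
proof -
  obtain b c where bc: "eval2 b x0 y0 \<noteq> 0" "eval2 c x0 y0 \<noteq> 0" "f dvd b * a - X ^ n * c"
    using assms(1) unfolding ord_rel_def by blast
  have "f dvd (b * a - X ^ n * c) - b * (a - a')"
    by (rule dvd_diff[OF bc(3) dvd_mult[OF assms(2)]])
  also have "\<dots> = b * a' - X ^ n * c" by (simp add: algebra_simps)
  finally show ?thesis using bc unfolding ord_rel_def by blast
qed

lemma ordP_cong: assumes "\<not> f dvd a" "f dvd a - a'" shows "ordP a = ordP a'"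
  using ord_rel_cong[OF ord_rel_ordP[OF assms(1)] assms(2)] ord_relI by metis

lemma ordP_mult:
  assumes "\<not> f dvd a" "\<not> f dvd a'"
  shows "ordP (a * a') = ordP a + ordP a'"
proof (rule ord_relI)
  obtain b c where bc: "eval2 b x0 y0 \<noteq> 0" "eval2 c x0 y0 \<noteq> 0" "f dvd b * a - X ^ ordP a * c"
    using ord_rel_ordP[OF assms(1)] unfolding ord_rel_def by blast
  obtain b' c' where bc': "eval2 b' x0 y0 \<noteq> 0" "eval2 c' x0 y0 \<noteq> 0"
    "f dvd b' * a' - X ^ ordP a' * c'"
    using ord_rel_ordP[OF assms(2)] unfolding ord_rel_def by blast
  have "f dvd (b' * a') * (b * a - X ^ ordP a * c) + (X ^ ordP a * c) * (b' * a' - X ^ ordP a' * c')"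
    by (rule dvd_add[OF dvd_mult[OF bc(3)] dvd_mult[OF bc'(3)]])
  also have "\<dots> = (b * b') * (a * a') - X ^ (ordP a + ordP a') * (c * c')"
    by (simp add: algebra_simps power_add)
  finally show "ord_rel (a * a') (ordP a + ordP a')"
    unfolding ord_rel_def using bc(1,2) bc'(1,2)
    by (intro exI[of _ "b * b'"] exI[of _ "c * c'"] conjI) simp_all
qed

lemma ordP_ge:
  assumes "\<not> f dvd a" "eval2 b x0 y0 \<noteq> 0" "f dvd b * a - X ^ n * c"
  shows "n \<le> ordP a"
proof -
  obtain b' c' where bc': "eval2 b' x0 y0 \<noteq> 0" "eval2 c' x0 y0 \<noteq> 0" "f dvd b' * a - X ^ ordP a * c'"
    using ord_rel_ordP[OF assms(1)] unfolding ord_rel_def by blast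
  show ?thesis by (rule ord_rel_le[OF bc'(2,3) assms(2,3)])
qed

lemma ordP_add:
  assumes "\<not> f dvd a" "\<not> f dvd a'" "\<not> f dvd a + a'"
  shows "min (ordP a) (ordP a') \<le> ordP (a + a')"
proof -
  define n where "n = min (ordP a) (ordP a')"
  obtain k where k: "ordP a = n + k" unfolding n_def by (metis le_add_diff_inverse min.cobounded1)
  obtain k' where k': "ordP a' = n + k'" unfolding n_def by (metis le_add_diff_inverse min.cobounded2)
  obtain b c where bc: "eval2 b x0 y0 \<noteq> 0" "f dvd b * a - X ^ (n + k) * c"
    using ord_rel_ordP[OF assms(1)] unfolding ord_rel_def k by blast
  obtain b' c' where bc': "eval2 b' x0 y0 \<noteq> 0" "f dvd b' * a' - X ^ (n + k') * c'"
    using ord_rel_ordP[OF assms(2)] unfolding ord_rel_def k' by blast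
  have "f dvd b' * (b * a - X ^ (n + k) * c) + b * (b' * a' - X ^ (n + k') * c')"
    by (rule dvd_add[OF dvd_mult[OF bc(2)] dvd_mult[OF bc'(2)]])
  also have "\<dots> = (b * b') * (a + a') - X ^ n * (b' * X ^ k * c + b * X ^ k' * c')"
    by (simp add: algebra_simps power_add)
  finally show ?thesis
    unfolding n_def[symmetric] by (rule ordP_ge[OF assms(3), rotated]) (simp add: bc(1) bc'(1))
qed

lemma ordP_unit: assumes "eval2 a x0 y0 \<noteq> 0" shows "ordP a = 0"
proof (rule ord_relI)
  show "ord_rel a 0" unfolding ord_rel_def
    by (rule exI[of _ 1], rule exI[of _ a]) (simp add: assms)
qed

lemma ordP_X: "ordP X = 1"
proof (rule ord_relI)
  show "ord_rel X 1" unfolding ord_rel_def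
    by (rule exI[of _ 1], rule exI[of _ 1]) simp
qed

text \<open>The fraction that represents \<open>r\<close> is determined only up to a common factor, which contributes to
  both orders equally.\<close>

definition point_val :: "complex poly poly fract \<Rightarrow> int" where
  "point_val r = (THE m. \<exists>a b. r = Fract a b \<and> \<not> f dvd a \<and> \<not> f dvd b
     \<and> m = int (ordP a) - int (ordP b))"

lemma point_val_Fract:
  assumes "\<not> f dvd a" "\<not> f dvd b"
  shows "point_val (Fract a b) = int (ordP a) - int (ordP b)"
  unfolding point_val_def
proof (rule the_equality)
  fix m assume "\<exists>a' b'. Fract a b = Fract a' b' \<and> \<not> f dvd a' \<and> \<not> f dvd b'
     \<and> m = int (ordP a') - int (ordP b')"
  then obtain a' b' where ab': "Fract a b = Fract a' b'" "\<not> f dvd a'" "\<not> f dvd b'"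
    "m = int (ordP a') - int (ordP b')" by blast
  have "a * b' = a' * b" using ab' assms by (simp add: eq_fract not_dvd_nz)
  hence "ordP a + ordP b' = ordP a' + ordP b" using ordP_mult assms ab' by metis
  thus "m = int (ordP a) - int (ordP b)" using ab'(4) by simp
qed (use assms in blast)

lemma unitE:
  assumes "r \<in> loc_ring" "r \<notin> max_ideal"
  obtains a b where "r = Fract a b" "\<not> f dvd a" "\<not> f dvd b"
  using assms by (metis Fract_max_ideal_iff loc_ringE)

lemma point_val_mult:
  assumes "r \<in> loc_ring" "r \<notin> max_ideal" "s \<in> loc_ring" "s \<notin> max_ideal"
  shows "point_val (r * s) = point_val r + point_val s"
proof -
  obtain a b where "r = Fract a b" "\<not> f dvd a" "\<not> f dvd b" using assms(1,2) by (rule unitE)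
  moreover obtain c d where "s = Fract c d" "\<not> f dvd c" "\<not> f dvd d"
    using assms(3,4) by (rule unitE)
  ultimately show ?thesis by (simp add: point_val_Fract ordP_mult dvd_mult_iff)
qed

lemma point_val_add:
  assumes "r \<in> loc_ring" "r \<notin> max_ideal" "s \<in> loc_ring" "s \<notin> max_ideal" "r + s \<notin> max_ideal"
  shows "min (point_val r) (point_val s) \<le> point_val (r + s)"
proof -
  obtain a b where ab: "r = Fract a b" "\<not> f dvd a" "\<not> f dvd b" using assms(1,2) by (rule unitE)
  obtain c d where cd: "s = Fract c d" "\<not> f dvd c" "\<not> f dvd d" using assms(3,4) by (rule unitE)
  have sum: "r + s = Fract (a * d + c * b) (b * d)" using ab cd by (simp add: not_dvd_nz)
  have nd: "\<not> f dvd a * d + c * b" "\<not> f dvd b * d" "\<not> f dvd a * d" "\<not> f dvd c * b"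
    using assms(5) ab cd unfolding sum by (auto simp: Fract_max_ideal_iff dvd_mult_iff)
  show ?thesis
    using ordP_add[OF nd(3,4,1)] ab cd nd unfolding sum
    by (simp add: point_val_Fract ordP_mult min_def split: if_splits)
qed

lemma point_val_cong:
  assumes "r \<in> loc_ring" "r \<notin> max_ideal" "s \<in> loc_ring" "r - s \<in> max_ideal"
  shows "point_val r = point_val s"
proof -
  have s: "s \<notin> max_ideal"
    using max_ideal_add[OF assms(4), of s] assms(2) by auto
  obtain a b where ab: "r = Fract a b" "\<not> f dvd a" "\<not> f dvd b" using assms(1,2) by (rule unitE)
  obtain c d where cd: "s = Fract c d" "\<not> f dvd c" "\<not> f dvd d" using assms(3) s by (rule unitE)
  have "r - s = Fract (a * d - c * b) (b * d)" using ab cd by (simp add: not_dvd_nz)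
  hence "f dvd a * d - c * b" using assms(4) ab cd by (simp add: Fract_max_ideal_iff dvd_mult_iff)
  hence "ordP (a * d) = ordP (c * b)" using ab cd by (intro ordP_cong) (simp_all add: dvd_mult_iff)
  thus ?thesis using ab cd by (simp add: point_val_Fract ordP_mult)
qed

lemma point_val_const: "c \<noteq> 0 \<Longrightarrow> point_val (const c) = 0"
  unfolding const_def by (subst point_val_Fract) (auto simp: ordP_unit not_dvd_of_eval)

lemma point_val_X: "point_val (Fract X 1) = 1"
  by (subst point_val_Fract) (auto simp: ordP_unit ordP_X not_dvd_1 not_dvd_X)

lemma X_notin: "Fract X 1 \<notin> max_ideal"
  by (simp add: Fract_max_ideal_iff not_dvd_1 not_dvd_X)

text \<open>The constant is the value of \<open>r\<close> at the point. If \<open>a\<close> and \<open>b\<close> are both unit multiples of the \<open>n\<close>-th power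
  of the parameter, it is the quotient of the values of these units.\<close>

lemma point_val_residue:
  assumes "r \<in> loc_ring" "r \<notin> max_ideal" "0 \<le> point_val r"
  shows "\<exists>c. r - const c \<in> max_ideal \<or> 0 < point_val (r - const c)"
proof (cases "point_val r = 0")
  case False
  thus ?thesis using assms by (intro exI[of _ 0]) (simp add: const_def fract_collapse)
next
  case True
  obtain a b where ab: "r = Fract a b" "\<not> f dvd a" "\<not> f dvd b" using assms(1,2) by (rule unitE)
  have "ordP a = ordP b" using True ab by (simp add: point_val_Fract)
  then obtain n where n: "ordP a = n" "ordP b = n" by simp
  obtain b1 c1 where 1: "eval2 b1 x0 y0 \<noteq> 0" "eval2 c1 x0 y0 \<noteq> 0" "f dvd b1 * a - X ^ n * c1"
    using ord_rel_ordP[OF ab(2)] unfolding ord_rel_def n by blast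
  obtain b2 c2 where 2: "eval2 b2 x0 y0 \<noteq> 0" "eval2 c2 x0 y0 \<noteq> 0" "f dvd b2 * b - X ^ n * c2"
    using ord_rel_ordP[OF ab(3)] unfolding ord_rel_def n by blast
  define c where "c = eval2 (c1 * b2) x0 y0 / eval2 (c2 * b1) x0 y0"
  define C where "C = [:[:c:]:]"
  have diff: "r - const c = Fract (a - C * b) b"
    unfolding const_def ab C_def using ab(3) by (simp add: not_dvd_nz)
  show ?thesis
  proof (cases "f dvd a - C * b")
    case True
    hence "r - const c \<in> max_ideal" using ab(3) unfolding diff by (simp add: Fract_max_ideal_iff)
    thus ?thesis by blast
  next
    case False
    have "eval2 (c1 * b2 - C * c2 * b1) x0 y0 = 0"
    proof -
      have "eval2 C x0 y0 = c" by (simp add: C_def)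
      thus ?thesis using 1 2 by (simp only: eval2_hom) (simp add: c_def)
    qed
    then obtain b3 c3 where 3: "eval2 b3 x0 y0 \<noteq> 0" "f dvd b3 * (c1 * b2 - C * c2 * b1) - X * c3"
      using uniformizer_step by blast
    have "f dvd b3 * b2 * (b1 * a - X ^ n * c1) - b3 * C * b1 * (b2 * b - X ^ n * c2)
        + X ^ n * (b3 * (c1 * b2 - C * c2 * b1) - X * c3)"
      by (rule dvd_add[OF dvd_diff[OF dvd_mult[OF 1(3)] dvd_mult[OF 2(3)]] dvd_mult[OF 3(2)]])
    also have "\<dots> = (b1 * b2 * b3) * (a - C * b) - X ^ Suc n * c3"
      by (simp add: algebra_simps)
    finally have "Suc n \<le> ordP (a - C * b)"
      using 1 2 3 by (intro ordP_ge[OF False]) auto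
    hence "0 < point_val (r - const c)" using False ab n unfolding diff by (simp add: point_val_Fract)
    thus ?thesis by blast
  qed
qed

end

section \<open>The function field and its places\<close>

context prime_curve begin

abbreviation Kf where "Kf \<equiv> function_field f"
abbreviation kf where "kf \<equiv> curve_constants f"

definition res :: "complex poly poly fract \<Rightarrow> complex poly poly fract set" where
  "res r = max_ideal +>\<^bsub>curve_local_ring f\<^esub> r"

lemma loc_ring_simps [simp]:
  "mult (curve_local_ring f) = (*)" "one (curve_local_ring f) = 1"
  "ring.zero (curve_local_ring f) = 0" "ring.add (curve_local_ring f) = (+)"
  by (simp_all add: curve_local_ring_def)

lemma loc_ring_cring: "cring (curve_local_ring f)"
proof (rule cringI)
  show "abelian_group (curve_local_ring f)"
  proof (rule abelian_groupI)
    fix x assume "x \<in> loc_ring"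
    thus "\<exists>y\<in>loc_ring. y \<oplus>\<^bsub>curve_local_ring f\<^esub> x = \<zero>\<^bsub>curve_local_ring f\<^esub>"
      by (intro bexI[of _ "- x"]) auto
  qed (auto simp: add_ac)
  show "comm_monoid (curve_local_ring f)"
    by (rule comm_monoidI) (auto simp: mult_ac)
qed (auto simp: algebra_simps)

lemma max_ideal_ideal: "ideal max_ideal (curve_local_ring f)"
proof (rule idealI)
  show "ring (curve_local_ring f)" using loc_ring_cring by (rule cring.axioms)
  interpret cring "curve_local_ring f" by (rule loc_ring_cring)
  have um: "\<ominus>\<^bsub>curve_local_ring f\<^esub> x = - x" if "x \<in> loc_ring" for x
    by (rule minus_equality) (use that in auto)
  show "subgroup max_ideal (add_monoid (curve_local_ring f))"
  proof (rule subgroup.intro)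
    fix x assume x: "x \<in> max_ideal"
    have "inv\<^bsub>add_monoid (curve_local_ring f)\<^esub> x = - x"
      using um[OF max_ideal_subset[OF x]] unfolding a_inv_def .
    thus "inv\<^bsub>add_monoid (curve_local_ring f)\<^esub> x \<in> max_ideal" using x by auto
  qed (auto simp: max_ideal_subset)
qed (auto simp: max_ideal_mult_iff max_ideal_subset)

sublocale LR: ideal max_ideal "curve_local_ring f" by (rule max_ideal_ideal)

lemma max_ideal_maximal: "maximalideal max_ideal (curve_local_ring f)"
proof (rule maximalidealI[OF max_ideal_ideal])
  show "loc_ring \<noteq> max_ideal" using one_notin_max_ideal loc_ring_1 by blast
next
  fix J assume J: "ideal J (curve_local_ring f)" "max_ideal \<subseteq> J" "J \<subseteq> loc_ring"
  show "J = max_ideal \<or> J = loc_ring"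
  proof (cases "J \<subseteq> max_ideal")
    case False
    then obtain r where r: "r \<in> J" "r \<notin> max_ideal" by blast
    hence rR: "r \<in> loc_ring" and "r \<noteq> 0" using J by auto
    have "r * inverse r \<in> J"
      using ideal.I_r_closed[OF J(1) r(1) inverse_loc_ring[OF rR r(2)]] by simp
    hence "\<one>\<^bsub>curve_local_ring f\<^esub> \<in> J" using \<open>r \<noteq> 0\<close> by simp
    thus ?thesis using ideal.one_imp_carrier[OF J(1)] by blast
  qed (use J in blast)
qed

lemma function_field_field: "field Kf"
  unfolding function_field_def
  by (rule maximalideal.quotient_is_field[OF max_ideal_maximal loc_ring_cring])

sublocale KF: field Kf by (rule function_field_field)

lemma res_ring_hom: "res \<in> ring_hom (curve_local_ring f) Kf"
  unfolding function_field_def res_def by (rule LR.rcos_ring_hom)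

lemma res_mem: "res r = {i + r | i. i \<in> max_ideal}"
  unfolding res_def a_r_coset_def' by auto

lemma res_eq_iff: "res r = res s \<longleftrightarrow> r - s \<in> max_ideal"
proof
  assume "res r = res s"
  moreover have "r \<in> res r" unfolding res_mem using max_ideal_0 by force
  ultimately obtain i where "i \<in> max_ideal" "r = i + s" unfolding res_mem by blast
  thus "r - s \<in> max_ideal" by simp
next
  assume a: "r - s \<in> max_ideal"
  have "\<exists>j. i + r = j + s \<and> j \<in> max_ideal" if "i \<in> max_ideal" for i
    using max_ideal_add[OF that a] by (intro exI[of _ "i + (r - s)"]) simp
  moreover have "\<exists>j. i + s = j + r \<and> j \<in> max_ideal" if "i \<in> max_ideal" for i
    using max_ideal_diff[OF that a] by (intro exI[of _ "i - (r - s)"]) simp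
  ultimately show "res r = res s" unfolding res_mem by blast
qed

lemma res_closed [simp]: "r \<in> loc_ring \<Longrightarrow> res r \<in> carrier Kf"
  by (rule ring_hom_closed[OF res_ring_hom])

lemma res_mult: "r \<in> loc_ring \<Longrightarrow> s \<in> loc_ring \<Longrightarrow> res r \<otimes>\<^bsub>Kf\<^esub> res s = res (r * s)"
  using ring_hom_mult[OF res_ring_hom, of r s] by simp

lemma res_add: "r \<in> loc_ring \<Longrightarrow> s \<in> loc_ring \<Longrightarrow> res r \<oplus>\<^bsub>Kf\<^esub> res s = res (r + s)"
  using ring_hom_add[OF res_ring_hom, of r s] by simp

lemma res_one: "\<one>\<^bsub>Kf\<^esub> = res 1"
  using ring_hom_one[OF res_ring_hom] by simp

lemma res_zero: "\<zero>\<^bsub>Kf\<^esub> = res 0"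
proof -
  have "\<zero>\<^bsub>Kf\<^esub> = max_ideal" by (simp add: function_field_def FactRing_def)
  also have "\<dots> = res 0" unfolding res_mem by simp
  finally show ?thesis .
qed

lemma res_eq_zero_iff: "res r = \<zero>\<^bsub>Kf\<^esub> \<longleftrightarrow> r \<in> max_ideal"
  unfolding res_zero res_eq_iff by simp

lemma carrier_Kf: "carrier Kf = res ` loc_ring"
  unfolding function_field_def res_def FactRing_def A_RCOSETS_def' by auto

lemma const_hom [simp]:
  "const 0 = 0" "const 1 = 1" "const (a + b) = const a + const b"
  "const (a - b) = const a - const b" "const (- a) = - const a" "const (a * b) = const a * const b"
  by (simp_all add: const_def Zero_fract_def One_fract_def one_pCons)

lemma const_loc_ring [simp, intro]: "const c \<in> loc_ring"
  by (simp add: const_def)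

lemma const_max_ideal_iff [simp]: "const c \<in> max_ideal \<longleftrightarrow> c = 0"
proof
  assume c: "const c \<in> max_ideal"
  show "c = 0"
  proof (rule ccontr)
    assume "c \<noteq> 0"
    hence "const c * const (1 / c) = 1" unfolding const_hom(6)[symmetric] by (simp del: const_hom(6))
    thus False using c max_ideal_mult_iff[of "const c" "const (1/c)"] by auto
  qed
qed simp

lemma curve_constants_eq: "kf = res ` range const"
  unfolding curve_constants_def res_def const_def by auto

lemma curve_constants_subfield: "subfield kf Kf"
proof (rule KF.subfieldI')
  show "subring kf Kf"
  proof (rule KF.subringI)
    show "kf \<subseteq> carrier Kf" by (auto simp: curve_constants_eq)
    show "\<one>\<^bsub>Kf\<^esub> \<in> kf" unfolding res_one curve_constants_eq using const_hom(2) by (metis imageI rangeI)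
  next
    fix h assume "h \<in> kf"
    then obtain c where c: "h = res (const c)" by (auto simp: curve_constants_eq)
    have "\<ominus>\<^bsub>Kf\<^esub> h = res (const (- c))"
    proof (rule KF.minus_equality)
      have "const (- c) \<in> loc_ring" by (rule const_loc_ring)
      thus "res (const (- c)) \<in> carrier Kf" by (rule res_closed)
      show "res (const (- c)) \<oplus>\<^bsub>Kf\<^esub> h = \<zero>\<^bsub>Kf\<^esub>"
        using res_add[OF \<open>const (- c) \<in> loc_ring\<close> const_loc_ring[of c]] by (simp add: c res_zero)
    qed (simp add: c)
    thus "\<ominus>\<^bsub>Kf\<^esub> h \<in> kf" unfolding curve_constants_eq by blast
  next
    fix h1 h2 assume "h1 \<in> kf" "h2 \<in> kf"
    then obtain c d where c: "h1 = res (const c)" "h2 = res (const d)"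
      by (auto simp: curve_constants_eq)
    have "h1 \<otimes>\<^bsub>Kf\<^esub> h2 = res (const (c * d))" "h1 \<oplus>\<^bsub>Kf\<^esub> h2 = res (const (c + d))"
      by (simp_all add: c res_mult res_add)
    thus "h1 \<otimes>\<^bsub>Kf\<^esub> h2 \<in> kf" "h1 \<oplus>\<^bsub>Kf\<^esub> h2 \<in> kf" unfolding curve_constants_eq by blast+
  qed
next
  fix h assume h: "h \<in> kf - {\<zero>\<^bsub>Kf\<^esub>}"
  then obtain c where c: "h = res (const c)" by (auto simp: curve_constants_eq)
  hence c0: "c \<noteq> 0" using h res_eq_zero_iff by auto
  have "const (1 / c * c) = 1" "const (c * (1 / c)) = 1" using c0 by (simp_all del: const_hom(6))
  hence 1: "const (1 / c) * const c = 1" "const c * const (1 / c) = 1"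
    by (simp_all only: const_hom(6))
  have "inv\<^bsub>Kf\<^esub> h = res (const (1 / c))"
    by (rule KF.inv_char) (simp_all add: c res_mult 1 res_one)
  thus "inv\<^bsub>Kf\<^esub> h \<in> kf" unfolding curve_constants_eq by blast
qed

text \<open>A place of the function field, read on representatives in the local ring. The third condition
  says that the value depends on the residue class only.\<close>

definition is_valuation :: "(complex poly poly fract \<Rightarrow> int) \<Rightarrow> bool" where
  "is_valuation w \<longleftrightarrow>
     (\<forall>r s. r \<in> loc_ring - max_ideal \<longrightarrow> s \<in> loc_ring - max_ideal \<longrightarrow> w (r * s) = w r + w s) \<and>
     (\<forall>r s. r \<in> loc_ring - max_ideal \<longrightarrow> s \<in> loc_ring - max_ideal \<longrightarrow> r + s \<notin> max_ideal \<longrightarrow>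
        min (w r) (w s) \<le> w (r + s)) \<and>
     (\<forall>r s. r \<in> loc_ring - max_ideal \<longrightarrow> s \<in> loc_ring \<longrightarrow> r - s \<in> max_ideal \<longrightarrow> w r = w s) \<and>
     (\<forall>c. c \<noteq> 0 \<longrightarrow> w (const c) = 0) \<and>
     (\<exists>r. r \<in> loc_ring - max_ideal \<and> w r = 1)"

lemma is_valuationD:
  assumes "is_valuation w"
  shows "r \<in> loc_ring - max_ideal \<Longrightarrow> s \<in> loc_ring - max_ideal \<Longrightarrow> w (r * s) = w r + w s"
    and "r \<in> loc_ring - max_ideal \<Longrightarrow> s \<in> loc_ring - max_ideal \<Longrightarrow> r + s \<notin> max_ideal \<Longrightarrow>
        min (w r) (w s) \<le> w (r + s)"
    and "r \<in> loc_ring - max_ideal \<Longrightarrow> s \<in> loc_ring \<Longrightarrow> r - s \<in> max_ideal \<Longrightarrow> w r = w s"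
    and "c \<noteq> 0 \<Longrightarrow> w (const c) = 0"
  using assms unfolding is_valuation_def by blast+

lemma nonzero_Kf_iff: "X \<in> carrier Kf - {\<zero>\<^bsub>Kf\<^esub>} \<longleftrightarrow> (\<exists>r \<in> loc_ring - max_ideal. X = res r)"
  unfolding carrier_Kf using res_eq_zero_iff by auto

lemma place_valuation:
  assumes "v \<in> places Kf kf"
  shows "is_valuation (\<lambda>r. v (res r))"
  unfolding is_valuation_def
proof (intro conjI allI impI)
  have M: "v (x \<otimes>\<^bsub>Kf\<^esub> y) = v x + v y" "x \<oplus>\<^bsub>Kf\<^esub> y \<noteq> \<zero>\<^bsub>Kf\<^esub> \<Longrightarrow> min (v x) (v y) \<le> v (x \<oplus>\<^bsub>Kf\<^esub> y)"
    if "x \<in> carrier Kf - {\<zero>\<^bsub>Kf\<^esub>}" "y \<in> carrier Kf - {\<zero>\<^bsub>Kf\<^esub>}" for x y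
    using assms that unfolding places_def by blast+
  show "v (res (r * s)) = v (res r) + v (res s)"
    if "r \<in> loc_ring - max_ideal" "s \<in> loc_ring - max_ideal" for r s
    using M(1)[of "res r" "res s"] that by (auto simp: res_mult res_eq_zero_iff)
  show "min (v (res r)) (v (res s)) \<le> v (res (r + s))"
    if "r \<in> loc_ring - max_ideal" "s \<in> loc_ring - max_ideal" "r + s \<notin> max_ideal" for r s
    using M(2)[of "res r" "res s"] that by (auto simp: res_add res_eq_zero_iff)
  show "v (res r) = v (res s)" if "r - s \<in> max_ideal" for r s
    using that res_eq_iff by metis
  show "v (res (const c)) = 0" if "c \<noteq> 0" for c
  proof -
    have "res (const c) \<in> kf - {\<zero>\<^bsub>Kf\<^esub>}"
      using that by (auto simp: curve_constants_eq res_eq_zero_iff)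
    thus ?thesis using assms unfolding places_def by blast
  qed
  show "\<exists>r. r \<in> loc_ring - max_ideal \<and> v (res r) = 1"
  proof -
    have "\<exists>x\<in>carrier Kf - {\<zero>\<^bsub>Kf\<^esub>}. v x = 1" using assms unfolding places_def by blast
    thus ?thesis using nonzero_Kf_iff by metis
  qed
qed

definition place_of :: "(complex poly poly fract \<Rightarrow> int) \<Rightarrow> complex poly poly fract set \<Rightarrow> int" where
  "place_of w = restrict (\<lambda>X. w (SOME r. r \<in> loc_ring \<and> res r = X)) (carrier Kf - {\<zero>\<^bsub>Kf\<^esub>})"

lemma place_of_res:
  assumes w: "is_valuation w" and r: "r \<in> loc_ring - max_ideal"
  shows "place_of w (res r) = w r"
proof -
  define s where "s = (SOME s. s \<in> loc_ring \<and> res s = res r)"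
  have s: "s \<in> loc_ring \<and> res s = res r" unfolding s_def by (rule someI[of _ r]) (use r in simp)
  have "r - s \<in> max_ideal" using s res_eq_iff by metis
  hence "w r = w s" using is_valuationD(3)[OF w r] s by blast
  moreover have "res r \<in> carrier Kf - {\<zero>\<^bsub>Kf\<^esub>}" using r nonzero_Kf_iff by blast
  ultimately show ?thesis unfolding place_of_def s_def by simp
qed

lemma place_of_place:
  assumes w: "is_valuation w"
  shows "place_of w \<in> places Kf kf"
  unfolding places_def
proof (intro CollectI conjI ballI impI)
  show "place_of w \<in> extensional (carrier Kf - {\<zero>\<^bsub>Kf\<^esub>})" by (simp add: place_of_def)
next
  fix x y assume "x \<in> carrier Kf - {\<zero>\<^bsub>Kf\<^esub>}" "y \<in> carrier Kf - {\<zero>\<^bsub>Kf\<^esub>}"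
  then obtain r s where rs: "r \<in> loc_ring - max_ideal" "x = res r" "s \<in> loc_ring - max_ideal" "y = res s"
    using nonzero_Kf_iff by metis
  hence "r * s \<in> loc_ring - max_ideal" using max_ideal_mult_iff by auto
  thus "place_of w (x \<otimes>\<^bsub>Kf\<^esub> y) = place_of w x + place_of w y"
    using rs is_valuationD(1)[OF w] by (simp add: res_mult place_of_res[OF w])
  assume "x \<oplus>\<^bsub>Kf\<^esub> y \<noteq> \<zero>\<^bsub>Kf\<^esub>"
  hence "r + s \<in> loc_ring - max_ideal" using rs by (auto simp: res_add res_eq_zero_iff)
  thus "min (place_of w x) (place_of w y) \<le> place_of w (x \<oplus>\<^bsub>Kf\<^esub> y)"
    using rs is_valuationD(2)[OF w] by (simp add: res_add place_of_res[OF w])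
next
  fix c assume "c \<in> kf - {\<zero>\<^bsub>Kf\<^esub>}"
  then obtain a where a: "c = res (const a)" "const a \<notin> max_ideal"
    using res_eq_zero_iff unfolding curve_constants_eq by blast
  hence "place_of w c = w (const a)" by (simp add: place_of_res[OF w])
  thus "place_of w c = 0" using is_valuationD(4)[OF w, of a] a(2) by simp
next
  obtain r where r: "r \<in> loc_ring - max_ideal" "w r = 1" using w unfolding is_valuation_def by blast
  hence "res r \<in> carrier Kf - {\<zero>\<^bsub>Kf\<^esub>}" using nonzero_Kf_iff by blast
  thus "\<exists>x\<in>carrier Kf - {\<zero>\<^bsub>Kf\<^esub>}. place_of w x = 1"
    using place_of_res[OF w r(1)] r(2) by auto
qed

definition cpoly :: "complex poly \<Rightarrow> complex poly poly fract \<Rightarrow> complex poly poly fract" where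
  "cpoly p g = poly (map_poly const p) g"

lemma map_poly_const_hom:
  "map_poly const (p + q) = map_poly const p + map_poly const q"
  "map_poly const (Polynomial.smult c p) = Polynomial.smult (const c) (map_poly const p)"
  by (rule poly_eqI, simp add: coeff_map_poly)+

lemma cpoly_0 [simp]: "cpoly 0 g = 0"
  by (simp add: cpoly_def)

lemma cpoly_pCons [simp]: "cpoly (pCons c p) g = const c + g * cpoly p g"
  by (simp add: cpoly_def map_poly_pCons)

lemma cpoly_add [simp]: "cpoly (p + q) g = cpoly p g + cpoly q g"
  by (simp add: cpoly_def map_poly_const_hom)

lemma cpoly_smult [simp]: "cpoly (Polynomial.smult c p) g = const c * cpoly p g"
  by (simp add: cpoly_def map_poly_const_hom)

lemma cpoly_mult [simp]: "cpoly (p * q) g = cpoly p g * cpoly q g"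
  by (induction p) (simp_all add: algebra_simps)

lemma cpoly_diff [simp]: "cpoly (p - q) g = cpoly p g - cpoly q g"
  using cpoly_add[of "p - q" q g] by simp

lemma cpoly_monom [simp]: "cpoly (Polynomial.monom c n) g = const c * g ^ n"
  by (induction n) (simp_all add: monom_0 monom_Suc)

lemma loc_ring_power [intro]: "g \<in> loc_ring \<Longrightarrow> g ^ n \<in> loc_ring"
  by (induction n) auto

lemma cpoly_loc_ring [intro]: "g \<in> loc_ring \<Longrightarrow> cpoly p g \<in> loc_ring"
  by (induction p) auto

lemma max_ideal_power_iff: "g \<in> loc_ring \<Longrightarrow> g ^ n \<in> max_ideal \<longleftrightarrow> g \<in> max_ideal \<and> n > 0"
  by (induction n) (auto simp: max_ideal_mult_iff loc_ring_power)

text \<open>A complex polynomial splits into linear factors, and none of them vanishes at a nonconstant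
  element.\<close>

lemma cpoly_transcendental:
  assumes g: "g \<in> loc_ring" "\<And>c. g - const c \<notin> max_ideal" and p: "p \<noteq> 0"
  shows "cpoly p g \<notin> max_ideal"
  using p
proof (induction "degree p" arbitrary: p)
  case 0
  then obtain c where "p = [:c:]" "c \<noteq> 0" by (metis degree_eq_zeroE pCons_0_0)
  thus ?case by simp
next
  case (Suc n)
  obtain z where "poly p z = 0"
    using Suc(2) fundamental_theorem_of_algebra_alt[of p] by (metis degree_pCons_0 nat.distinct(1) poly_eq_0_iff_dvd)
  then obtain q where q: "p = [:-z,1:] * q" by (auto simp: poly_eq_0_iff_dvd elim: dvdE)
  have "q \<noteq> 0" using q Suc by auto
  hence "degree p = Suc (degree q)" unfolding q by (subst degree_mult_eq) auto
  hence IH: "cpoly q g \<notin> max_ideal" using Suc \<open>q \<noteq> 0\<close> by auto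
  have "cpoly p g = (g - const z) * cpoly q g"
    unfolding q cpoly_mult by simp
  thus ?case using IH g max_ideal_mult_iff[of "g - const z" "cpoly q g"] by auto
qed

text \<open>The highest power comes first, because \<open>KF.independent\<close> builds lists from the right.\<close>

fun powers :: "complex poly poly fract \<Rightarrow> nat \<Rightarrow> complex poly poly fract set list" where
  "powers g 0 = []"
| "powers g (Suc n) = res (g ^ n) # powers g n"

lemma Span_powers:
  assumes "g \<in> loc_ring" and "X \<in> KF.Span kf (powers g n)"
  shows "\<exists>p. X = res (cpoly p g) \<and> (p = 0 \<or> degree p < n)"
  using assms(2)
proof (induction n arbitrary: X)
  case 0
  thus ?case using res_zero by (intro exI[of _ 0]) simp
next
  case (Suc n)
  then obtain c v where cv: "c \<in> kf" "v \<in> KF.Span kf (powers g n)" "X = c \<otimes>\<^bsub>Kf\<^esub> res (g ^ n) \<oplus>\<^bsub>Kf\<^esub> v"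
    using KF.line_extension_mem_iff by auto
  then obtain p where p: "v = res (cpoly p g)" "p = 0 \<or> degree p < n" using Suc.IH by blast
  obtain a where a: "c = res (const a)" using cv(1) by (auto simp: curve_constants_eq)
  have "X = res (cpoly (Polynomial.monom a n + p) g)"
    unfolding cv(3) a p(1) using assms(1)
    by (simp add: res_mult res_add loc_ring_power cpoly_loc_ring loc_ring_mult)
  moreover have "degree (Polynomial.monom a n + p) < Suc n"
    by (rule le_imp_less_Suc, rule degree_add_le) (use p(2) in \<open>auto simp: degree_monom_le\<close>)
  ultimately show ?case by blast
qed

lemma powers_independent:
  assumes g: "g \<in> loc_ring" "\<And>c. g - const c \<notin> max_ideal"
  shows "KF.independent kf (powers g n)"
proof (induction n)
  case (Suc n)
  have "res (g ^ n) \<notin> KF.Span kf (powers g n)"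
  proof
    assume "res (g ^ n) \<in> KF.Span kf (powers g n)"
    then obtain p where p: "res (g ^ n) = res (cpoly p g)" "p = 0 \<or> degree p < n"
      using Span_powers[OF g(1)] by blast
    have "cpoly (Polynomial.monom 1 n - p) g \<in> max_ideal" using p(1) res_eq_iff by simp
    hence "Polynomial.monom 1 n - p = 0" using cpoly_transcendental[OF g] by blast
    hence "p = Polynomial.monom 1 n" by simp
    thus False using p(2) by (auto simp: degree_monom_eq)
  qed
  thus ?case using Suc g(1) by (auto intro!: KF.independent.intros simp: loc_ring_power)
qed (simp add: KF.independent.intros)

end

section \<open>Riemann-Roch spaces in genus zero\<close>

context smooth_point begin

lemma point_val_valuation: "is_valuation point_val"
  unfolding is_valuation_def
proof (intro conjI allI impI)
  show "\<exists>r. r \<in> loc_ring - max_ideal \<and> point_val r = 1"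
    using point_val_X X_notin by (intro exI[of _ "Fract X 1"]) simp
qed (auto simp: point_val_mult point_val_add point_val_const intro: point_val_cong)

lemma valuation_power:
  assumes "is_valuation w" "g \<in> loc_ring - max_ideal"
  shows "w (g ^ n) = int n * w g"
proof (induction n)
  case 0
  show ?case using is_valuationD(4)[OF assms(1), of 1] by simp
next
  case (Suc n)
  have "g ^ n \<in> loc_ring - max_ideal" using assms by (auto simp: max_ideal_power_iff loc_ring_power)
  thus ?case using Suc is_valuationD(1)[OF assms, of "g ^ n"] by (simp add: algebra_simps)
qed

definition point_div :: "nat \<Rightarrow> (complex poly poly fract set \<Rightarrow> int) \<Rightarrow> int" where
  "point_div N = (\<lambda>v. if v = place_of point_val then int N else 0)"

lemma point_div_support: "{v. point_div N v \<noteq> 0} = (if N = 0 then {} else {place_of point_val})"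
  by (auto simp: point_div_def)

lemma point_div_divisor: "point_div N \<in> divisors Kf kf"
  unfolding divisors_def mem_Collect_eq point_div_support
  by (simp add: place_of_place[OF point_val_valuation])

lemma point_div_degree: "divisor_degree (point_div N) = int N"
  unfolding divisor_degree_def point_div_support by (simp add: point_div_def)

abbreviation RR :: "nat \<Rightarrow> complex poly poly fract set set" where
  "RR N \<equiv> riemann_roch_space Kf kf (point_div N)"

lemma genus0_dim: "curve_has_genus f 0 \<Longrightarrow> int N + 1 \<le> int (ring.dim Kf kf (RR N))"
  unfolding curve_has_genus_def has_genus_def
  using point_div_divisor[of N] point_div_degree[of N] by fastforce

text \<open>On every infinite dimensional space \<open>ring.dim\<close> takes one and the same value \<open>u\<close>, the default
  value of a definite description that nothing satisfies. Riemann's inequality bounds the dimension of \<open>RR u\<close>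
  from below by \<open>u + 1\<close>, so this space cannot be infinite dimensional.\<close>

lemma genus0_finite_dim:
  assumes "curve_has_genus f 0"
  shows "\<exists>N. KF.finite_dimension kf (RR N)"
proof (rule ccontr)
  assume inf: "\<nexists>N. KF.finite_dimension kf (RR N)"
  define u :: nat where "u = (THE n. False)"
  have "\<not> KF.dimension n kf (RR u)" for n
    using inf unfolding KF.finite_dimension_def by blast
  hence "KF.dim kf (RR u) = u" unfolding KF.dim_def u_def by simp
  thus False using genus0_dim[OF assms, of u] by simp
qed

lemma RR_iff:
  assumes "r \<in> loc_ring - max_ideal"
  shows "res r \<in> RR N \<longleftrightarrow> (\<forall>v\<in>places Kf kf. 0 \<le> v (res r) + point_div N v)"
  using assms unfolding riemann_roch_space_def by (simp add: res_eq_zero_iff)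

text \<open>Otherwise all powers of \<open>g\<close> would be independent elements of a finite dimensional space \<open>RR N\<close>.\<close>

lemma genus0_regular_const:
  assumes genus: "curve_has_genus f 0" and g: "g \<in> loc_ring"
    and reg: "\<And>w. is_valuation w \<Longrightarrow> g \<notin> max_ideal \<Longrightarrow> 0 \<le> w g"
  shows "\<exists>c. g - const c \<in> max_ideal"
proof (rule ccontr)
  assume no: "\<nexists>c. g - const c \<in> max_ideal"
  have gI: "g \<notin> max_ideal" using no const_hom(1) by (metis diff_zero)
  obtain N where N: "KF.finite_dimension kf (RR N)" using genus0_finite_dim[OF genus] by blast
  then obtain d where d: "KF.dimension d kf (RR N)" unfolding KF.finite_dimension_def by blast
  have mem: "res (g ^ n) \<in> RR N" for n
  proof -
    have gn: "g ^ n \<in> loc_ring - max_ideal" using g gI by (auto simp: max_ideal_power_iff loc_ring_power)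
    show ?thesis unfolding RR_iff[OF gn]
    proof
      fix v assume "v \<in> places Kf kf"
      hence v: "is_valuation (\<lambda>r. v (res r))" by (rule place_valuation)
      have "0 \<le> v (res (g ^ n))" using valuation_power[OF v] reg[OF v gI] g gI by simp
      thus "0 \<le> v (res (g ^ n)) + point_div N v" by (simp add: point_div_def)
    qed
  qed
  have "set (powers g n) \<subseteq> RR N" for n by (induction n) (simp_all add: mem)
  moreover have "length (powers g n) = n" for n by (induction n) simp_all
  ultimately have "n \<le> d" for n
    using KF.independent_length_le_dimension[OF curve_constants_subfield d, of "powers g n"]
      powers_independent[OF g, of n] no by auto
  thus False using not_less_eq_eq by blast
qed

text \<open>If there were none, \<open>RR 1\<close> would consist of the constants and have dimension one, while Riemann's
  inequality asks for two.\<close>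

lemma genus0_simple_pole:
  assumes genus: "curve_has_genus f 0"
  shows "\<exists>g\<in>loc_ring. (\<forall>c. g - const c \<notin> max_ideal) \<and> -1 \<le> point_val g \<and>
    (\<forall>w. is_valuation w \<longrightarrow> (\<exists>r\<in>loc_ring - max_ideal. w r \<noteq> point_val r) \<longrightarrow> 0 \<le> w g)"
proof (rule ccontr)
  assume no: "\<not> ?thesis"
  have "RR 1 \<subseteq> kf"
  proof
    fix X assume X: "X \<in> RR 1"
    show "X \<in> kf"
    proof (rule ccontr)
      assume Xk: "X \<notin> kf"
      obtain g where g: "g \<in> loc_ring" "X = res g"
        using X carrier_Kf unfolding riemann_roch_space_def by blast
      have nc: "g - const c \<notin> max_ideal" for c
        using Xk g res_eq_iff by (auto simp: curve_constants_eq)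
      hence gI: "g \<notin> max_ideal" using const_hom(1) by (metis diff_zero)
      have v: "0 \<le> v (res g) + point_div 1 v" if "v \<in> places Kf kf" for v
        using X that g gI by (auto simp: RR_iff)
      have 1: "-1 \<le> point_val g"
        using v[OF place_of_place[OF point_val_valuation]] place_of_res[OF point_val_valuation, of g] g gI
        by (simp add: point_div_def)
      have 2: "0 \<le> w g" if w: "is_valuation w" and r: "r \<in> loc_ring - max_ideal" "w r \<noteq> point_val r" for w r
      proof -
        have "place_of w \<noteq> place_of point_val"
          using r place_of_res[OF w r(1)] place_of_res[OF point_val_valuation r(1)] by auto
        thus ?thesis using v[OF place_of_place[OF w]] place_of_res[OF w, of g] g gI
          by (simp add: point_div_def)
      qed
      show False using no nc g 1 2 by blast
    qed
  qed
  moreover have "kf \<subseteq> RR 1"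
  proof
    fix X assume "X \<in> kf"
    then obtain c where c: "X = res (const c)" by (auto simp: curve_constants_eq)
    show "X \<in> RR 1"
    proof (cases "c = 0")
      case True
      thus ?thesis unfolding c riemann_roch_space_def by (simp add: res_eq_zero_iff)
    next
      case False
      have "const c \<in> loc_ring - max_ideal" using False by simp
      have "0 \<le> v (res (const c)) + point_div 1 v" if "v \<in> places Kf kf" for v
        using is_valuationD(4)[OF place_valuation[OF that] False] by (simp add: point_div_def)
      thus ?thesis unfolding c RR_iff[OF \<open>const c \<in> loc_ring - max_ideal\<close>] by blast
    qed
  qed
  ultimately have "RR 1 = kf" by blast
  moreover have "KF.dim kf kf = 1"
    using KF.dimI[OF curve_constants_subfield KF.dimension_one[OF curve_constants_subfield]]
    by (simp add: over_def)
  ultimately show False using genus0_dim[OF genus, of 1] by simp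
qed

end

section \<open>Integrality and algebraic dependence\<close>

text \<open>Gaussian elimination without division: clear the last component with a pivot vector and recurse.\<close>

lemma linear_dependence:
  fixes v :: "'b \<Rightarrow> nat \<Rightarrow> 'a::idom"
  assumes "finite J" "card J = Suc n"
  shows "\<exists>d. (\<exists>j\<in>J. d j \<noteq> 0) \<and> (\<forall>i<n. (\<Sum>j\<in>J. d j * v j i) = 0)"
  using assms
proof (induction n arbitrary: J v)
  case 0
  then obtain j where "j \<in> J" by fastforce
  thus ?case by (intro exI[of _ "\<lambda>_. 1"]) auto
next
  case (Suc n)
  show ?case
  proof (cases "\<forall>j\<in>J. v j n = 0")
    case True
    obtain j0 where j0: "j0 \<in> J" using Suc.prems by fastforce
    obtain d where d: "\<exists>j\<in>J - {j0}. d j \<noteq> 0" "\<And>i. i < n \<Longrightarrow> (\<Sum>j\<in>J - {j0}. d j * v j i) = 0"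
      using Suc.IH[of "J - {j0}" v] Suc.prems j0 by auto
    define e where "e = d(j0 := 0)"
    have "(\<Sum>j\<in>J. e j * v j i) = 0" if "i < Suc n" for i
    proof (cases "i = n")
      case False
      have "(\<Sum>j\<in>J. e j * v j i) = (\<Sum>j\<in>J - {j0}. d j * v j i)"
        by (subst sum.remove[OF Suc.prems(1) j0]) (auto simp: e_def intro!: sum.cong)
      thus ?thesis using d(2) that False by simp
    qed (simp add: True)
    moreover have "\<exists>j\<in>J. e j \<noteq> 0" using d(1) by (auto simp: e_def)
    ultimately show ?thesis by blast
  next
    case False
    then obtain k where k: "k \<in> J" "v k n \<noteq> 0" by blast
    define v' where "v' = (\<lambda>j i. v k n * v j i - v j n * v k i)"
    obtain d where d: "\<exists>j\<in>J - {k}. d j \<noteq> 0" "\<And>i. i < n \<Longrightarrow> (\<Sum>j\<in>J - {k}. d j * v' j i) = 0"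
      using Suc.IH[of "J - {k}" v'] Suc.prems k by auto
    define e where "e = (\<lambda>j. if j = k then - (\<Sum>j\<in>J - {k}. d j * v j n) else v k n * d j)"
    have "(\<Sum>j\<in>J. e j * v j i) = 0" if "i < Suc n" for i
    proof -
      have "(\<Sum>j\<in>J. e j * v j i) = e k * v k i + (\<Sum>j\<in>J - {k}. e j * v j i)"
        by (rule sum.remove[OF Suc.prems(1) k(1)])
      also have "(\<Sum>j\<in>J - {k}. e j * v j i) = (\<Sum>j\<in>J - {k}. v k n * d j * v j i)"
        by (intro sum.cong) (auto simp: e_def)
      also have "e k * v k i + \<dots> = (\<Sum>j\<in>J - {k}. d j * v' j i)"
        by (simp add: e_def v'_def sum_distrib_left sum_subtractf algebra_simps)
      also have "\<dots> = 0"
      proof (cases "i = n")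
        case True
        thus ?thesis by (simp add: v'_def)
      qed (use d(2) that in simp)
      finally show ?thesis .
    qed
    moreover have "\<exists>j\<in>J. e j \<noteq> 0" using d(1) k(2) by (auto simp: e_def)
    ultimately show ?thesis by blast
  qed
qed

context prime_curve begin

text \<open>Valuation at least \<open>m\<close>, where elements of the maximal ideal have the value infinity.\<close>

definition vge :: "(complex poly poly fract \<Rightarrow> int) \<Rightarrow> int \<Rightarrow> complex poly poly fract \<Rightarrow> bool" where
  "vge w m r \<longleftrightarrow> r \<in> loc_ring \<and> (r \<notin> max_ideal \<longrightarrow> m \<le> w r)"

lemma vge_mono: "vge w m r \<Longrightarrow> n \<le> m \<Longrightarrow> vge w n r"
  unfolding vge_def by auto

lemma vge_max_ideal: "r \<in> max_ideal \<Longrightarrow> vge w m r"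
  unfolding vge_def by (simp add: max_ideal_subset)

lemma vge_add:
  assumes w: "is_valuation w" and r: "vge w m r" and s: "vge w m s"
  shows "vge w m (r + s)"
proof -
  have RS: "r \<in> loc_ring" "s \<in> loc_ring" using r s unfolding vge_def by auto
  hence rs: "r + s \<in> loc_ring" by blast
  have "m \<le> w (r + s)" if n: "r + s \<notin> max_ideal"
  proof (cases "r \<in> max_ideal")
    case True
    hence "s \<notin> max_ideal" using n by blast
    hence "w s = w (r + s)"
      using True RS rs by (intro is_valuationD(3)[OF w]) (auto simp: max_ideal_uminus)
    thus ?thesis using s \<open>s \<notin> max_ideal\<close> unfolding vge_def by simp
  next
    case False
    show ?thesis
    proof (cases "s \<in> max_ideal")
      case True
      hence "w r = w (r + s)"
        using False RS rs by (intro is_valuationD(3)[OF w]) (auto simp: max_ideal_uminus)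
      thus ?thesis using r False unfolding vge_def by simp
    next
      case sI: False
      have "min (w r) (w s) \<le> w (r + s)"
        using RS False sI n by (intro is_valuationD(2)[OF w]) auto
      thus ?thesis using r s False sI unfolding vge_def by auto
    qed
  qed
  thus ?thesis using rs unfolding vge_def by blast
qed

lemma vge_mult:
  assumes w: "is_valuation w" and r: "vge w m r" and s: "vge w n s"
  shows "vge w (m + n) (r * s)"
proof -
  have RS: "r \<in> loc_ring" "s \<in> loc_ring" using r s unfolding vge_def by auto
  have "m + n \<le> w (r * s)" if "r * s \<notin> max_ideal"
  proof -
    have "r \<notin> max_ideal" "s \<notin> max_ideal" using that RS max_ideal_mult_iff by auto
    thus ?thesis using is_valuationD(1)[OF w, of r s] r s RS unfolding vge_def by auto
  qed
  thus ?thesis using RS unfolding vge_def by blast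
qed

lemma vge_const: "is_valuation w \<Longrightarrow> vge w 0 (const c)"
  unfolding vge_def using is_valuationD(4)[of w c] by (cases "c = 0") auto

lemma vge_uminus: assumes "is_valuation w" "vge w m r" shows "vge w m (- r)"
  using vge_mult[OF assms(1) vge_const[OF assms(1), of "-1"] assms(2)] by simp

lemma vge_diff: "is_valuation w \<Longrightarrow> vge w m r \<Longrightarrow> vge w m s \<Longrightarrow> vge w m (r - s)"
  using vge_add[of w m r "- s"] vge_uminus[of w m s] by simp

lemma vge_power: "is_valuation w \<Longrightarrow> vge w m r \<Longrightarrow> vge w (int n * m) (r ^ n)"
proof (induction n)
  case 0
  thus ?case using vge_const[of w 1] by simp
next
  case (Suc n)
  thus ?case using vge_mult[of w m r "int n * m" "r ^ n"] by (simp add: algebra_simps)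
qed

lemma vge_sum: assumes "is_valuation w" "\<And>i. i \<in> A \<Longrightarrow> vge w m (r i)" shows "vge w m (sum r A)"
  using assms(2)
proof (induction A rule: infinite_finite_induct)
  case (insert x F)
  thus ?case using vge_add[OF assms(1)] by simp
qed (simp_all add: vge_max_ideal)

lemma vge_cpoly: "is_valuation w \<Longrightarrow> vge w 0 g \<Longrightarrow> vge w 0 (cpoly p g)"
proof (induction p)
  case (pCons c p)
  have "vge w (0 + 0) (g * cpoly p g)" using pCons by (intro vge_mult) auto
  thus ?case using pCons by (auto intro!: vge_add vge_const)
qed (simp add: vge_max_ideal)

text \<open>If the value of \<open>y\<close> were negative, \<open>y ^ m\<close> would be the term of least value in its monic equation,
  and nothing could cancel it.\<close>

lemma vge_integral:
  assumes w: "is_valuation w" and y: "y \<in> loc_ring" and a: "\<And>i. i < m \<Longrightarrow> vge w 0 (a i)"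
    and eq: "y ^ m + (\<Sum>i<m. a i * y ^ i) \<in> max_ideal"
  shows "vge w 0 y"
proof (rule ccontr)
  assume no: "\<not> vge w 0 y"
  hence yI: "y \<notin> max_ideal" and neg: "w y < 0" using y unfolding vge_def by auto
  have wy: "vge w (w y) y" unfolding vge_def using y by simp
  have "vge w ((int m - 1) * w y) (a i * y ^ i)" if "i < m" for i
  proof (rule vge_mono)
    show "vge w (0 + int i * w y) (a i * y ^ i)"
      by (intro vge_mult vge_power w a wy that)
    have "int i \<le> int m - 1" using that by simp
    thus "(int m - 1) * w y \<le> 0 + int i * w y"
      using neg by (simp add: mult_right_mono_neg)
  qed
  hence S: "vge w ((int m - 1) * w y) (\<Sum>i<m. a i * y ^ i)"
    by (intro vge_sum[OF w]) auto
  have "vge w ((int m - 1) * w y)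
      ((y ^ m + (\<Sum>i<m. a i * y ^ i)) - (\<Sum>i<m. a i * y ^ i))"
    by (intro vge_diff[OF w] S vge_max_ideal eq)
  hence v: "vge w ((int m - 1) * w y) (y ^ m)" by simp
  have pw: "w (y ^ n) = int n * w y" for n
  proof (induction n)
    case 0
    show ?case using is_valuationD(4)[OF w, of 1] by simp
  next
    case (Suc n)
    thus ?case using is_valuationD(1)[OF w, of y "y ^ n"] y yI
      by (simp add: max_ideal_power_iff loc_ring_power algebra_simps)
  qed
  have "y ^ m \<notin> max_ideal" using yI y by (simp add: max_ideal_power_iff)
  hence "(int m - 1) * w y \<le> int m * w y" using v pw unfolding vge_def by simp
  thus False using neg by (simp add: algebra_simps)
qed

definition xT :: "complex poly poly fract" where "xT = Fract [:[:0,1:]:] 1"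

lemma Fract_1_hom: "Fract (a + b) 1 = Fract a 1 + Fract b (1::'z::idom)"
  "Fract (a * b) 1 = Fract a 1 * Fract b (1::'z)" "Fract (0::'z) 1 = 0"
  by (simp_all add: Zero_fract_def)

lemma cpoly_xT: "cpoly e xT = Fract [:e:] 1"
proof (induction e)
  case (pCons c e)
  have "[:pCons c e:] = [:[:c:]:] + [:[:0,1:]:] * [:e:]" by simp
  hence "Fract [:pCons c e:] 1 = const c + xT * Fract [:e:] 1"
    unfolding const_def xT_def by (simp only: Fract_1_hom)
  thus ?case using pCons by simp
qed (simp add: Zero_fract_def)

lemma xT_loc_ring [simp, intro]: "xT \<in> loc_ring"
  by (simp add: xT_def)

lemma Fract_1_sum: "Fract (sum g A) 1 = (\<Sum>i\<in>A. Fract (g i) (1::complex poly poly))"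
  by (induction A rule: infinite_finite_induct) (simp_all add: Fract_1_hom del: add_fract)

lemma loc_ring_sum: "(\<And>i. i \<in> A \<Longrightarrow> r i \<in> loc_ring) \<Longrightarrow> sum r A \<in> loc_ring"
  by (induction A rule: infinite_finite_induct) auto

lemma cpoly_altdef: "degree p \<le> n \<Longrightarrow> cpoly p g = (\<Sum>i\<le>n. const (poly.coeff p i) * g ^ i)"
proof -
  assume "degree p \<le> n"
  hence "p = (\<Sum>i\<le>n. Polynomial.monom (poly.coeff p i) i)" by (rule poly_as_sum_of_monoms'[symmetric])
  moreover have "cpoly (\<Sum>i\<in>A. q i) g = (\<Sum>i\<in>A. cpoly (q i) g)" for A :: "nat set" and q
    by (induction A rule: infinite_finite_induct) simp_all
  ultimately show ?thesis by (metis (no_types, lifting) cpoly_monom sum.cong)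
qed

text \<open>Every element of the function field is algebraic over \<open>C(x)\<close>: the \<open>n + 1\<close> products
  \<open>a^j b^(n-j)\<close>, reduced modulo the equation of degree \<open>n\<close> in \<open>y\<close>, are linearly dependent.\<close>

lemma algebraic_over_x:
  assumes deg: "degree f > 0" and t: "t \<in> loc_ring"
  shows "\<exists>n e. (\<exists>j\<le>n. e j \<noteq> 0) \<and> (\<Sum>j\<le>n. cpoly (e j) xT * t ^ j) \<in> max_ideal"
proof -
  obtain a b where ab: "t = Fract a b" "\<not> f dvd b" using t by (rule loc_ringE)
  define n where "n = degree f"
  define P where "P = (\<lambda>j. a ^ j * b ^ (n - j))"
  have f0: "f \<noteq> 0" using deg by auto
  have "\<exists>s r. s \<noteq> 0 \<and> f dvd Polynomial.smult s (P j) - r \<and> (\<forall>i\<ge>n. poly.coeff r i = 0)" for j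
  proof -
    obtain s q where sq: "s \<noteq> 0" "Polynomial.smult s (P j) = f * q + pseudo_mod (P j) f"
      using pseudo_mod(1)[OF f0, of "P j"] by blast
    have "poly.coeff (pseudo_mod (P j) f) i = 0" if "i \<ge> n" for i
      using pseudo_mod(2)[OF f0, of "P j"] that unfolding n_def
      by (metis coeff_0 coeff_eq_0 order_less_le_trans)
    thus ?thesis using sq by (intro exI[of _ s] exI[of _ "pseudo_mod (P j) f"]) simp
  qed
  then obtain s r where s: "\<And>j. s j \<noteq> 0" and r: "\<And>j. f dvd Polynomial.smult (s j) (P j) - r j"
    and rc: "\<And>j i. i \<ge> n \<Longrightarrow> poly.coeff (r j) i = 0" by metis
  obtain d where d: "\<exists>j\<in>{..n}. d j \<noteq> 0" "\<And>i. i < n \<Longrightarrow> (\<Sum>j\<in>{..n}. d j * poly.coeff (r j) i) = 0"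
    using linear_dependence[of "{..n}" n "\<lambda>j i. poly.coeff (r j) i"] by auto
  have dr: "(\<Sum>j\<le>n. Polynomial.smult (d j) (r j)) = 0"
  proof (rule poly_eqI)
    fix i show "poly.coeff (\<Sum>j\<le>n. Polynomial.smult (d j) (r j)) i = poly.coeff 0 i"
      using d(2)[of i] rc[of i] by (cases "i < n") (simp_all add: coeff_sum)
  qed
  define e where "e = (\<lambda>j. d j * s j)"
  define S where "S = (\<Sum>j\<le>n. [:e j:] * P j)"
  have "S = (\<Sum>j\<le>n. Polynomial.smult (d j) (Polynomial.smult (s j) (P j) - r j))"
    unfolding S_def e_def smult_diff_right sum_subtractf dr by simp
  hence "f dvd S" using r by (simp add: dvd_sum dvd_smult)
  have bn: "\<not> f dvd b ^ n" using ab(2) prime prime_elem_dvd_power by blast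
  have b0: "b \<noteq> 0" using ab(2) by auto
  have tj: "Fract (P j) (b ^ n) = t ^ j" if "j \<le> n" for j
  proof -
    have tp: "t ^ k = Fract (a ^ k) (b ^ k)" for k
      unfolding ab(1) by (induction k) (simp_all add: One_fract_def)
    show ?thesis unfolding P_def tp using b0 that
      by (simp add: eq_fract power_add[symmetric] mult.assoc)
  qed
  have "Fract S (b ^ n) = Fract S 1 * Fract 1 (b ^ n)" by simp
  also have "\<dots> = (\<Sum>j\<le>n. Fract [:e j:] 1 * (Fract (P j) 1 * Fract 1 (b ^ n)))"
    unfolding S_def Fract_1_sum Fract_1_hom by (simp add: sum_distrib_right mult.assoc)
  also have "\<dots> = (\<Sum>j\<le>n. cpoly (e j) xT * t ^ j)"
  proof (intro sum.cong refl)
    fix j assume "j \<in> {..n}"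
    moreover have "Fract (P j) 1 * Fract 1 (b ^ n) = Fract (P j) (b ^ n)" by simp
    ultimately show "Fract [:e j:] 1 * (Fract (P j) 1 * Fract 1 (b ^ n)) = cpoly (e j) xT * t ^ j"
      by (simp only: tj cpoly_xT atMost_iff)
  qed
  finally have eq: "Fract S (b ^ n) = (\<Sum>j\<le>n. cpoly (e j) xT * t ^ j)" .
  have "Fract S (b ^ n) \<in> max_ideal" using \<open>f dvd S\<close> bn by (simp add: Fract_max_ideal_iff)
  moreover have "\<exists>j\<le>n. e j \<noteq> 0" using d(1) s by (auto simp: e_def)
  ultimately show ?thesis unfolding eq by blast
qed

end

section \<open>Functions with one simple pole\<close>

context smooth_point begin

abbreviation other where
  "other w \<equiv> is_valuation w \<and> (\<exists>r\<in>loc_ring - max_ideal. w r \<noteq> point_val r)"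

definition pole_le :: "nat \<Rightarrow> complex poly poly fract \<Rightarrow> bool" where
  "pole_le N h \<longleftrightarrow> vge point_val (- int N) h \<and> (\<forall>w. other w \<longrightarrow> vge w 0 h)"

lemma genus0_coordinate:
  assumes genus: "curve_has_genus f 0"
  obtains t where "t \<in> loc_ring" "\<And>c. t - const c \<notin> max_ideal" "pole_le 1 t"
proof -
  obtain t where t: "t \<in> loc_ring" "\<And>c. t - const c \<notin> max_ideal" "-1 \<le> point_val t"
    "\<And>w. other w \<Longrightarrow> 0 \<le> w t" using genus0_simple_pole[OF genus] by blast
  have "pole_le 1 t" using t unfolding pole_le_def vge_def by simp
  thus ?thesis using t that by blast
qed

lemma pole_le_0:
  assumes genus: "curve_has_genus f 0" and h: "pole_le 0 h"
  shows "\<exists>c. h - const c \<in> max_ideal"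
proof (rule genus0_regular_const[OF genus])
  show hR: "h \<in> loc_ring" using h unfolding pole_le_def vge_def by blast
  fix w assume w: "is_valuation w" and hI: "h \<notin> max_ideal"
  show "0 \<le> w h"
  proof (cases "other w")
    case True
    thus ?thesis using h hI unfolding pole_le_def vge_def by blast
  next
    case False
    hence "w h = point_val h" using w hR hI by blast
    thus ?thesis using h hI unfolding pole_le_def vge_def by simp
  qed
qed

text \<open>The leading term of the pole of \<open>h\<close> is a constant multiple of a power of \<open>t\<close>, because the residue
  field is the field of constants. Subtracting it lowers the order of the pole.\<close>

lemma pole_le_cpoly:
  assumes genus: "curve_has_genus f 0"
    and t: "t \<in> loc_ring" "\<And>c. t - const c \<notin> max_ideal" "pole_le 1 t"
    and h: "pole_le N h"
  shows "\<exists>p. degree p \<le> N \<and> h - cpoly p t \<in> max_ideal"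
  using h
proof (induction N arbitrary: h)
  case 0
  then obtain c where "h - const c \<in> max_ideal" using pole_le_0[OF genus] by blast
  thus ?case by (intro exI[of _ "[:c:]"]) simp
next
  case (Suc N)
  have tI: "t \<notin> max_ideal" using t(2)[of 0] by simp
  have pt: "point_val t = -1"
  proof (rule ccontr)
    assume "point_val t \<noteq> -1"
    hence "pole_le 0 t" using t(3) tI unfolding pole_le_def vge_def by auto
    thus False using pole_le_0[OF genus] t(2) by blast
  qed
  have hR: "h \<in> loc_ring" using Suc.prems unfolding pole_le_def vge_def by blast
  define T where "T = t ^ Suc N"
  have T: "T \<in> loc_ring" "T \<notin> max_ideal" unfolding T_def using t(1) tI by (auto simp: max_ideal_power_iff simp del: power_Suc)
  have pT: "point_val T = - int (Suc N)"
    unfolding T_def using valuation_power[OF point_val_valuation, of t "Suc N"] t(1) tI pt by simp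
  show ?case
  proof (cases "pole_le N h")
    case True
    thus ?thesis using Suc.IH[of h] le_SucI by blast
  next
    case False
    hence hI: "h \<notin> max_ideal" and ph: "point_val h = - int (Suc N)"
      using Suc.prems unfolding pole_le_def vge_def by auto
    define u where "u = h * inverse T"
    have T0: "T \<noteq> 0" using T by auto
    have iT: "inverse T \<in> loc_ring" "inverse T \<notin> max_ideal" using T inverse_loc_ring inverse_notin by auto
    have uR: "u \<in> loc_ring" "u \<notin> max_ideal" unfolding u_def using hR hI iT max_ideal_mult_iff by auto
    have hu: "h = u * T" unfolding u_def using T0 by simp
    have "point_val h = point_val u + point_val T" unfolding hu using uR T by (intro point_val_mult)
    hence "0 \<le> point_val u" using ph pT by simp
    then obtain c where c: "u - const c \<in> max_ideal \<or> 0 < point_val (u - const c)"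
      using point_val_residue[OF uR] by blast
    define h' where "h' = h - const c * T"
    have h': "h' = (u - const c) * T" unfolding h'_def hu by (simp add: algebra_simps)
    have "vge point_val 1 (u - const c)" using c uR unfolding vge_def by auto
    moreover have "vge point_val (- int (Suc N)) T" unfolding vge_def using T pT by simp
    ultimately have "vge point_val (1 + - int (Suc N)) h'"
      unfolding h' by (intro vge_mult point_val_valuation)
    hence 1: "vge point_val (- int N) h'" by simp
    have 2: "vge w 0 h'" if w: "other w" for w
    proof -
      have "vge w (0 + int (Suc N) * 0) (const c * T)"
        unfolding T_def using w t(3) unfolding pole_le_def
        by (intro vge_mult vge_const vge_power) auto
      hence "vge w 0 (const c * T)" by simp
      thus ?thesis unfolding h'_def using w Suc.prems unfolding pole_le_def
        by (intro vge_diff) auto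
    qed
    obtain p where p: "degree p \<le> N" "h' - cpoly p t \<in> max_ideal"
      using Suc.IH[of h'] 1 2 unfolding pole_le_def by blast
    have "h - cpoly (p + Polynomial.monom c (Suc N)) t = h' - cpoly p t"
      unfolding h'_def T_def by simp
    moreover have "degree (p + Polynomial.monom c (Suc N)) \<le> Suc N"
      using p(1) by (intro degree_add_le) (auto simp: degree_monom_le)
    ultimately show ?thesis using p(2) by metis
  qed
qed

text \<open>The coordinate \<open>x\<close> is algebraic over \<open>C(t)\<close>. Multiplied by the leading
  coefficient of an equation over \<open>C[t]\<close>, it is integral over \<open>C[t]\<close> and so has no pole except at the
  point.\<close>

lemma x_rational_in_t:
  assumes genus: "curve_has_genus f 0"
    and t: "t \<in> loc_ring" "\<And>c. t - const c \<notin> max_ideal" "pole_le 1 t"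
  shows "\<exists>p q. q \<noteq> 0 \<and> cpoly q t * xT - cpoly p t \<in> max_ideal"
proof -
  obtain n e where e: "\<exists>j\<le>n. e j \<noteq> 0" "(\<Sum>j\<le>n. cpoly (e j) xT * t ^ j) \<in> max_ideal"
    using algebraic_over_x[OF degree_pos t(1)] by blast
  define M where "M = Max ((\<lambda>j. degree (e j)) ` {..n})"
  have M: "degree (e j) \<le> M" if "j \<le> n" for j unfolding M_def using that by simp
  define q where "q = (\<lambda>i. \<Sum>j\<le>n. Polynomial.monom (poly.coeff (e j) i) j)"
  have qc: "poly.coeff (q i) j = poly.coeff (e j) i" if "j \<le> n" for i j
    unfolding q_def using that by (simp add: coeff_sum)
  have csum: "cpoly (\<Sum>i\<in>A. r i) g = (\<Sum>i\<in>A. cpoly (r i) g)" for A :: "nat set" and r g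
    by (induction A rule: infinite_finite_induct) simp_all
  have "(\<Sum>j\<le>n. cpoly (e j) xT * t ^ j) = (\<Sum>j\<le>n. \<Sum>i\<le>M. const (poly.coeff (e j) i) * xT ^ i * t ^ j)"
    by (intro sum.cong refl) (simp add: cpoly_altdef[OF M] sum_distrib_right)
  also have "\<dots> = (\<Sum>i\<le>M. \<Sum>j\<le>n. const (poly.coeff (e j) i) * xT ^ i * t ^ j)" by (rule sum.swap)
  also have "\<dots> = (\<Sum>i\<le>M. cpoly (q i) t * xT ^ i)"
    unfolding q_def csum cpoly_monom by (simp add: sum_distrib_right sum_distrib_left mult_ac)
  finally have rel: "(\<Sum>i\<le>M. cpoly (q i) t * xT ^ i) \<in> max_ideal" using e(2) by simp
  have nz: "\<exists>i\<le>M. q i \<noteq> 0"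
  proof -
    obtain j where j: "j \<le> n" "e j \<noteq> 0" using e(1) by blast
    hence "poly.coeff (q (degree (e j))) j \<noteq> 0" using qc by simp
    thus ?thesis using M[OF j(1)] by (metis coeff_0)
  qed
  define m where "m = Max {i. i \<le> M \<and> q i \<noteq> 0}"
  have fin: "finite {i. i \<le> M \<and> q i \<noteq> 0}" by simp
  have m: "m \<le> M" "q m \<noteq> 0" using Max_in[OF fin] nz unfolding m_def by auto
  have above: "q i = 0" if "i \<le> M" "m < i" for i
  proof (rule ccontr)
    assume "q i \<noteq> 0"
    hence "i \<le> m" unfolding m_def using that(1) by (intro Max_ge[OF fin]) simp
    thus False using that(2) by simp
  qed
  have "(\<Sum>i\<le>M. cpoly (q i) t * xT ^ i) = (\<Sum>i\<le>m. cpoly (q i) t * xT ^ i)"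
    using m(1) above by (intro sum.mono_neutral_right) auto
  hence rel': "(\<Sum>i\<le>m. cpoly (q i) t * xT ^ i) \<in> max_ideal" using rel by simp
  have "m \<noteq> 0"
  proof
    assume "m = 0"
    hence "cpoly (q 0) t \<in> max_ideal" using rel' by simp
    thus False using cpoly_transcendental[OF t(1,2)] m(2) \<open>m = 0\<close> by blast
  qed
  define y where "y = cpoly (q m) t * xT"
  define a where "a = (\<lambda>i. cpoly (q i * q m ^ (m - 1 - i)) t)"
  have yR: "y \<in> loc_ring" unfolding y_def using t(1) by (intro loc_ring_mult cpoly_loc_ring) auto
  have cpw: "cpoly (r ^ k) g = cpoly r g ^ k" for r g k
    by (induction k) (simp_all add: one_pCons)
  have "cpoly (q m) t ^ (m - 1) * (\<Sum>i\<le>m. cpoly (q i) t * xT ^ i) = y ^ m + (\<Sum>i<m. a i * y ^ i)"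
  proof -
    have "{..m} = insert m {..<m}" by auto
    hence "(\<Sum>i\<le>m. cpoly (q i) t * xT ^ i)
        = cpoly (q m) t * xT ^ m + (\<Sum>i<m. cpoly (q i) t * xT ^ i)" by simp
    moreover have "cpoly (q m) t ^ (m - 1) * (cpoly (q m) t * xT ^ m) = y ^ m"
      unfolding y_def power_mult_distrib using \<open>m \<noteq> 0\<close>
      by (metis (no_types, lifting) mult.assoc mult.commute power_minus_mult bot_nat_0.not_eq_extremum)
    moreover have "cpoly (q m) t ^ (m - 1) * (cpoly (q i) t * xT ^ i) = a i * y ^ i" if "i < m" for i
    proof -
      have "m - 1 = (m - 1 - i) + i" using that by simp
      hence "cpoly (q m) t ^ (m - 1) = cpoly (q m) t ^ (m - 1 - i) * cpoly (q m) t ^ i"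
        by (metis power_add)
      thus ?thesis unfolding a_def y_def cpoly_mult cpw power_mult_distrib by (simp add: mult_ac)
    qed
    ultimately show ?thesis by (simp add: distrib_left sum_distrib_left)
  qed
  moreover have "cpoly (q m) t ^ (m - 1) * (\<Sum>i\<le>m. cpoly (q i) t * xT ^ i) \<in> max_ideal"
    using rel' t(1) by (subst max_ideal_mult_iff) (auto intro!: loc_ring_sum)
  ultimately have int: "y ^ m + (\<Sum>i<m. a i * y ^ i) \<in> max_ideal" by simp
  have "vge w 0 y" if w: "other w" for w
  proof (rule vge_integral[OF _ yR _ int])
    show "is_valuation w" using w by blast
    show "vge w 0 (a i)" for i
      unfolding a_def using w t(3) unfolding pole_le_def by (intro vge_cpoly) auto
  qed
  moreover have "vge point_val (- int (nat (- point_val y))) y"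
    unfolding vge_def using yR by auto
  ultimately have "pole_le (nat (- point_val y)) y" unfolding pole_le_def by blast
  then obtain p where "y - cpoly p t \<in> max_ideal" using pole_le_cpoly[OF genus t] by blast
  thus ?thesis using m(2) unfolding y_def by blast
qed

lemma valuation_comp:
  assumes w: "is_valuation w"
    and A: "\<And>r s. \<phi> (r + s) = \<phi> r + \<phi> s" "\<And>r s. \<phi> (r * s) = \<phi> r * \<phi> s"
      "\<And>r s. \<phi> (r - s) = \<phi> r - \<phi> s" "\<And>c. \<phi> (const c) = const c"
      "\<And>r. r \<in> loc_ring \<Longrightarrow> \<phi> r \<in> loc_ring" "\<And>r. r \<in> max_ideal \<Longrightarrow> \<phi> r \<in> max_ideal"
      "\<And>r. r \<in> loc_ring - max_ideal \<Longrightarrow> \<phi> r \<in> loc_ring - max_ideal"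
      "\<And>r. r \<in> loc_ring - max_ideal \<Longrightarrow> \<psi> r \<in> loc_ring - max_ideal" "\<And>r. \<phi> (\<psi> r) = r"
  shows "is_valuation (\<lambda>r. w (\<phi> r))"
proof -
  have nI: "r + s \<notin> max_ideal \<Longrightarrow> r + s \<in> loc_ring \<Longrightarrow> \<phi> r + \<phi> s \<notin> max_ideal" for r s
      using A(7)[of "r + s"] by (simp add: A(1))
    obtain r0 where r0: "r0 \<in> loc_ring - max_ideal" "w r0 = 1" using w unfolding is_valuation_def by blast
    show ?thesis unfolding is_valuation_def
    proof (intro conjI allI impI)
      show "\<exists>r. r \<in> loc_ring - max_ideal \<and> w (\<phi> r) = 1"
        using r0 A(8)[OF r0(1)] A(9)[of r0] by (intro exI[of _ "\<psi> r0"]) simp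
    next
      fix r s assume rs: "r \<in> loc_ring - max_ideal" "s \<in> loc_ring - max_ideal"
      show "w (\<phi> (r * s)) = w (\<phi> r) + w (\<phi> s)"
        unfolding A(2) by (rule is_valuationD(1)[OF w A(7)[OF rs(1)] A(7)[OF rs(2)]])
      assume "r + s \<notin> max_ideal"
      hence "\<phi> r + \<phi> s \<notin> max_ideal" using rs by (intro nI) auto
      thus "min (w (\<phi> r)) (w (\<phi> s)) \<le> w (\<phi> (r + s))"
        unfolding A(1) by (rule is_valuationD(2)[OF w A(7)[OF rs(1)] A(7)[OF rs(2)]])
    next
      fix r s assume rs: "r \<in> loc_ring - max_ideal" "s \<in> loc_ring" "r - s \<in> max_ideal"
      show "w (\<phi> r) = w (\<phi> s)"
        by (rule is_valuationD(3)[OF w A(7)[OF rs(1)] A(5)[OF rs(2)]]) (use A(6)[OF rs(3)] in \<open>simp add: A(3)\<close>)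
    next
      fix c :: complex assume "c \<noteq> 0"
      thus "w (\<phi> (const c)) = 0" unfolding A(4) by (rule is_valuationD(4)[OF w])
    qed
  qed

text \<open>The function \<open>\<sigma> t\<close> has a single simple pole, at the place \<open>Q\<close>. If \<open>Q\<close> is the place of the point, \<open>\<sigma> t\<close>
  is a polynomial of degree one in \<open>t\<close>. Otherwise \<open>t\<close> has a value \<open>c\<close> at \<open>Q\<close>, and \<open>\<sigma> t * (t - c)\<close> is such a
  polynomial.\<close>

lemma automorphism_moebius:
  assumes genus: "curve_has_genus f 0"
    and t: "t \<in> loc_ring" "\<And>c. t - const c \<notin> max_ideal" "pole_le 1 t"
    and add: "\<And>r s. \<sigma> (r + s) = \<sigma> r + \<sigma> s" "\<And>r s. \<tau> (r + s) = \<tau> r + \<tau> s"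
    and mult: "\<And>r s. \<sigma> (r * s) = \<sigma> r * \<sigma> s" "\<And>r s. \<tau> (r * s) = \<tau> r * \<tau> s"
    and cst: "\<And>c. \<sigma> (const c) = const c" "\<And>c. \<tau> (const c) = const c"
    and loc: "\<And>r. r \<in> loc_ring \<Longrightarrow> \<sigma> r \<in> loc_ring" "\<And>r. r \<in> loc_ring \<Longrightarrow> \<tau> r \<in> loc_ring"
    and idl: "\<And>r. r \<in> max_ideal \<Longrightarrow> \<sigma> r \<in> max_ideal" "\<And>r. r \<in> max_ideal \<Longrightarrow> \<tau> r \<in> max_ideal"
    and inv: "\<And>r. \<tau> (\<sigma> r) = r" "\<And>r. \<sigma> (\<tau> r) = r"
  shows "\<exists>a b c d. a * d - b * c \<noteq> 0 \<and>
    (const c * t + const d) * \<sigma> t - (const a * t + const b) \<in> max_ideal"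
proof -
  have tI: "t \<notin> max_ideal" using t(2)[of 0] by simp
  have diff: "\<sigma> (r - s) = \<sigma> r - \<sigma> s" "\<tau> (r - s) = \<tau> r - \<tau> s" for r s
    using add(1)[of "r - s" s] add(2)[of "r - s" s] by simp_all
  have unit: "\<sigma> r \<in> loc_ring - max_ideal" "\<tau> r \<in> loc_ring - max_ideal" if "r \<in> loc_ring - max_ideal" for r
    using that loc[of r] idl(2)[of "\<sigma> r"] idl(1)[of "\<tau> r"] inv by auto
  have nonconst: "\<sigma> t - const c \<notin> max_ideal" for c
    using idl(2)[of "\<sigma> t - const c"] t(2)[of c] by (auto simp: diff cst inv)
  have val: "is_valuation (\<lambda>r. w (\<sigma> r))" "is_valuation (\<lambda>r. w (\<tau> r))" if "is_valuation w" for w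
  proof -
    show "is_valuation (\<lambda>r. w (\<sigma> r))"
      by (rule valuation_comp[OF that, of \<sigma> \<tau>]) (fact add mult diff cst loc idl unit inv)+
    show "is_valuation (\<lambda>r. w (\<tau> r))"
      by (rule valuation_comp[OF that, of \<tau> \<sigma>]) (fact add mult diff cst loc idl unit inv)+
  qed
  define Q where "Q = (\<lambda>r. point_val (\<tau> r))"
  have Q: "is_valuation Q" unfolding Q_def by (rule val(2)[OF point_val_valuation])
  \<comment> \<open>a pole of \<open>\<sigma> t\<close> at \<open>w\<close> is a pole of \<open>t\<close> at \<open>w \<circ> \<sigma>\<close>\<close>
  have away: "vge w 0 (\<sigma> t)" if w: "is_valuation w" "r \<in> loc_ring - max_ideal" "w r \<noteq> Q r" for w r
  proof -
    have "is_valuation (\<lambda>r. w (\<sigma> r))" by (rule val(1)[OF w(1)])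
    moreover have "w (\<sigma> (\<tau> r)) \<noteq> point_val (\<tau> r)" using w(3) inv(2)[of r] unfolding Q_def by simp
    hence "\<exists>s\<in>loc_ring - max_ideal. w (\<sigma> s) \<noteq> point_val s" using unit(2)[OF w(2)] by blast
    ultimately have "vge (\<lambda>r. w (\<sigma> r)) 0 t" using t(3) unfolding pole_le_def by blast
    thus ?thesis using tI loc(1)[OF t(1)] unfolding vge_def by blast
  qed
  have Qt: "vge Q (-1) (\<sigma> t)"
    using t(3) tI t(1) unfolding pole_le_def vge_def Q_def inv by (auto intro: loc(1))
  show ?thesis
  proof (cases "\<exists>r\<in>loc_ring - max_ideal. Q r \<noteq> point_val r")
    case False
    have "pole_le 1 (\<sigma> t)" unfolding pole_le_def
    proof (intro conjI allI impI)
      have "\<sigma> t \<in> max_ideal \<or> Q (\<sigma> t) = point_val (\<sigma> t)" using False loc(1)[OF t(1)] by blast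
      thus "vge point_val (- int 1) (\<sigma> t)" using Qt unfolding vge_def by auto
      fix w assume "other w"
      thus "vge w 0 (\<sigma> t)" using away False by metis
    qed
    then obtain p where p: "degree p \<le> 1" "\<sigma> t - cpoly p t \<in> max_ideal"
      using pole_le_cpoly[OF genus t] by blast
    define a b where "a = poly.coeff p 1" and "b = poly.coeff p 0"
    have cp: "cpoly p t = const a * t + const b"
      unfolding cpoly_altdef[OF p(1)] a_def b_def by simp
    have "a \<noteq> 0" using nonconst[of b] p(2) unfolding cp by auto
    thus ?thesis using p(2) unfolding cp
      by (intro exI[of _ a] exI[of _ b] exI[of _ 0] exI[of _ 1]) simp
  next
    case True
    have "vge Q 0 t" using t(3) Q True unfolding pole_le_def by blast
    hence "0 \<le> point_val (\<tau> t)" using tI unfolding vge_def Q_def by blast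
    then obtain c where c: "\<tau> t - const c \<in> max_ideal \<or> 0 < point_val (\<tau> t - const c)"
      using point_val_residue[of "\<tau> t"] unit(2)[of t] t(1) tI by blast
    have Qc: "vge Q 1 (t - const c)"
      unfolding vge_def Q_def diff cst using c t(1) idl(1)[of "\<tau> t - const c"]
      by (auto simp: diff cst inv)
    define h where "h = \<sigma> t * (t - const c)"
    have "pole_le 1 h" unfolding pole_le_def
    proof (intro conjI allI impI)
      obtain r where r: "r \<in> loc_ring - max_ideal" "Q r \<noteq> point_val r" using True by blast
      have "vge point_val (0 + (-1)) h"
        unfolding h_def
      proof (rule vge_mult[OF point_val_valuation])
        show "vge point_val 0 (\<sigma> t)" using away[OF point_val_valuation r(1)] r(2) by metis
        have "vge point_val (- 1) (const c)" by (rule vge_mono[OF vge_const[OF point_val_valuation]]) simp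
        thus "vge point_val (-1) (t - const c)"
          using t(3) unfolding pole_le_def by (intro vge_diff point_val_valuation) auto
      qed
      thus "vge point_val (- int 1) h" by simp
      fix w assume w: "other w"
      show "vge w 0 h"
      proof (cases "\<exists>r\<in>loc_ring - max_ideal. w r \<noteq> Q r")
        case True
        have "vge w (0 + 0) h" unfolding h_def
          using away True w t(3) unfolding pole_le_def by (intro vge_mult vge_diff vge_const) blast+
        thus ?thesis by simp
      next
        case False
        have "vge w (-1 + 1) h" unfolding h_def
        proof (rule vge_mult)
          show "is_valuation w" using w by blast
          show "vge w (-1) (\<sigma> t)" using Qt False unfolding vge_def by auto
          have "t - const c \<in> loc_ring - max_ideal" using t by blast
          hence "w (t - const c) = Q (t - const c)" using False by blast
          thus "vge w 1 (t - const c)" using Qc unfolding vge_def by simp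
        qed
        thus ?thesis by simp
      qed
    qed
    then obtain p where p: "degree p \<le> 1" "h - cpoly p t \<in> max_ideal"
      using pole_le_cpoly[OF genus t] by blast
    define a b where "a = poly.coeff p 1" and "b = poly.coeff p 0"
    have cp: "cpoly p t = const a * t + const b"
      unfolding cpoly_altdef[OF p(1)] a_def b_def by simp
    have eq: "(const 1 * t + const (- c)) * \<sigma> t - (const a * t + const b) \<in> max_ideal"
      using p(2) unfolding cp h_def by (simp add: algebra_simps)
    have "a * (- c) - b * 1 \<noteq> 0"
    proof
      assume "a * (- c) - b * 1 = 0"
      hence "b = - (c * a)" by (simp add: algebra_simps)
      hence "(t - const c) * (\<sigma> t - const a) \<in> max_ideal" using eq by (simp add: algebra_simps)
      thus False using max_ideal_mult_iff[of "t - const c" "\<sigma> t - const a"] t(1,2) nonconst loc(1) by blast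
    qed
    thus ?thesis using eq by blast
  qed
qed

end

section \<open>Null sets in the plane\<close>

lemma measurable_vector2: "(\<lambda>(x,y). vector [x,y] :: real^2) \<in> measurable (lborel \<Otimes>\<^sub>M lborel) borel"
proof -
  have cont: "continuous_on UNIV (\<lambda>z::real \<times> real. (\<chi> i. if i = 1 then fst z else snd z) :: real^2)"
  proof (intro continuous_on_vec_lambda)
    fix i :: 2 show "continuous_on UNIV (\<lambda>z::real \<times> real. if i = 1 then fst z else snd z)"
      by (cases "i = 1") (auto intro: continuous_intros)
  qed
  have eq: "(\<lambda>z::real \<times> real. (\<chi> i. if i = 1 then fst z else snd z) :: real^2) = (\<lambda>(x,y). vector [x,y])"
    by (auto simp: fun_eq_iff vec_eq_iff forall_2)
  have "(\<lambda>(x,y). vector [x,y] :: real^2) \<in> borel_measurable borel"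
    using borel_measurable_continuous_onI[OF cont] unfolding eq .
  thus ?thesis by (simp add: lborel_prod)
qed

lemma lborel_plane: "(lborel :: (real^2) measure) = distr (lborel \<Otimes>\<^sub>M lborel) borel (\<lambda>(x,y). vector [x,y])"
proof (rule lborel_eqI)
  show "sets (distr (lborel \<Otimes>\<^sub>M lborel) borel (\<lambda>(x,y). vector [x,y] :: real^2)) = sets borel" by simp
  fix l u :: "real^2" assume le: "\<And>b. b \<in> Basis \<Longrightarrow> l \<bullet> b \<le> u \<bullet> b"
  have le': "l $ i \<le> u $ i" for i using le[of "axis i 1"] by (auto simp: inner_axis Basis_vec_def)
  have "(\<lambda>(x,y). vector [x,y] :: real^2) -` box l u = {l$1<..<u$1} \<times> {l$2<..<u$2}"
    by (auto simp: mem_box_cart forall_2)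
  hence "emeasure (distr (lborel \<Otimes>\<^sub>M lborel) borel (\<lambda>(x,y). vector [x,y])) (box l u)
     = emeasure (lborel \<Otimes>\<^sub>M lborel) ({l$1<..<u$1} \<times> {l$2<..<u$2})"
    by (subst emeasure_distr[OF measurable_vector2]) (auto simp: space_pair_measure)
  also have "\<dots> = emeasure lborel {l$1<..<u$1} * emeasure lborel {l$2<..<u$2}"
    by (rule lborel.emeasure_pair_measure_Times) auto
  also have "\<dots> = ennreal ((u$1 - l$1) * (u$2 - l$2))"
    using le' by (simp add: ennreal_mult)
  also have "(u$1 - l$1) * (u$2 - l$2) = (\<Prod>b\<in>Basis. (u - l) \<bullet> b)"
  proof -
    have "(\<Prod>b\<in>(Basis :: (real^2) set). (u - l) \<bullet> b) = (\<Prod>b\<in>(\<lambda>i::2. axis i (1::real)) ` UNIV. (u - l) \<bullet> b)"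
      by (rule arg_cong[where f = "prod _"]) (auto simp: Basis_vec_def)
    also have "\<dots> = (\<Prod>i\<in>(UNIV::2 set). (u - l) $ i)"
      by (subst prod.reindex) (auto simp: inj_on_def axis_eq_axis inner_axis)
    finally show ?thesis by (simp add: UNIV_2)
  qed
  finally show "emeasure (distr (lborel \<Otimes>\<^sub>M lborel) borel (\<lambda>(x,y). vector [x,y])) (box l u)
      = ennreal (\<Prod>b\<in>Basis. (u - l) \<bullet> b)" .
qed

lemma null_sets_vertical_slices:
  fixes E :: "(real^2) set"
  assumes E: "E \<in> sets borel" and N: "countable N"
    and slices: "\<And>x. x \<notin> N \<Longrightarrow> countable {y. vector [x,y] \<in> E}"
  shows "E \<in> null_sets lborel"
proof -
  note meas = measurable_vector2
  define E' where "E' = (\<lambda>(x,y). vector [x,y] :: real^2) -` E"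
  have E': "E' \<in> sets (lborel \<Otimes>\<^sub>M lborel)"
    using measurable_sets[OF meas E] unfolding E'_def by (simp add: space_pair_measure)
  have "emeasure lborel E = emeasure (lborel \<Otimes>\<^sub>M lborel) E'"
    by (subst lborel_plane, subst emeasure_distr[OF meas]) (use E in \<open>auto simp: E'_def space_pair_measure\<close>)
  also have "\<dots> = (\<integral>\<^sup>+x. emeasure lborel (Pair x -` E') \<partial>lborel)"
    by (rule lborel.emeasure_pair_measure_alt[OF E'])
  also have "\<dots> = (\<integral>\<^sup>+(x::real). 0 \<partial>lborel)"
  proof (rule nn_integral_cong_AE)
    have "AE x in lborel. x \<notin> N"
      using countable_imp_null_set_lborel[OF N] by (rule AE_not_in)
    thus "AE x in lborel. emeasure lborel (Pair x -` E') = (0::ennreal)"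
    proof (eventually_elim)
      case (elim x)
      have "Pair x -` E' = {y. vector [x,y] \<in> E}" unfolding E'_def by auto
      thus ?case using countable_imp_null_set_lborel[OF slices[OF elim]] by auto
    qed
  qed
  finally show ?thesis using E by (intro null_setsI) simp_all
qed

lemma null_sets_lborel_negligible: "E \<in> null_sets lborel \<Longrightarrow> negligible E"
  unfolding negligible_iff_null_sets by (rule null_sets_completionI)

lemma negligible_vertical_slices:
  fixes E :: "(real^2) set"
  assumes E: "E \<in> sets lebesgue" and slices: "\<And>x. countable {y. vector [x,y] \<in> E}"
  shows "negligible E"
proof -
  obtain C N where CN: "fsigma C" "N \<in> null_sets lebesgue" "C \<union> N = E" "disjnt C N"
    using lebesgue_set_almost_fsigma[OF E] .
  have "C \<in> sets borel" using CN(1) by (cases rule: fsigma.cases) auto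
  moreover have "countable {y. vector [x,y] \<in> C}" for x
    by (rule countable_subset[OF _ slices[of x]]) (use CN in auto)
  ultimately have "C \<in> null_sets lborel" by (intro null_sets_vertical_slices[of C "{}"]) auto
  hence "negligible C" by (rule null_sets_lborel_negligible)
  moreover have "negligible N" using CN(2) by (simp add: negligible_iff_null_sets)
  ultimately show ?thesis unfolding CN(3)[symmetric] by simp
qed

section \<open>Change of variables for nonnegative functions\<close>

lemma emeasure_image_eq_nn_integral:
  fixes g :: "real^2 \<Rightarrow> real^2"
  assumes A: "A \<in> sets lebesgue"
    and der: "\<And>x. x \<in> A \<Longrightarrow> (g has_derivative g' x) (at x)"
    and J: "\<And>x. x \<in> A \<Longrightarrow> det (matrix (g' x)) = J x" "J \<in> borel_measurable borel"
    and inj: "inj_on g A"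
  shows "emeasure lebesgue (g ` A) = (\<integral>\<^sup>+x. ennreal \<bar>J x\<bar> * indicator A x \<partial>lebesgue)"
proof -
  have der': "(g has_derivative g' x) (at x within A)" if "x \<in> A" for x
    using der[OF that] by (rule has_derivative_at_withinI)
  define h where "h = (\<lambda>x. if x \<in> A then \<bar>J x\<bar> else 0)"
  have hm: "h \<in> borel_measurable lebesgue"
    unfolding h_def using A J(2) by (intro measurable_If_set borel_measurable_abs measurable_completion) auto
  have hn: "(\<integral>\<^sup>+x. ennreal \<bar>J x\<bar> * indicator A x \<partial>lebesgue) = (\<integral>\<^sup>+x. ennreal (h x) \<partial>lebesgue)"
    by (intro nn_integral_cong) (auto simp: h_def indicator_def)
  have iff: "((\<lambda>x. \<bar>det (matrix (g' x))\<bar>) has_integral m) A \<longleftrightarrow> (\<integral>\<^sup>+x. ennreal (h x) \<partial>lebesgue) = ennreal m"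
    if "0 \<le> m" for m
  proof -
    have "((\<lambda>x. \<bar>det (matrix (g' x))\<bar>) has_integral m) A \<longleftrightarrow> (h has_integral m) UNIV"
      unfolding h_def has_integral_restrict_UNIV by (rule has_integral_cong) (simp add: J(1))
    also have "\<dots> \<longleftrightarrow> (\<integral>\<^sup>+x. ennreal (h x) \<partial>lebesgue) = ennreal m"
      using that hm by (subst has_integral_iff_nn_integral_lebesgue) (auto simp: h_def)
    finally show ?thesis .
  qed
  have im: "g ` A \<in> sets lebesgue"
    by (rule differentiable_image_in_sets_lebesgue[OF A])
      (use der' in \<open>auto simp: differentiable_on_def differentiable_def\<close>)
  show ?thesis
  proof (cases "emeasure lebesgue (g ` A) = \<infinity>")
    case False
    hence lm: "g ` A \<in> lmeasurable" using im by (simp add: fmeasurable_def top.not_eq_extremum)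
    have "((\<lambda>x. \<bar>det (matrix (g' x))\<bar>) has_integral measure lebesgue (g ` A)) A"
      using has_measure_differentiable_image[OF A der' inj] lm by blast
    hence "(\<integral>\<^sup>+x. ennreal (h x) \<partial>lebesgue) = ennreal (measure lebesgue (g ` A))"
      by (subst (asm) iff) auto
    thus ?thesis unfolding hn using emeasure_eq_measure2[OF lm] by simp
  next
    case True
    have "(\<integral>\<^sup>+x. ennreal (h x) \<partial>lebesgue) = \<infinity>"
    proof (rule ccontr)
      assume "(\<integral>\<^sup>+x. ennreal (h x) \<partial>lebesgue) \<noteq> \<infinity>"
      then obtain m where m: "0 \<le> m" "(\<integral>\<^sup>+x. ennreal (h x) \<partial>lebesgue) = ennreal m"
        by (metis ennreal_cases infinity_ennreal_def)
      hence "g ` A \<in> lmeasurable"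
        using has_measure_differentiable_image[OF A der' inj] iff[OF m(1)] by blast
      thus False using True by (auto simp: fmeasurable_def)
    qed
    thus ?thesis unfolding hn using True by simp
  qed
qed

text \<open>Both sides are integrals of \<open>\<phi>\<close>, and the two measures agree on Borel sets by the measure formula for
  images.\<close>

lemma nn_integral_image_eq:
  fixes g :: "real^2 \<Rightarrow> real^2"
  assumes A: "A \<in> sets lebesgue"
    and der: "\<And>x. x \<in> A \<Longrightarrow> (g has_derivative g' x) (at x)"
    and J: "\<And>x. x \<in> A \<Longrightarrow> det (matrix (g' x)) = J x" "J \<in> borel_measurable borel"
    and inj: "inj_on g A" and gm: "g \<in> borel_measurable borel" and \<phi>: "\<phi> \<in> borel_measurable borel"
  shows "(\<integral>\<^sup>+y. \<phi> y * indicator (g ` A) y \<partial>lebesgue) = (\<integral>\<^sup>+x. \<phi> (g x) * ennreal \<bar>J x\<bar> * indicator A x \<partial>lebesgue)"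
proof -
  have der': "(g has_derivative g' x) (at x within A)" if "x \<in> A" for x
    using der[OF that] by (rule has_derivative_at_withinI)
  have im: "g ` A \<in> sets lebesgue"
    by (rule differentiable_image_in_sets_lebesgue[OF A])
      (use der' in \<open>auto simp: differentiable_on_def differentiable_def\<close>)
  have [measurable]: "g \<in> lebesgue \<rightarrow>\<^sub>M borel" "\<phi> \<in> borel_measurable borel" "J \<in> lebesgue \<rightarrow>\<^sub>M borel"
    "(\<lambda>x. x) \<in> lebesgue \<rightarrow>\<^sub>M (borel :: (real^2) measure)"
    using gm \<phi> J(2) by (auto intro: measurable_completion)
  have A'[measurable]: "(\<lambda>x. indicator A x :: ennreal) \<in> borel_measurable lebesgue"
     "(\<lambda>x. indicator (g ` A) x :: ennreal) \<in> borel_measurable lebesgue"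
    using A im by simp_all
  define M1 where "M1 = distr (density lebesgue (\<lambda>x. ennreal \<bar>J x\<bar> * indicator A x)) borel g"
  define M2 where "M2 = distr (density lebesgue (indicator (g ` A))) borel (\<lambda>x. x)"
  have "M1 = M2"
  proof (rule measure_eqI)
    show "sets M1 = sets M2" by (simp add: M1_def M2_def)
    fix B assume "B \<in> sets M1"
    hence B: "B \<in> sets borel" by (simp add: M1_def)
    have gB: "g -` B \<in> sets lebesgue" using measurable_sets[of g lebesgue borel B] B by simp
    have BL: "B \<in> sets lebesgue" using B by simp
    have "emeasure M1 B = (\<integral>\<^sup>+x. ennreal \<bar>J x\<bar> * indicator A x * indicator (g -` B) x \<partial>lebesgue)"
      unfolding M1_def using B gB by (subst emeasure_distr) (auto simp: emeasure_density)
    also have "\<dots> = (\<integral>\<^sup>+x. ennreal \<bar>J x\<bar> * indicator (A \<inter> g -` B) x \<partial>lebesgue)"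
      by (intro nn_integral_cong) (auto simp: indicator_def)
    also have "\<dots> = emeasure lebesgue (g ` (A \<inter> g -` B))"
      by (rule emeasure_image_eq_nn_integral[symmetric, where g' = g'])
        (use A gB der J inj in \<open>auto intro: inj_on_subset\<close>)
    also have "g ` (A \<inter> g -` B) = g ` A \<inter> B" by auto
    also have "emeasure lebesgue (g ` A \<inter> B) = (\<integral>\<^sup>+x. indicator (g ` A) x * indicator B x \<partial>lebesgue)"
    proof -
      have "g ` A \<inter> B \<in> sets lebesgue" using im BL by (rule sets.Int)
      hence "emeasure lebesgue (g ` A \<inter> B) = (\<integral>\<^sup>+x. indicator (g ` A \<inter> B) x \<partial>lebesgue)"
        by (rule nn_integral_indicator[symmetric])
      thus ?thesis by (simp only: indicator_inter_arith)
    qed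
    also have "\<dots> = emeasure M2 B"
      unfolding M2_def using B BL by (subst emeasure_distr) (auto simp: emeasure_density)
    finally show "emeasure M1 B = emeasure M2 B" .
  qed
  hence "(\<integral>\<^sup>+y. \<phi> y \<partial>M1) = (\<integral>\<^sup>+y. \<phi> y \<partial>M2)" by simp
  thus ?thesis unfolding M1_def M2_def
    by (simp add: nn_integral_distr nn_integral_density mult_ac)
qed

lemma negligible_locally_injective_image:
  fixes g :: "real^2 \<Rightarrow> real^2"
  assumes A: "A \<in> sets lebesgue"
    and der: "\<And>x. x \<in> A \<Longrightarrow> (g has_derivative g' x) (at x)"
    and J: "\<And>x. x \<in> A \<Longrightarrow> det (matrix (g' x)) = J x" "J \<in> borel_measurable borel" "\<And>x. x \<in> A \<Longrightarrow> J x \<noteq> 0"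
    and inj: "inj_on g A" and neg: "negligible (g ` A)"
  shows "negligible A"
proof -
  have m: "(\<lambda>x. ennreal \<bar>J x\<bar> * indicator A x) \<in> borel_measurable lebesgue"
  proof (intro borel_measurable_times_ennreal borel_measurable_indicator A)
    show "(\<lambda>x. ennreal \<bar>J x\<bar>) \<in> borel_measurable lebesgue"
      using J(2) by (intro measurable_completion) simp
  qed
  have "(\<integral>\<^sup>+x. ennreal \<bar>J x\<bar> * indicator A x \<partial>lebesgue) = 0"
    using emeasure_image_eq_nn_integral[OF A der J(1,2) inj] neg
    by (simp add: negligible_iff_null_sets null_setsD1)
  hence "AE x in lebesgue. ennreal \<bar>J x\<bar> * indicator A x = 0" using nn_integral_0_iff_AE[OF m] by simp
  hence "AE x in lebesgue. x \<notin> A"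
    by eventually_elim (use J(3) in \<open>auto simp: indicator_def split: if_splits\<close>)
  thus ?thesis unfolding negligible_iff_null_sets using A by (simp add: AE_iff_null_sets)
qed

text \<open>Locally \<open>g\<close> is injective and carries the set to one with countable vertical slices. The image is null
  by Fubini's theorem, and the set itself by change of variables.\<close>

lemma negligible_countable_fibres:
  fixes g :: "real^2 \<Rightarrow> real^2"
  assumes E: "E \<in> sets borel" and S: "open S" "E \<subseteq> S"
    and der: "\<And>x. x \<in> S \<Longrightarrow> (g has_derivative g' x) (at x)"
    and cont: "\<And>v. continuous_on S (\<lambda>x. g' x v)"
    and J: "\<And>x. x \<in> S \<Longrightarrow> det (matrix (g' x)) = J x" "J \<in> borel_measurable borel" "\<And>x. x \<in> E \<Longrightarrow> J x \<noteq> 0"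
    and fib: "\<And>h. countable {p \<in> E. g p $ 1 = h}"
  shows "negligible E"
proof -
  have loc: "\<exists>r>0. ball a r \<subseteq> S \<and> inj_on g (ball a r)" if a: "a \<in> E" for a
  proof -
    have aS: "a \<in> S" using a S by blast
    have lin: "linear (g' x)" if "x \<in> S" for x
      using der[OF that] has_derivative_bounded_linear bounded_linear.linear by blast
    have "invertible (matrix (g' a))" using J(1)[OF aS] J(3)[OF a] by (simp add: invertible_det_nz)
    then obtain B where B: "B ** matrix (g' a) = mat 1" unfolding invertible_def by blast
    have B': "(*v) B \<circ> g' a = id"
    proof
      fix v
      have "g' a v = matrix (g' a) *v v" using matrix_vector_mul(2)[OF lin[OF aS]] by metis
      thus "((*v) B \<circ> g' a) v = id v" by (simp add: matrix_vector_mul_assoc B)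
    qed
    have on: "\<exists>d>0. \<forall>x. dist a x < d \<longrightarrow> onorm (\<lambda>v. g' x v - g' a v) < e" if e: "e > 0" for e
    proof -
      have "\<exists>d>0. \<forall>x. dist a x < d \<longrightarrow> x \<in> S \<and> norm (g' x b - g' a b) < e / 5" for b
      proof -
        obtain d1 where d1: "d1 > 0" "ball a d1 \<subseteq> S" using S(1) aS open_contains_ball by blast
        obtain d2 where d2: "d2 > 0" "\<And>x. x \<in> S \<Longrightarrow> dist x a < d2 \<Longrightarrow> dist (g' x b) (g' a b) < e / 5"
        proof -
          have "0 < e / 5" using e by simp
          thus ?thesis using cont[of b, unfolded continuous_on_iff, rule_format, OF aS] that by blast
        qed
        show ?thesis
          by (rule exI[of _ "min d1 d2"]) (use d1 d2 in \<open>auto simp: dist_commute dist_norm subset_iff\<close>)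
      qed
      then obtain d where d: "\<And>b. d b > 0" "\<And>b x. dist a x < d b \<Longrightarrow> x \<in> S \<and> norm (g' x b - g' a b) < e / 5"
        by metis
      define D where "D = min (d (axis 1 1)) (d (axis 2 1))"
      have "onorm (\<lambda>v. g' x v - g' a v) < e" if x: "dist a x < D" for x
      proof -
        have xS: "x \<in> S" using d(2)[of x "axis 1 1"] x unfolding D_def by simp
        have l: "linear (\<lambda>v. g' x v - g' a v)" using lin[OF xS] lin[OF aS] by (rule linear_compose_sub)
        have "norm (g' x v - g' a v) \<le> (2 * (e / 5)) * norm v" for v
        proof -
          define L where "L = (\<lambda>v. g' x v - g' a v)"
          have v: "v = (v$1) *\<^sub>R axis 1 1 + (v$2) *\<^sub>R axis 2 1"
            by (simp add: vec_eq_iff forall_2 axis_def)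
          have "L v = (v$1) *\<^sub>R L (axis 1 1) + (v$2) *\<^sub>R L (axis 2 1)"
            by (subst v) (simp only: linear_add[OF l[folded L_def]] linear_scale[OF l[folded L_def]])
          hence "norm (L v) \<le> \<bar>v$1\<bar> * norm (L (axis 1 1)) + \<bar>v$2\<bar> * norm (L (axis 2 1))"
            by (metis norm_scaleR norm_triangle_ineq)
          also have "\<dots> \<le> norm v * (e / 5) + norm v * (e / 5)"
            using d(2)[of x "axis 1 1"] d(2)[of x "axis 2 1"] x e unfolding D_def L_def
            by (intro add_mono mult_mono component_le_norm_cart) auto
          finally show ?thesis unfolding L_def by simp
        qed
        hence "onorm (\<lambda>v. g' x v - g' a v) \<le> 2 * (e / 5)" by (rule onorm_le)
        also have "\<dots> < e" using e by simp
        finally show ?thesis .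
      qed
      moreover have "D > 0" using d(1) unfolding D_def by simp
      ultimately show ?thesis by blast
    qed
    show ?thesis
      using has_derivative_locally_injective[OF aS S(1) matrix_vector_mul_bounded_linear B' der on] by metis
  qed
  then obtain r where r: "\<And>a. a \<in> E \<Longrightarrow> r a > 0 \<and> ball a (r a) \<subseteq> S \<and> inj_on g (ball a (r a))" by metis
  \<comment> \<open>countably many of the balls of injectivity suffice, by the theorem of Lindelof\<close>
  obtain E0 where E0: "E0 \<subseteq> E" "countable E0" "E \<subseteq> (\<Union>a\<in>E0. ball a (r a))"
  proof -
    obtain F' where F': "F' \<subseteq> (\<lambda>a. ball a (r a)) ` E" "countable F'" "\<Union>F' = \<Union>((\<lambda>a. ball a (r a)) ` E)"
      using Lindelof[of "(\<lambda>a. ball a (r a)) ` E"] by auto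
    obtain E0 where "E0 \<subseteq> E" "countable E0" "F' = (\<lambda>a. ball a (r a)) ` E0"
      using countable_subset_image[of F' "\<lambda>a. ball a (r a)" E] F'(1,2) by auto
    moreover have "E \<subseteq> \<Union>((\<lambda>a. ball a (r a)) ` E)"
    proof
      fix a assume "a \<in> E"
      hence "a \<in> ball a (r a)" using r by simp
      thus "a \<in> \<Union>((\<lambda>a. ball a (r a)) ` E)" using \<open>a \<in> E\<close> by blast
    qed
    ultimately show ?thesis using F'(3) that by auto
  qed
  have "negligible (E \<inter> ball a (r a))" if "a \<in> E0" for a
  proof (rule negligible_locally_injective_image[where g = g and g' = g' and J = J])
    have aE: "a \<in> E" using that E0 by blast
    show A: "E \<inter> ball a (r a) \<in> sets lebesgue" using E by auto
    show inj: "inj_on g (E \<inter> ball a (r a))" using r[OF aE] by (auto intro: inj_on_subset)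
    show "negligible (g ` (E \<inter> ball a (r a)))"
    proof (rule negligible_vertical_slices)
      show "g ` (E \<inter> ball a (r a)) \<in> sets lebesgue"
      proof (rule differentiable_image_in_sets_lebesgue[OF A])
        show "g differentiable_on E \<inter> ball a (r a)"
          unfolding differentiable_on_def
        proof
          fix x assume "x \<in> E \<inter> ball a (r a)"
          hence "x \<in> S" using S(2) by blast
          thus "g differentiable at x within E \<inter> ball a (r a)"
            using der has_derivative_at_withinI unfolding differentiable_def by blast
        qed
      qed simp
      fix h
      have "{y. vector [h,y] \<in> g ` (E \<inter> ball a (r a))} \<subseteq> (\<lambda>p. g p $ 2) ` {p \<in> E. g p $ 1 = h}"
      proof
        fix y assume "y \<in> {y. vector [h,y] \<in> g ` (E \<inter> ball a (r a))}"
        then obtain p where p: "p \<in> E" "vector [h,y] = g p" by auto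
        have "g p $ 1 = h" "g p $ 2 = y" unfolding p(2)[symmetric] by simp_all
        thus "y \<in> (\<lambda>p. g p $ 2) ` {p \<in> E. g p $ 1 = h}" using p(1) by (intro image_eqI[of _ _ p]) auto
      qed
      thus "countable {y. vector [h,y] \<in> g ` (E \<inter> ball a (r a))}"
        by (rule countable_subset) (intro countable_image fib)
    qed
  qed (use S in \<open>auto intro: der J(1,2) dest: J(3)\<close>)
  hence "negligible (\<Union>a\<in>E0. E \<inter> ball a (r a))"
    using E0(2) by (intro negligible_countable_Union) auto
  moreover have "(\<Union>a\<in>E0. E \<inter> ball a (r a)) = E" using E0(3) by blast
  ultimately show ?thesis by simp
qed

section \<open>Invariant densities\<close>

lemma preserves_ac_measure_on_compose:
  assumes "preserves_ac_measure_on F U"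
  shows "preserves_ac_measure_on (F \<circ> F) U"
proof -
  obtain \<nu> where \<nu>: "\<nu> \<in> borel_measurable (lebesgue_on U)" "\<And>p. p \<in> U \<Longrightarrow> 0 < \<nu> p"
    and F: "F \<in> density (lebesgue_on U) (\<lambda>p. ennreal (\<nu> p)) \<rightarrow>\<^sub>M density (lebesgue_on U) (\<lambda>p. ennreal (\<nu> p))"
    and inv: "\<And>B. B \<in> sets (density (lebesgue_on U) (\<lambda>p. ennreal (\<nu> p))) \<Longrightarrow>
      emeasure (density (lebesgue_on U) (\<lambda>p. ennreal (\<nu> p))) (F -` B \<inter> U)
        = emeasure (density (lebesgue_on U) (\<lambda>p. ennreal (\<nu> p))) B"
    using assms unfolding preserves_ac_measure_on_def Let_def by blast
  define m where "m = density (lebesgue_on U) (\<lambda>p. ennreal (\<nu> p))"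
  have sp: "space m = U" by (simp add: m_def)
  have F': "F \<in> m \<rightarrow>\<^sub>M m" using F by (simp add: m_def)
  have "emeasure m ((F \<circ> F) -` B \<inter> U) = emeasure m B" if B: "B \<in> sets m" for B
  proof -
    have "(F \<circ> F) -` B \<inter> U = F -` (F -` B \<inter> U) \<inter> U"
      using measurable_space[OF F'] sp by auto
    moreover have "F -` B \<inter> U \<in> sets m" using measurable_sets[OF F' B] sp by simp
    ultimately show ?thesis using inv[folded m_def] B by metis
  qed
  moreover have "F \<circ> F \<in> m \<rightarrow>\<^sub>M m" using F' F' by (rule measurable_comp)
  ultimately show ?thesis
    using \<nu> unfolding preserves_ac_measure_on_def Let_def m_def by blast
qed

lemma preserves_ac_measure_on_empty: "preserves_ac_measure_on F {}"
  unfolding preserves_ac_measure_on_def Let_def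
  by (intro exI[of _ "\<lambda>_. 1"] conjI ballI) (auto simp: measurable_def sets_restrict_space)

text \<open>A map \<open>F\<close> which is invertible on a conull subset \<open>X\<close> of \<open>U\<close>, with inverse \<open>G\<close> there. The functions \<open>J\<close>
  and \<open>K\<close> are the Jacobian determinants of \<open>F\<close> and \<open>G\<close>, and \<open>g\<close> is the density from which the invariant
  one is built.\<close>

locale plane_dynamics =
  fixes F G :: "real^2 \<Rightarrow> real^2" and F' :: "real^2 \<Rightarrow> real^2 \<Rightarrow> real^2"
    and J K g :: "real^2 \<Rightarrow> real" and U X :: "(real^2) set"
  assumes U: "open U" and X: "X \<in> sets borel" "X \<subseteq> U" "negligible (U - X)"
    and FU: "\<And>p. p \<in> U \<Longrightarrow> F p \<in> U"
    and FX: "\<And>p. p \<in> X \<Longrightarrow> F p \<in> X" and GX: "\<And>p. p \<in> X \<Longrightarrow> G p \<in> X"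
    and GF: "\<And>p. p \<in> X \<Longrightarrow> G (F p) = p" and FG: "\<And>p. p \<in> X \<Longrightarrow> F (G p) = p"
    and meas [measurable]: "F \<in> borel_measurable borel" "G \<in> borel_measurable borel"
      "J \<in> borel_measurable borel" "K \<in> borel_measurable borel" "g \<in> borel_measurable borel"
    and derF: "\<And>p. p \<in> X \<Longrightarrow> (F has_derivative F' p) (at p)"
    and derG: "\<And>p. p \<in> X \<Longrightarrow> G differentiable (at p)"
    and J: "\<And>p. p \<in> X \<Longrightarrow> det (matrix (F' p)) = J p"
    and JK: "\<And>p. p \<in> X \<Longrightarrow> \<bar>K (F p)\<bar> * \<bar>J p\<bar> = 1"
    and g: "\<And>p. p \<in> X \<Longrightarrow> 0 < g p"
begin

text \<open>The invariance of \<open>\<nu>\<close> under the Jacobian rule is the change of variables formula for \<open>F\<close> on the preimage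
  of \<open>B\<close> in \<open>Y\<close>. The points outside \<open>Y\<close> form a null set.\<close>

lemma preserves_ac_measure:
  assumes Y: "Y \<in> sets borel" "Y \<subseteq> X" "negligible (X - Y)"
      "\<And>p. p \<in> Y \<Longrightarrow> F p \<in> Y" "\<And>p. p \<in> Y \<Longrightarrow> G p \<in> Y"
    and \<nu>: "\<nu> \<in> borel_measurable borel" "\<And>p. 0 < \<nu> p" "\<And>p. p \<in> Y \<Longrightarrow> \<nu> (F p) * \<bar>J p\<bar> = \<nu> p"
  shows "preserves_ac_measure_on F U"
proof -
  define m where "m = density (lebesgue_on U) (\<lambda>p. ennreal (\<nu> p))"
  have Ul: "U \<in> sets lebesgue" using U by auto
  have sets_m: "B \<in> sets m \<longleftrightarrow> B \<in> sets lebesgue \<and> B \<subseteq> U" for B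
    unfolding m_def using Ul by (simp add: sets_restrict_space_iff conj_commute)
  have sp: "space m = U" by (simp add: m_def)
  have \<nu>m: "\<nu> \<in> borel_measurable (lebesgue_on U)"
    by (rule measurable_restrict_space1, rule measurable_completion) (use \<nu>(1) in simp)
  have neg: "negligible (U - Y)"
  proof (rule negligible_subset)
    show "negligible ((U - X) \<union> (X - Y))" using X(3) Y(3) by simp
  qed blast
  have em: "emeasure m B = (\<integral>\<^sup>+x. ennreal (\<nu> x) * indicator (B \<inter> Y) x \<partial>lebesgue)" if B: "B \<in> sets m" for B
  proof -
    have "emeasure m B = (\<integral>\<^sup>+x. ennreal (\<nu> x) * indicator B x \<partial>lebesgue_on U)"
      unfolding m_def using B \<nu>m by (subst emeasure_density) (auto simp: m_def)
    also have "\<dots> = (\<integral>\<^sup>+x. ennreal (\<nu> x) * indicator B x * indicator U x \<partial>lebesgue)"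
      using Ul by (subst nn_integral_restrict_space) auto
    also have "\<dots> = (\<integral>\<^sup>+x. ennreal (\<nu> x) * indicator (B \<inter> Y) x \<partial>lebesgue)"
    proof (rule nn_integral_cong_AE)
      have "AE x in lebesgue. x \<notin> U - Y"
        using neg unfolding negligible_iff_null_sets by (rule AE_not_in)
      thus "AE x in lebesgue. ennreal (\<nu> x) * indicator B x * indicator U x = ennreal (\<nu> x) * indicator (B \<inter> Y) x"
        by eventually_elim (use B sets_m Y(2) X(2) in \<open>auto simp: indicator_def\<close>)
    qed
    finally show ?thesis .
  qed
  have pre: "F -` B \<inter> Y = G ` (B \<inter> Y)" for B
  proof (intro equalityI subsetI)
    fix p assume p: "p \<in> F -` B \<inter> Y"
    hence "F p \<in> B \<inter> Y" "p = G (F p)" using GF Y by auto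
    thus "p \<in> G ` (B \<inter> Y)" by blast
  qed (use FG Y in auto)
  have preS: "F -` B \<inter> Y \<in> sets lebesgue" if "B \<in> sets m" for B
    unfolding pre
  proof (rule differentiable_image_in_sets_lebesgue)
    show "B \<inter> Y \<in> sets lebesgue" using that sets_m Y(1) by auto
    show "G differentiable_on B \<inter> Y" unfolding differentiable_on_def
    proof
      fix x assume "x \<in> B \<inter> Y"
      hence "x \<in> X" using Y(2) by blast
      thus "G differentiable at x within B \<inter> Y" by (rule differentiable_at_withinI[OF derG])
    qed
  qed simp
  have preU: "F -` B \<inter> U \<in> sets m" if "B \<in> sets m" for B
  proof -
    have "negligible (F -` B \<inter> (U - Y))" by (rule negligible_subset[OF neg]) blast
    hence "F -` B \<inter> (U - Y) \<in> sets lebesgue" by (simp add: negligible_iff_null_sets null_setsD2)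
    moreover have "F -` B \<inter> U = (F -` B \<inter> Y) \<union> (F -` B \<inter> (U - Y))" using Y(2) X(2) by blast
    ultimately show ?thesis unfolding sets_m using preS[OF that] by auto
  qed
  have "emeasure m (F -` B \<inter> U) = emeasure m B" if B: "B \<in> sets m" for B
  proof -
    define A where "A = F -` B \<inter> Y"
    have AX: "x \<in> X" "x \<in> Y" if "x \<in> A" for x using that Y(2) unfolding A_def by auto
    have FA: "F ` A = B \<inter> Y"
    proof (intro equalityI subsetI)
      fix q assume q: "q \<in> B \<inter> Y"
      hence "G q \<in> A" "q = F (G q)" unfolding A_def using FG Y by auto
      thus "q \<in> F ` A" by blast
    qed (use Y in \<open>auto simp: A_def\<close>)
    have inj: "inj_on F A" using GF AX by (metis inj_on_inverseI)
    have "emeasure m B = (\<integral>\<^sup>+x. ennreal (\<nu> x) * indicator (F ` A) x \<partial>lebesgue)"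
      unfolding FA by (rule em[OF B])
    also have "\<dots> = (\<integral>\<^sup>+x. ennreal (\<nu> (F x)) * ennreal \<bar>J x\<bar> * indicator A x \<partial>lebesgue)"
    proof (rule nn_integral_image_eq[where g' = F'])
      show "A \<in> sets lebesgue" unfolding A_def by (rule preS[OF B])
      show "(\<lambda>x. ennreal (\<nu> x)) \<in> borel_measurable borel" using \<nu>(1) by simp
    qed (use derF J AX inj in auto)
    also have "\<dots> = (\<integral>\<^sup>+x. ennreal (\<nu> x) * indicator A x \<partial>lebesgue)"
    proof (rule nn_integral_cong)
      fix x
      have "ennreal (\<nu> (F x)) * ennreal \<bar>J x\<bar> = ennreal (\<nu> x)" if "x \<in> A"
        using \<nu>(3)[OF AX(2)[OF that]] \<nu>(2)[of "F x"] by (simp add: ennreal_mult[symmetric] less_imp_le)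
      thus "ennreal (\<nu> (F x)) * ennreal \<bar>J x\<bar> * indicator A x = ennreal (\<nu> x) * indicator A x"
        by (cases "x \<in> A") auto
    qed
    also have "A = (F -` B \<inter> U) \<inter> Y" unfolding A_def using X(2) Y(2) by blast
    also have "(\<integral>\<^sup>+x. ennreal (\<nu> x) * indicator ((F -` B \<inter> U) \<inter> Y) x \<partial>lebesgue) = emeasure m (F -` B \<inter> U)"
      by (rule em[OF preU[OF B], symmetric])
    finally show ?thesis by simp
  qed
  moreover have "F \<in> m \<rightarrow>\<^sub>M m"
    by (rule measurableI) (use FU preU sp in auto)
  ultimately show ?thesis
    unfolding preserves_ac_measure_on_def Let_def using \<nu>m \<nu>(2) unfolding m_def by blast
qed

text \<open>The density \<open>g\<close> pulled back by the \<open>n\<close>-th iterates of \<open>F\<close> and of \<open>G\<close>.\<close>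

definition fw :: "nat \<Rightarrow> real^2 \<Rightarrow> real" where
  "fw n p = (\<Prod>i<n. \<bar>J ((F ^^ i) p)\<bar>) * g ((F ^^ n) p)"

definition bw :: "nat \<Rightarrow> real^2 \<Rightarrow> real" where
  "bw n p = (\<Prod>i<n. \<bar>K ((G ^^ i) p)\<bar>) * g ((G ^^ n) p)"

definition osup :: "real^2 \<Rightarrow> ennreal" where
  "osup p = (SUP n. max (ennreal (fw n p)) (ennreal (bw n p)))"

lemma fw_Suc: "fw (Suc n) p = fw n (F p) * \<bar>J p\<bar>"
  unfolding fw_def prod.lessThan_Suc_shift by (simp add: funpow_swap1)

lemma bw_Suc: "bw (Suc n) p = bw n (G p) * \<bar>K p\<bar>"
  unfolding bw_def prod.lessThan_Suc_shift by (simp add: funpow_swap1)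

lemma bw_Suc_F: "p \<in> X \<Longrightarrow> bw (Suc n) (F p) * \<bar>J p\<bar> = bw n p"
  using JK[of p] GF[of p] by (simp add: bw_Suc mult.assoc)

lemma fw_le: "ennreal (fw n p) \<le> osup p" and bw_le: "ennreal (bw n p) \<le> osup p"
  unfolding osup_def by (rule SUP_upper2[of n]; simp)+

text \<open>Multiplication by the Jacobian maps the family of pullbacks at \<open>F p\<close> onto the family at \<open>p\<close>, shifted
  by one iterate.\<close>

lemma osup_F:
  assumes p: "p \<in> X"
  shows "osup (F p) * ennreal \<bar>J p\<bar> = osup p"
proof (rule antisym)
  have J: "ennreal a * ennreal \<bar>J p\<bar> = ennreal (a * \<bar>J p\<bar>)" for a
    by (metis abs_ge_zero ennreal_mult'' )
  have "osup (F p) * ennreal \<bar>J p\<bar> = (SUP n. max (ennreal (fw n (F p))) (ennreal (bw n (F p))) * ennreal \<bar>J p\<bar>)"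
    unfolding osup_def by (rule SUP_mult_right_ennreal)
  also have "\<dots> \<le> osup p"
  proof (rule SUP_least)
    fix n
    have 1: "ennreal (fw n (F p)) * ennreal \<bar>J p\<bar> \<le> osup p"
      unfolding J fw_Suc[symmetric] by (rule fw_le)
    have 2: "ennreal (bw n (F p)) * ennreal \<bar>J p\<bar> \<le> osup p"
    proof (cases n)
      case 0
      have "bw 0 (F p) = fw 0 (F p)" by (simp add: bw_def fw_def)
      thus ?thesis unfolding 0 J using fw_Suc[of 0 p] fw_le[of "Suc 0" p] by simp
    next
      case (Suc k)
      show ?thesis unfolding Suc J bw_Suc_F[OF p] by (rule bw_le)
    qed
    show "max (ennreal (fw n (F p))) (ennreal (bw n (F p))) * ennreal \<bar>J p\<bar> \<le> osup p"
      using 1 2 by (auto simp: max_def)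
  qed
  finally show "osup (F p) * ennreal \<bar>J p\<bar> \<le> osup p" .
  have b: "ennreal (bw n p) \<le> osup (F p) * ennreal \<bar>J p\<bar>" for n
    unfolding bw_Suc_F[OF p, symmetric] J[symmetric] by (intro mult_right_mono bw_le) simp
  have f: "ennreal (fw n p) \<le> osup (F p) * ennreal \<bar>J p\<bar>" for n
  proof (cases n)
    case 0
    have "fw 0 p = bw 0 p" by (simp add: bw_def fw_def)
    thus ?thesis using b[of 0] 0 by simp
  next
    case (Suc k)
    show ?thesis unfolding Suc fw_Suc J[symmetric] by (intro mult_right_mono fw_le) simp
  qed
  show "osup p \<le> osup (F p) * ennreal \<bar>J p\<bar>"
    unfolding osup_def[of p] by (rule SUP_least) (simp add: b f)
qed

lemma osup_measurable [measurable]: "osup \<in> borel_measurable borel"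
proof -
  have [measurable]: "(F ^^ n) \<in> borel_measurable borel" "(G ^^ n) \<in> borel_measurable borel" for n
    by (induction n) auto
  have "(\<lambda>p. SUP n. max (ennreal (fw n p)) (ennreal (bw n p))) \<in> borel_measurable borel"
    unfolding fw_def bw_def by measurable
  thus ?thesis unfolding osup_def by simp
qed

lemma finite_osup_preserves_ac_measure:
  assumes fin: "negligible {p \<in> X. osup p = \<infinity>}"
  shows "preserves_ac_measure_on F U"
proof -
  define Y where "Y = {p \<in> X. osup p \<noteq> \<infinity>}"
  define \<nu> where "\<nu> = (\<lambda>p. if p \<in> Y then enn2real (osup p) else 1)"
  have Yb: "Y \<in> sets borel" unfolding Y_def using X(1) by measurable
  have pos: "0 < osup p" if "p \<in> X" for p
  proof -
    have "ennreal (fw 0 p) \<le> osup p" by (rule fw_le)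
    moreover have "0 < ennreal (fw 0 p)" using g[OF that] by (simp add: fw_def ennreal_less_zero_iff)
    ultimately show ?thesis by (rule less_le_trans[rotated])
  qed
  have J0: "J p \<noteq> 0" if "p \<in> X" for p using JK[OF that] by auto
  have FY: "F p \<in> Y" if "p \<in> Y" for p
    using that osup_F[of p] FX[of p] J0[of p] unfolding Y_def
    by (auto simp: ennreal_top_mult)
  have GY: "G p \<in> Y" if "p \<in> Y" for p
  proof -
    have p: "p \<in> X" "osup p \<noteq> \<infinity>" using that unfolding Y_def by auto
    have "osup (G p) = osup p * ennreal \<bar>J (G p)\<bar>"
      using osup_F[OF GX[OF p(1)]] FG[OF p(1)] by simp
    hence "osup (G p) \<noteq> \<infinity>" using p(2) by (simp add: ennreal_mult_eq_top_iff)
    thus ?thesis using GX[OF p(1)] unfolding Y_def by simp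
  qed
  show ?thesis
  proof (rule preserves_ac_measure[OF Yb _ _ FY GY])
    show "Y \<subseteq> X" unfolding Y_def by blast
    have "X - Y = {p \<in> X. osup p = \<infinity>}" unfolding Y_def by blast
    thus "negligible (X - Y)" using fin by simp
    show "\<nu> \<in> borel_measurable borel" unfolding \<nu>_def using Yb by measurable
    show "0 < \<nu> p" for p
      using pos[of p] unfolding \<nu>_def Y_def by (auto simp: enn2real_positive_iff top.not_eq_extremum)
    show "\<nu> (F p) * \<bar>J p\<bar> = \<nu> p" if p: "p \<in> Y" for p
    proof -
      have "enn2real (osup (F p)) * \<bar>J p\<bar> = enn2real (osup (F p) * ennreal \<bar>J p\<bar>)"
        by (simp add: enn2real_mult)
      thus ?thesis using p FY[OF p] osup_F[of p] unfolding \<nu>_def Y_def by simp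
    qed
  qed
qed

end

section \<open>The spherical derivative of a rational function is bounded\<close>

lemma spherical_bound_disc:
  fixes P Q W :: "complex poly"
  assumes "\<And>z. norm z \<le> 1 \<Longrightarrow> poly P z \<noteq> 0 \<or> poly Q z \<noteq> 0"
  shows "\<exists>C. \<forall>z. norm z \<le> 1 \<longrightarrow>
    norm (poly W z) * (1 + (norm z)\<^sup>2) \<le> C * ((norm (poly P z))\<^sup>2 + (norm (poly Q z))\<^sup>2)"
proof -
  have pos: "(norm (poly P z))\<^sup>2 + (norm (poly Q z))\<^sup>2 > 0" if "norm z \<le> 1" for z
    using assms[OF that] by (metis sum_power2_gt_zero_iff norm_eq_zero)
  define f where "f = (\<lambda>z. norm (poly W z) * (1 + (norm z)\<^sup>2) / ((norm (poly P z))\<^sup>2 + (norm (poly Q z))\<^sup>2))"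
  have "continuous_on (cball 0 1) f" unfolding f_def
    by (intro continuous_intros) (use pos in \<open>auto simp: less_le\<close>)
  hence "compact (f ` cball 0 1)" by (intro compact_continuous_image) auto
  hence "bounded (f ` cball 0 1)" by (rule compact_imp_bounded)
  then obtain C where C': "\<forall>x\<in>cball 0 1. norm (f x) \<le> C" by (auto simp: bounded_iff)
  have C: "norm (f z) \<le> C" if "norm z \<le> 1" for z using C' that by simp
  show ?thesis
  proof (intro exI allI impI)
    fix z :: complex assume z: "norm z \<le> 1"
    have "f z \<le> C" using C[OF z] by simp
    thus "norm (poly W z) * (1 + (norm z)\<^sup>2) \<le> C * ((norm (poly P z))\<^sup>2 + (norm (poly Q z))\<^sup>2)"
      unfolding f_def using pos[OF z] by (simp add: divide_le_eq)
  qed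
qed

text \<open>The polynomial \<open>u ^ e P (1/u)\<close>, that is, \<open>P\<close> in the coordinate \<open>1/z\<close> at infinity.\<close>

definition revpoly :: "nat \<Rightarrow> complex poly \<Rightarrow> complex poly" where
  "revpoly e P = Polynomial.monom 1 (e - degree P) * reflect_poly P"

lemma poly_revpoly:
  assumes "degree P \<le> e" "u \<noteq> 0"
  shows "poly (revpoly e P) u = u ^ e * poly P (inverse u)"
  unfolding revpoly_def using assms
  by (simp add: poly_monom poly_reflect_poly_nz mult.assoc[symmetric] power_add[symmetric])

lemma pderiv_revpoly:
  assumes e: "degree P \<le> e" and u: "u \<noteq> 0"
  shows "u\<^sup>2 * poly (pderiv (revpoly e P)) u
    = of_nat e * u ^ Suc e * poly P (inverse u) - u ^ e * poly (pderiv P) (inverse u)"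
proof -
  have D1: "((\<lambda>u. u ^ e * poly P (inverse u)) has_field_derivative
      of_nat e * u ^ (e - Suc 0) * poly P (inverse u)
        + u ^ e * (poly (pderiv P) (inverse u) * (- (inverse u ^ 2)))) (at u)"
  proof -
    have 1: "((\<lambda>u. u ^ e) has_field_derivative of_nat e * u ^ (e - Suc 0)) (at u)"
      by (auto intro!: derivative_eq_intros)
    have 2: "(inverse has_field_derivative - (inverse u ^ 2)) (at u)"
      using DERIV_inverse[OF u] by (simp add: numeral_2_eq_2)
    have 3: "((\<lambda>u. poly P (inverse u)) has_field_derivative
        poly (pderiv P) (inverse u) * (- (inverse u ^ 2))) (at u)"
      using DERIV_chain2[OF poly_DERIV 2] by simp
    show ?thesis using DERIV_mult[OF 1 3] by (simp add: algebra_simps)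
  qed
  have "(poly (revpoly e P) has_field_derivative
      of_nat e * u ^ (e - Suc 0) * poly P (inverse u)
        + u ^ e * (poly (pderiv P) (inverse u) * (- (inverse u ^ 2)))) (at u)"
    by (rule has_field_derivative_transform_within_open[OF D1, of "- {0}"])
      (use u poly_revpoly[OF e] in auto)
  hence "poly (pderiv (revpoly e P)) u = of_nat e * u ^ (e - Suc 0) * poly P (inverse u)
        + u ^ e * (poly (pderiv P) (inverse u) * (- (inverse u ^ 2)))"
    using DERIV_unique[OF poly_DERIV] by blast
  moreover have "u\<^sup>2 * (of_nat e * u ^ (e - Suc 0) * poly P (inverse u)) = of_nat e * u ^ Suc e * poly P (inverse u)"
    by (cases e) (simp_all add: power2_eq_square)
  moreover have "u\<^sup>2 * (u ^ e * (poly (pderiv P) (inverse u) * (- (inverse u ^ 2)))) = - (u ^ e * poly (pderiv P) (inverse u))"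
    using u by (simp add: power_inverse field_simps)
  ultimately show ?thesis by (simp only: distrib_left) simp
qed

text \<open>The bound is clear on the unit disc by compactness. The inversion \<open>z = 1/u\<close> is an isometry of the
  sphere and maps the rest of the plane into the disc, where the reversed polynomials take the place of \<open>P\<close> and \<open>Q\<close>.\<close>

lemma spherical_bound:
  fixes P Q :: "complex poly"
  assumes nz: "\<And>z. poly P z \<noteq> 0 \<or> poly Q z \<noteq> 0"
  shows "\<exists>C. \<forall>z. norm (poly (pderiv P * Q - P * pderiv Q) z) * (1 + (norm z)\<^sup>2)
    \<le> C * ((norm (poly P z))\<^sup>2 + (norm (poly Q z))\<^sup>2)"
proof -
  define W where "W = pderiv P * Q - P * pderiv Q"
  define e where "e = max (degree P) (degree Q)"
  have e: "degree P \<le> e" "degree Q \<le> e" by (simp_all add: e_def)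
  define P1 Q1 where "P1 = revpoly e P" and "Q1 = revpoly e Q"
  define W1 where "W1 = pderiv P1 * Q1 - P1 * pderiv Q1"
  obtain C1 where C1: "\<And>z. norm z \<le> 1 \<Longrightarrow> norm (poly W z) * (1 + (norm z)\<^sup>2)
      \<le> C1 * ((norm (poly P z))\<^sup>2 + (norm (poly Q z))\<^sup>2)"
    using spherical_bound_disc[of P Q W] nz by blast
  have "poly P1 u \<noteq> 0 \<or> poly Q1 u \<noteq> 0" for u
  proof (cases "u = 0")
    case False
    thus ?thesis unfolding P1_def Q1_def poly_revpoly[OF e(1) False] poly_revpoly[OF e(2) False]
      using nz[of "inverse u"] by simp
  next
    case True
    have "P \<noteq> 0 \<or> Q \<noteq> 0" using nz[of 0] by auto
    hence "P \<noteq> 0 \<and> degree P = e \<or> Q \<noteq> 0 \<and> degree Q = e" by (auto simp: e_def max_def)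
    thus ?thesis unfolding True P1_def Q1_def revpoly_def by (auto simp: poly_monom)
  qed
  then obtain C2 where C2: "\<And>z. norm z \<le> 1 \<Longrightarrow> norm (poly W1 z) * (1 + (norm z)\<^sup>2)
      \<le> C2 * ((norm (poly P1 z))\<^sup>2 + (norm (poly Q1 z))\<^sup>2)"
    using spherical_bound_disc[of P1 Q1 W1] by blast
  have far: "norm (poly W z) * (1 + (norm z)\<^sup>2) \<le> C2 * ((norm (poly P z))\<^sup>2 + (norm (poly Q z))\<^sup>2)"
    if z: "norm z > 1" for z
  proof -
    define u where "u = inverse z"
    have u0: "u \<noteq> 0" and zu: "inverse u = z" using z by (auto simp: u_def)
    have nu: "norm u \<le> 1" using z by (simp add: u_def norm_inverse inverse_le_1_iff)
    define U where "U = u ^ e"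
    have U0: "U \<noteq> 0" using u0 by (simp add: U_def)
    have PQ: "poly P1 u = U * poly P z" "poly Q1 u = U * poly Q z"
      unfolding P1_def Q1_def U_def using poly_revpoly e u0 zu by auto
    have dPQ: "u\<^sup>2 * poly (pderiv P1) u = of_nat e * u * U * poly P z - U * poly (pderiv P) z"
      "u\<^sup>2 * poly (pderiv Q1) u = of_nat e * u * U * poly Q z - U * poly (pderiv Q) z"
      unfolding P1_def Q1_def U_def pderiv_revpoly[OF e(1) u0] pderiv_revpoly[OF e(2) u0] zu by simp_all
    have "u\<^sup>2 * poly W1 u = (u\<^sup>2 * poly (pderiv P1) u) * poly Q1 u - poly P1 u * (u\<^sup>2 * poly (pderiv Q1) u)"
      unfolding W1_def by (simp add: algebra_simps)
    also have "\<dots> = - (U\<^sup>2 * poly W z)"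
      unfolding dPQ PQ W_def by (simp add: algebra_simps power2_eq_square)
    finally have "norm (u\<^sup>2 * poly W1 u) = norm (U\<^sup>2 * poly W z)" by simp
    hence nW: "(norm u)\<^sup>2 * norm (poly W1 u) = (norm U)\<^sup>2 * norm (poly W z)"
      by (simp add: norm_mult norm_power)
    have un: "(norm u)\<^sup>2 * (1 + (norm z)\<^sup>2) = 1 + (norm u)\<^sup>2"
    proof -
      have "norm u * norm z = norm (u * z)" by (simp add: norm_mult)
      also have "\<dots> = 1" using u0 zu by auto
      finally have "(norm u)\<^sup>2 * (norm z)\<^sup>2 = 1" by (metis power_mult_distrib power_one)
      thus ?thesis by (simp add: distrib_left)
    qed
    have "(norm U)\<^sup>2 * (norm (poly W z) * (1 + (norm z)\<^sup>2)) = norm (poly W1 u) * ((norm u)\<^sup>2 * (1 + (norm z)\<^sup>2))"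
      using nW by (metis mult.assoc mult.commute)
    also have "\<dots> = norm (poly W1 u) * (1 + (norm u)\<^sup>2)" unfolding un ..
    also have "\<dots> \<le> C2 * ((norm (poly P1 u))\<^sup>2 + (norm (poly Q1 u))\<^sup>2)" by (rule C2[OF nu])
    also have "\<dots> = (norm U)\<^sup>2 * (C2 * ((norm (poly P z))\<^sup>2 + (norm (poly Q z))\<^sup>2))"
      unfolding PQ by (simp add: norm_mult power_mult_distrib algebra_simps)
    finally show ?thesis using U0 by (simp add: mult_le_cancel_left)
  qed
  show ?thesis
  proof (intro exI[of _ "max C1 C2"] allI)
    fix z
    have nn: "0 \<le> (norm (poly P z))\<^sup>2 + (norm (poly Q z))\<^sup>2" by simp
    have "norm (poly W z) * (1 + (norm z)\<^sup>2) \<le> max C1 C2 * ((norm (poly P z))\<^sup>2 + (norm (poly Q z))\<^sup>2)"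
    proof (cases "norm z \<le> 1")
      case True
      show ?thesis by (rule order_trans[OF C1[OF True] mult_right_mono[OF _ nn]]) simp
    next
      case False
      show ?thesis by (rule order_trans[OF far mult_right_mono[OF _ nn]]) (use False in simp_all)
    qed
    thus "norm (poly (pderiv P * Q - P * pderiv Q) z) * (1 + (norm z)\<^sup>2)
      \<le> max C1 C2 * ((norm (poly P z))\<^sup>2 + (norm (poly Q z))\<^sup>2)" unfolding W_def .
  qed
qed

section \<open>Finiteness of the orbit supremum\<close>

context plane_dynamics begin

lemma funpow_FX: "p \<in> X \<Longrightarrow> (F ^^ n) p \<in> X" and funpow_GX: "p \<in> X \<Longrightarrow> (G ^^ n) p \<in> X"
  by (induction n) (auto simp: FX GX)

lemma G_funpow_F: "p \<in> X \<Longrightarrow> (G ^^ n) ((F ^^ n) p) = p"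
proof (induction n)
  case (Suc n)
  have "(G ^^ Suc n) ((F ^^ Suc n) p) = (G ^^ n) (G (F ((F ^^ n) p)))" by (simp add: funpow_swap1)
  thus ?case using Suc GF[OF funpow_FX] by simp
qed simp

lemma F_funpow_G: "p \<in> X \<Longrightarrow> (F ^^ n) ((G ^^ n) p) = p"
proof (induction n)
  case (Suc n)
  have "(F ^^ Suc n) ((G ^^ Suc n) p) = (F ^^ n) (F (G ((G ^^ n) p)))" by (simp add: funpow_swap1)
  thus ?case using Suc FG[OF funpow_GX] by simp
qed simp

text \<open>The pullbacks of \<open>\<kappa>\<close> at \<open>p\<close> all telescope to \<open>\<kappa> p\<close>, so a bound of \<open>g\<close> by \<open>\<kappa>\<close> along the orbit bounds
  every pullback of \<open>g\<close> at \<open>p\<close> alike.\<close>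

lemma osup_finite:
  assumes p: "p \<in> X"
    and bound: "\<And>q. q \<in> Ob \<Longrightarrow> g q \<le> C * \<kappa> q"
    and transport: "\<And>q. q \<in> Ob \<Longrightarrow> F q \<in> Ob \<Longrightarrow> \<bar>J q\<bar> * \<kappa> (F q) = \<kappa> q"
    and Ob: "\<And>n. (F ^^ n) p \<in> Ob" "\<And>n. (G ^^ n) p \<in> Ob"
  shows "osup p \<noteq> \<infinity>"
proof -
  have f: "(\<Prod>i<n. \<bar>J ((F ^^ i) p)\<bar>) * \<kappa> ((F ^^ n) p) = \<kappa> p" for n
  proof (induction n)
    case (Suc n)
    have "\<bar>J ((F ^^ n) p)\<bar> * \<kappa> ((F ^^ Suc n) p) = \<kappa> ((F ^^ n) p)"
      using transport[of "(F ^^ n) p"] Ob(1)[of n] Ob(1)[of "Suc n"] by simp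
    thus ?case using Suc by (simp add: mult.assoc)
  qed simp
  have b: "(\<Prod>i<n. \<bar>K ((G ^^ i) p)\<bar>) * \<kappa> ((G ^^ n) p) = \<kappa> p" for n
  proof (induction n)
    case (Suc n)
    define q where "q = (G ^^ n) p"
    have q: "q \<in> X" "q \<in> Ob" "G q \<in> Ob" "F (G q) = q" "G q \<in> X"
      using funpow_GX[OF p, of n] Ob(2)[of n] Ob(2)[of "Suc n"] FG GX unfolding q_def by auto
    have "\<bar>J (G q)\<bar> * \<kappa> q = \<kappa> (G q)" using transport[of "G q"] q by simp
    moreover have "\<bar>K q\<bar> * \<bar>J (G q)\<bar> = 1" using JK[of "G q"] q by simp
    ultimately have "\<bar>K q\<bar> * \<kappa> (G q) = \<kappa> q" by (metis mult.assoc mult_1)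
    thus ?case using Suc unfolding q_def by (simp add: mult.assoc)
  qed simp
  have 1: "fw n p \<le> C * \<kappa> p" for n
  proof -
    have "fw n p \<le> (\<Prod>i<n. \<bar>J ((F ^^ i) p)\<bar>) * (C * \<kappa> ((F ^^ n) p))"
      unfolding fw_def by (intro mult_left_mono bound Ob prod_nonneg) simp
    thus ?thesis using f[of n] by (simp add: mult.left_commute[of _ C])
  qed
  have 2: "bw n p \<le> C * \<kappa> p" for n
  proof -
    have "bw n p \<le> (\<Prod>i<n. \<bar>K ((G ^^ i) p)\<bar>) * (C * \<kappa> ((G ^^ n) p))"
      unfolding bw_def by (intro mult_left_mono bound Ob prod_nonneg) simp
    thus ?thesis using b[of n] by (simp add: mult.left_commute[of _ C])
  qed
  have "osup p \<le> ennreal (C * \<kappa> p)"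
    unfolding osup_def by (rule SUP_least) (simp add: 1 2 ennreal_leI)
  thus ?thesis by (auto simp: top_unique)
qed

lemma countable_orbits:
  assumes "countable Z"
  shows "countable {p \<in> X. \<exists>n. (F ^^ n) p \<in> Z \<or> (G ^^ n) p \<in> Z}"
proof (rule countable_subset)
  show "{p \<in> X. \<exists>n. (F ^^ n) p \<in> Z \<or> (G ^^ n) p \<in> Z} \<subseteq> (\<Union>n. (G ^^ n) ` Z \<union> (F ^^ n) ` Z)"
  proof
    fix p assume "p \<in> {p \<in> X. \<exists>n. (F ^^ n) p \<in> Z \<or> (G ^^ n) p \<in> Z}"
    then obtain n where p: "p \<in> X" "(F ^^ n) p \<in> Z \<or> (G ^^ n) p \<in> Z" by blast
    have "p \<in> (G ^^ n) ` Z \<union> (F ^^ n) ` Z"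
      using p(2) imageI[of "(F ^^ n) p" Z "G ^^ n"] imageI[of "(G ^^ n) p" Z "F ^^ n"]
      unfolding G_funpow_F[OF p(1)] F_funpow_G[OF p(1)] by blast
    thus "p \<in> (\<Union>n. (G ^^ n) ` Z \<union> (F ^^ n) ` Z)" by blast
  qed
  show "countable (\<Union>n. (G ^^ n) ` Z \<union> (F ^^ n) ` Z)" using assms by auto
qed

end

section \<open>Moebius dynamics on a curve\<close>

text \<open>On a level curve with a coordinate \<open>\<phi>\<close> in which the map is a Moebius transformation and the
  plane coordinate \<open>u\<close> is the rational function \<open>P/Q\<close>. Derivatives along the curve are denoted by
  \<open>d\<phi>\<close> and \<open>du\<close>. The vector field \<open>q \<partial>/\<partial>\<phi>\<close>, with the fixed points of the transformation as its
  zeros, is invariant, so \<open>\<kappa> = \<bar>d\<phi> / q(\<phi>)\<bar>\<close> is transported. If the transformation is the identity, \<open>q\<close> vanishes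
  identically, but then \<open>\<kappa> = \<bar>d\<phi>\<bar>\<close> is transported.\<close>

lemma moebius_transport:
  fixes F :: "'p \<Rightarrow> 'p" and \<phi> d\<phi> :: "'p \<Rightarrow> complex" and u du J :: "'p \<Rightarrow> real"
  assumes det: "a * d - b * c \<noteq> 0" and PQ: "\<And>z. poly P z \<noteq> 0 \<or> poly Q z \<noteq> 0"
    and u: "\<And>p. p \<in> Ob \<Longrightarrow> complex_of_real (u p) * poly Q (\<phi> p) = poly P (\<phi> p)"
    and du: "\<And>p. p \<in> Ob \<Longrightarrow> complex_of_real (du p) * (poly Q (\<phi> p))\<^sup>2
      = poly (pderiv P * Q - P * pderiv Q) (\<phi> p) * d\<phi> p"
    and F: "\<And>p. p \<in> Ob \<Longrightarrow> F p \<in> Ob \<Longrightarrow> (c * \<phi> p + d) * \<phi> (F p) = a * \<phi> p + b"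
    and dF: "\<And>p. p \<in> Ob \<Longrightarrow> F p \<in> Ob \<Longrightarrow>
      complex_of_real (J p) * d\<phi> (F p) * (c * \<phi> p + d)\<^sup>2 = (a * d - b * c) * d\<phi> p"
  shows "\<exists>C \<kappa> B. finite B \<and> (\<forall>p\<in>Ob. \<phi> p \<notin> B \<longrightarrow> \<bar>du p\<bar> / (1 + (u p)\<^sup>2) \<le> C * \<kappa> p) \<and>
    (\<forall>p\<in>Ob. F p \<in> Ob \<longrightarrow> \<phi> p \<notin> B \<longrightarrow> \<phi> (F p) \<notin> B \<longrightarrow> \<bar>J p\<bar> * \<kappa> (F p) = (\<kappa> p :: real))"
proof -
  obtain C where C: "\<And>z. norm (poly (pderiv P * Q - P * pderiv Q) z) * (1 + (norm z)\<^sup>2)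
    \<le> C * ((norm (poly P z))\<^sup>2 + (norm (poly Q z))\<^sup>2)" using spherical_bound[OF PQ] by blast
  have C0: "0 \<le> C"
  proof -
    have "0 \<le> C * ((norm (poly P 0))\<^sup>2 + (norm (poly Q 0))\<^sup>2)"
      by (rule order_trans[OF _ C[of 0]]) simp
    moreover have "0 < (norm (poly P 0))\<^sup>2 + (norm (poly Q 0))\<^sup>2"
      using PQ[of 0] by (metis sum_power2_gt_zero_iff norm_eq_zero)
    ultimately show ?thesis by (simp add: zero_le_mult_iff)
  qed
  have bnd: "\<bar>du p\<bar> / (1 + (u p)\<^sup>2) \<le> C * (norm (d\<phi> p) / (1 + (norm (\<phi> p))\<^sup>2))" if p: "p \<in> Ob" for p
  proof -
    define z where "z = \<phi> p"
    have Q0: "poly Q z \<noteq> 0" using u[OF p] PQ[of z] unfolding z_def by auto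
    have nP: "norm (poly P z) = \<bar>u p\<bar> * norm (poly Q z)"
      using arg_cong[OF u[OF p], of norm] unfolding z_def by (simp add: norm_mult)
    have nd: "\<bar>du p\<bar> * (norm (poly Q z))\<^sup>2 = norm (poly (pderiv P * Q - P * pderiv Q) z) * norm (d\<phi> p)"
      using arg_cong[OF du[OF p], of norm] unfolding z_def by (simp only: norm_mult norm_power norm_of_real)
    have "\<bar>du p\<bar> * (1 + (norm z)\<^sup>2) * (norm (poly Q z))\<^sup>2
        = norm (poly (pderiv P * Q - P * pderiv Q) z) * (1 + (norm z)\<^sup>2) * norm (d\<phi> p)"
      using nd by (metis mult.assoc mult.commute)
    also have "\<dots> \<le> C * ((norm (poly P z))\<^sup>2 + (norm (poly Q z))\<^sup>2) * norm (d\<phi> p)"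
      by (rule mult_right_mono[OF C]) simp
    also have "\<dots> = C * (1 + (u p)\<^sup>2) * norm (d\<phi> p) * (norm (poly Q z))\<^sup>2"
      unfolding nP by (simp add: power_mult_distrib algebra_simps)
    finally have "\<bar>du p\<bar> * (1 + (norm z)\<^sup>2) \<le> C * (1 + (u p)\<^sup>2) * norm (d\<phi> p)"
      using Q0 by (simp add: mult_le_cancel_right)
    moreover have "0 < 1 + (u p)\<^sup>2" "0 < 1 + (norm z)\<^sup>2" by (simp_all add: add_pos_nonneg)
    ultimately show ?thesis unfolding z_def[symmetric] by (simp add: field_simps)
  qed
  show ?thesis
  proof (cases "c = 0 \<and> d = a \<and> b = 0")
    case True
    hence a0: "a \<noteq> 0" using det by auto
    have t: "\<bar>J p\<bar> * norm (d\<phi> (F p)) = norm (d\<phi> p)" if "p \<in> Ob" "F p \<in> Ob" for p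
    proof -
      have "complex_of_real (J p) * d\<phi> (F p) = d\<phi> p" using dF[OF that] True a0 by (simp add: power2_eq_square)
      thus ?thesis by (metis norm_mult norm_of_real)
    qed
    have "\<bar>du p\<bar> / (1 + (u p)\<^sup>2) \<le> C * norm (d\<phi> p)" if "p \<in> Ob" for p
    proof (rule order_trans[OF bnd[OF that] mult_left_mono[OF _ C0]])
      have "norm (d\<phi> p) / (1 + (norm (\<phi> p))\<^sup>2) \<le> norm (d\<phi> p) / 1"
        by (intro divide_left_mono) (auto simp: add_pos_nonneg)
      thus "norm (d\<phi> p) / (1 + (norm (\<phi> p))\<^sup>2) \<le> norm (d\<phi> p)" by simp
    qed
    thus ?thesis using t by (intro exI[of _ C] exI[of _ "\<lambda>p. norm (d\<phi> p)"] exI[of _ "{}"]) auto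
  next
    case False
    define q where "q = [:-b, d - a, c:]"
    have q: "poly q z = c * z\<^sup>2 + (d - a) * z - b" for z
      unfolding q_def by (simp add: algebra_simps power2_eq_square)
    have "q \<noteq> 0" using False unfolding q_def by auto
    hence B: "finite {z. poly q z = 0}" by (rule poly_roots_finite)
    define M where "M = norm b + norm (d - a) + norm c"
    have M0: "0 \<le> M" by (simp add: M_def)
    have qM: "norm (poly q z) \<le> M * (1 + (norm z)\<^sup>2)" for z
    proof -
      have z1: "norm z \<le> 1 + (norm z)\<^sup>2"
      proof -
        have "0 \<le> (norm z - 1 / 2)\<^sup>2" by simp
        hence "norm z \<le> (norm z)\<^sup>2 + 1 / 4" by (simp add: power2_eq_square algebra_simps)
        thus ?thesis by simp
      qed
      have "norm (poly q z) \<le> norm c * (norm z)\<^sup>2 + norm (d - a) * norm z + norm b"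
        unfolding q using norm_triangle_ineq4[of "c * z\<^sup>2 + (d - a) * z" b] norm_triangle_ineq[of "c * z\<^sup>2" "(d - a) * z"]
        by (simp add: norm_mult norm_power)
      also have "\<dots> \<le> norm c * (1 + (norm z)\<^sup>2) + norm (d - a) * (1 + (norm z)\<^sup>2) + norm b * (1 + (norm z)\<^sup>2)"
        using z1 by (intro add_mono mult_left_mono) (auto intro: mult_left_mono[of 1 "1 + (norm z)\<^sup>2" "norm b", simplified])
      finally show ?thesis unfolding M_def by (simp add: algebra_simps)
    qed
    define \<kappa> where "\<kappa> = (\<lambda>p. norm (d\<phi> p) / norm (poly q (\<phi> p)))"
    have 1: "\<bar>du p\<bar> / (1 + (u p)\<^sup>2) \<le> (C * M) * \<kappa> p" if p: "p \<in> Ob" "poly q (\<phi> p) \<noteq> 0" for p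
    proof -
      have pos: "0 < 1 + (norm (\<phi> p))\<^sup>2" by (simp add: add_pos_nonneg)
      have "norm (d\<phi> p) * norm (poly q (\<phi> p)) \<le> norm (d\<phi> p) * (M * (1 + (norm (\<phi> p))\<^sup>2))"
        by (intro mult_left_mono qM) simp
      hence "norm (d\<phi> p) / (1 + (norm (\<phi> p))\<^sup>2) \<le> M * \<kappa> p"
        unfolding \<kappa>_def using pos p(2) by (simp add: field_simps)
      hence "C * (norm (d\<phi> p) / (1 + (norm (\<phi> p))\<^sup>2)) \<le> C * (M * \<kappa> p)" using C0 by (rule mult_left_mono)
      thus ?thesis using bnd[OF p(1)] by (simp add: mult.assoc)
    qed
    have 2: "\<bar>J p\<bar> * \<kappa> (F p) = \<kappa> p" if p: "p \<in> Ob" "F p \<in> Ob" "poly q (\<phi> p) \<noteq> 0" "poly q (\<phi> (F p)) \<noteq> 0" for p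
    proof -
      define z w s where "z = \<phi> p" and "w = \<phi> (F p)" and "s = c * \<phi> p + d"
      have sw: "s * w = a * z + b" using F[OF p(1,2)] by (simp add: s_def w_def z_def)
      have "s\<^sup>2 * poly q w = c * (s * w)\<^sup>2 + (d - a) * (s * w) * s - b * s\<^sup>2"
        unfolding q by (simp add: algebra_simps power2_eq_square)
      also have "\<dots> = c * (a * z + b)\<^sup>2 + (d - a) * (a * z + b) * s - b * s\<^sup>2" by (simp only: sw)
      also have "\<dots> = (a * d - b * c) * poly q z"
        unfolding q s_def z_def[symmetric] by (simp add: algebra_simps power2_eq_square)
      finally have q2: "s\<^sup>2 * poly q w = (a * d - b * c) * poly q z" .
      have d2: "complex_of_real (J p) * d\<phi> (F p) * s\<^sup>2 = (a * d - b * c) * d\<phi> p"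
        using dF[OF p(1,2)] by (simp add: s_def)
      have s0: "s \<noteq> 0" using q2 det p(3) unfolding z_def by auto
      have "(a * d - b * c) * (complex_of_real (J p) * d\<phi> (F p) * poly q z)
          = complex_of_real (J p) * d\<phi> (F p) * ((a * d - b * c) * poly q z)" by (simp add: mult_ac)
      also have "\<dots> = (complex_of_real (J p) * d\<phi> (F p) * s\<^sup>2) * poly q w" unfolding q2[symmetric] by (simp add: mult_ac)
      also have "\<dots> = (a * d - b * c) * (d\<phi> p * poly q w)" unfolding d2 by (simp add: mult_ac)
      finally have "complex_of_real (J p) * d\<phi> (F p) * poly q z = d\<phi> p * poly q w" using det by simp
      hence "norm (complex_of_real (J p) * d\<phi> (F p) * poly q z) = norm (d\<phi> p * poly q w)" by simp
      hence "\<bar>J p\<bar> * norm (d\<phi> (F p)) * norm (poly q z) = norm (d\<phi> p) * norm (poly q w)"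
        by (simp add: norm_mult)
      thus ?thesis unfolding \<kappa>_def using p(3,4) by (simp add: z_def w_def field_simps)
    qed
    show ?thesis using B 1 2
      by (intro exI[of _ "C * M"] exI[of _ \<kappa>] exI[of _ "{z. poly q z = 0}"]) auto
  qed
qed

section \<open>Polynomial and rational functions on the plane\<close>

definition evp :: "'a::real_normed_field poly poly \<Rightarrow> real^2 \<Rightarrow> 'a" where
  "evp P p = eval2 P (of_real (p$1)) (of_real (p$2))"

lemma evp_hom [simp]:
  "evp 0 p = 0" "evp 1 p = 1" "evp (P + Q) p = evp P p + evp Q p"
  "evp (P - Q) p = evp P p - evp Q p" "evp (- P) p = - evp P p"
  "evp (P * Q) p = evp P p * evp Q p" "evp (P ^ n) p = evp P p ^ n"
  "evp (pCons c P) p = poly c (of_real (p$1)) + of_real (p$2) * evp P p"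
  "evp (Polynomial.smult c P) p = poly c (of_real (p$1)) * evp P p"
  by (simp_all add: evp_def)

lemma evp_real: "evp P p = eval2 P (p$1) (p$2)"
  by (simp add: evp_def)

definition dX :: "'a::real_normed_field poly poly \<Rightarrow> 'a poly poly" where "dX P = map_poly pderiv P"

lemma dX_0 [simp]: "dX 0 = 0"
  by (simp add: dX_def)

lemma dX_pCons [simp]: "dX (pCons c P) = pCons (pderiv c) (dX P)"
  by (simp add: dX_def map_poly_pCons)

lemma evp_has_derivative:
  fixes P :: "'a::real_normed_field poly poly"
  shows "(evp P has_derivative (\<lambda>v. of_real (v$1) * evp (dX P) p + of_real (v$2) * evp (pderiv P) p)) (at p)"
proof (induction P)
  case 0
  have "evp (0 :: 'a poly poly) = (\<lambda>_. 0)" by (simp add: fun_eq_iff)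
  thus ?case by simp
next
  case (pCons c P)
  have 1: "((\<lambda>p::real^2. of_real (p$k) :: 'a) has_derivative (\<lambda>v. of_real (v$k))) (at p)" for k
    by (rule bounded_linear_imp_has_derivative, rule bounded_linear_compose[OF bounded_linear_of_real bounded_linear_vec_nth])
  have 2: "((\<lambda>p::real^2. poly c (of_real (p$1))) has_derivative
      (\<lambda>v. of_real (v$1) * poly (pderiv c) (of_real (p$1)))) (at p)"
    using has_derivative_compose[OF 1[of 1] has_field_derivative_imp_has_derivative[OF poly_DERIV[of c "of_real (p$1)"]]]
    by (simp add: mult.commute)
  have 3: "((\<lambda>p. of_real (p$2) * evp P p) has_derivative (\<lambda>v. of_real (p$2) *
      (of_real (v$1) * evp (dX P) p + of_real (v$2) * evp (pderiv P) p) + of_real (v$2) * evp P p)) (at p)"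
    by (rule has_derivative_mult[OF 1[of 2] pCons(2)])
  have "evp (pCons c P) = (\<lambda>p. poly c (of_real (p$1)) + of_real (p$2) * evp P p)" by (simp add: fun_eq_iff)
  moreover have "(\<lambda>v::real^2. of_real (v$1) * poly (pderiv c) (of_real (p$1)) + (of_real (p$2) *
      (of_real (v$1) * evp (dX P) p + of_real (v$2) * evp (pderiv P) p) + of_real (v$2) * evp P p))
    = (\<lambda>v. of_real (v$1) * evp (dX (pCons c P)) p + of_real (v$2) * evp (pderiv (pCons c P)) p)"
    by (simp add: fun_eq_iff pderiv_pCons algebra_simps)
  ultimately show ?case using has_derivative_add[OF 2 3] by simp
qed

lemma continuous_on_evp: "continuous_on S (evp P)"
  by (rule continuous_at_imp_continuous_on, rule ballI) (rule has_derivative_continuous[OF evp_has_derivative])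

text \<open>The partial derivatives of \<open>A / B\<close> with respect to \<open>x\<close> and \<open>y\<close>.\<close>

definition qX :: "'a::real_normed_field poly poly \<Rightarrow> 'a poly poly \<Rightarrow> real^2 \<Rightarrow> 'a" where
  "qX A B p = (evp (dX A) p * evp B p - evp A p * evp (dX B) p) / (evp B p)\<^sup>2"

definition qY :: "'a::real_normed_field poly poly \<Rightarrow> 'a poly poly \<Rightarrow> real^2 \<Rightarrow> 'a" where
  "qY A B p = (evp (pderiv A) p * evp B p - evp A p * evp (pderiv B) p) / (evp B p)\<^sup>2"

lemma quotient_has_derivative:
  assumes "evp B p \<noteq> 0"
  shows "((\<lambda>p. evp A p / evp B p) has_derivative (\<lambda>v. of_real (v$1) * qX A B p + of_real (v$2) * qY A B p)) (at p)"
proof -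
  have "(\<lambda>v::real^2. - evp A p * (inverse (evp B p) * (of_real (v$1) * evp (dX B) p + of_real (v$2) * evp (pderiv B) p) * inverse (evp B p))
      + (of_real (v$1) * evp (dX A) p + of_real (v$2) * evp (pderiv A) p) / evp B p)
    = (\<lambda>v. of_real (v$1) * qX A B p + of_real (v$2) * qY A B p)"
    using assms by (simp add: fun_eq_iff qX_def qY_def field_simps power2_eq_square)
  thus ?thesis
    using has_derivative_divide[OF evp_has_derivative evp_has_derivative assms, of A] by simp
qed

lemma borel_measurable_evp [measurable]: "(evp P :: real^2 \<Rightarrow> real) \<in> borel_measurable borel"
  by (rule borel_measurable_continuous_onI[OF continuous_on_evp])

lemma borel_measurable_qX [measurable]: "(qX A B :: real^2 \<Rightarrow> real) \<in> borel_measurable borel"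
  and borel_measurable_qY [measurable]: "(qY A B :: real^2 \<Rightarrow> real) \<in> borel_measurable borel"
  unfolding qX_def qY_def by measurable

lemma continuous_on_qX: "(\<And>p. p \<in> S \<Longrightarrow> evp B p \<noteq> 0) \<Longrightarrow> continuous_on S (qX A B)"
  and continuous_on_qY: "(\<And>p. p \<in> S \<Longrightarrow> evp B p \<noteq> 0) \<Longrightarrow> continuous_on S (qY A B)"
  unfolding qX_def qY_def by (auto intro!: continuous_intros continuous_on_evp)

lemma eval2_eq_poly: "eval2 P x y = poly (map_poly (\<lambda>c. poly c x) P) y"
  by (induction P) (simp_all add: map_poly_pCons)

lemma null_zero_set:
  fixes P :: "'a::real_normed_field poly poly"
  assumes "P \<noteq> 0"
  shows "{p. evp P p = 0} \<in> null_sets lborel"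
proof (rule null_sets_vertical_slices)
  have "closed {p. evp P p = 0}"
    by (intro closed_Collect_eq continuous_on_evp) simp
  thus "{p. evp P p = 0} \<in> sets borel" by simp
  define k where "k = degree P"
  define N where "N = {x::real. poly (poly.coeff P k) (of_real x) = 0}"
  have fin: "finite {x::real. poly q (of_real x) = 0}" if "q \<noteq> 0" for q :: "'a poly"
  proof (rule finite_imageD)
    show "finite ((of_real :: real \<Rightarrow> 'a) ` {x. poly q (of_real x) = 0})"
      by (rule finite_subset[OF _ poly_roots_finite[OF that]]) auto
    show "inj_on (of_real :: real \<Rightarrow> 'a) {x. poly q (of_real x) = 0}" by (simp add: inj_on_def)
  qed
  have "poly.coeff P k \<noteq> 0" using assms unfolding k_def by simp
  thus "countable N" unfolding N_def using fin by (intro countable_finite) auto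
  fix x assume x: "x \<notin> N"
  define q where "q = map_poly (\<lambda>c. poly c (of_real x)) P"
  have "poly.coeff q k \<noteq> 0" using x unfolding N_def q_def by (simp add: coeff_map_poly)
  hence "q \<noteq> 0" by auto
  moreover have "{y. vector [x, y] \<in> {p. evp P p = 0}} = {y. poly q (of_real y) = 0}"
    unfolding evp_def q_def eval2_eq_poly by simp
  ultimately show "countable {y. vector [x, y] \<in> {p. evp P p = 0}}" using fin by (intro countable_finite) auto
qed

lemma negligible_zero_set: "P \<noteq> 0 \<Longrightarrow> negligible {p. evp P p = 0}"
  by (rule null_sets_lborel_negligible[OF null_zero_set])

lemma evp_identity:
  assumes "\<not> negligible S" "\<And>p. p \<in> S \<Longrightarrow> evp P p = 0"
  shows "P = 0"
  using assms negligible_zero_set[of P] negligible_subset[of "{p. evp P p = 0}" S] by blast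

lemma rf_domain_evp: "p \<in> rf_domain r \<longleftrightarrow> evp (rf_denom r) p \<noteq> 0"
  by (simp add: rf_domain_def evp_real)

lemma rf_eval_evp: "rf_eval r p = evp (rf_numer r) p / evp (rf_denom r) p"
  by (simp add: rf_eval_def evp_real)

lemma open_rf_domain: "open (rf_domain r)"
proof -
  have "rf_domain r = {p. evp (rf_denom r) p \<noteq> 0}" using rf_domain_evp by blast
  thus ?thesis by (simp add: open_Collect_neq continuous_on_evp)
qed

abbreviation rX where "rX r \<equiv> qX (rf_numer r) (rf_denom r)"
abbreviation rY where "rY r \<equiv> qY (rf_numer r) (rf_denom r)"

lemma rf_eval_has_derivative:
  assumes "p \<in> rf_domain r"
  shows "(rf_eval r has_derivative (\<lambda>v. v$1 * rX r p + v$2 * rY r p)) (at p)"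
  using quotient_has_derivative[of "rf_denom r" p "rf_numer r"] assms
  unfolding rf_domain_evp rf_eval_evp[abs_def] by simp

lemma borel_measurable_rf_eval [measurable]: "rf_eval r \<in> borel_measurable borel"
  unfolding rf_eval_evp[abs_def] by measurable

lemma vector2_eq: "vector [a, b] = a *\<^sub>R axis 1 1 + b *\<^sub>R (axis 2 1 :: real^2)"
  by (simp add: vec_eq_iff forall_2 axis_def)

definition rm_deriv :: "ratmap \<Rightarrow> real^2 \<Rightarrow> real^2 \<Rightarrow> real^2" where
  "rm_deriv F p v = vector [v$1 * rX (fst F) p + v$2 * rY (fst F) p, v$1 * rX (snd F) p + v$2 * rY (snd F) p]"

definition rm_jac :: "ratmap \<Rightarrow> real^2 \<Rightarrow> real" where
  "rm_jac F p = rX (fst F) p * rY (snd F) p - rY (fst F) p * rX (snd F) p"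

lemma rm_eval_has_derivative:
  assumes "p \<in> rm_domain F"
  shows "(rm_eval F has_derivative rm_deriv F p) (at p)"
proof -
  have "rm_eval F = (\<lambda>p. rf_eval (fst F) p *\<^sub>R axis 1 1 + rf_eval (snd F) p *\<^sub>R axis 2 1)"
    by (simp add: fun_eq_iff rm_eval_def vector2_eq)
  moreover have "rm_deriv F p = (\<lambda>v. (v$1 * rX (fst F) p + v$2 * rY (fst F) p) *\<^sub>R axis 1 1
      + (v$1 * rX (snd F) p + v$2 * rY (snd F) p) *\<^sub>R axis 2 1)"
    by (simp add: fun_eq_iff rm_deriv_def vector2_eq)
  ultimately show ?thesis using assms unfolding rm_domain_def
    by (auto intro!: has_derivative_add has_derivative_scaleR_left rf_eval_has_derivative)
qed

lemma rm_jac_det: "det (matrix (rm_deriv F p)) = rm_jac F p"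
  by (simp add: det_2 matrix_def rm_deriv_def rm_jac_def axis_def)

lemma borel_measurable_vector2:
  assumes "a \<in> borel_measurable borel" "b \<in> borel_measurable borel"
  shows "(\<lambda>p. vector [a p, b p] :: real^2) \<in> borel_measurable borel"
  unfolding vector2_eq using assms by measurable

lemma borel_measurable_rm_eval [measurable]: "rm_eval F \<in> borel_measurable borel"
  unfolding rm_eval_def[abs_def] by (rule borel_measurable_vector2) measurable

lemma borel_measurable_rm_jac [measurable]: "rm_jac F \<in> borel_measurable borel"
  unfolding rm_jac_def[abs_def] by measurable

section \<open>A conull set on which a birational map is bijective\<close>

text \<open>Remove from \<open>U\<close> all points whose orbit under \<open>F\<close> and \<open>G\<close> leaves \<open>U0\<close>. At each of the countably many
  steps the preimage of a null set is its image under the differentiable inverse, hence null.\<close>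

lemma exists_invariant_conull_set:
  fixes F G :: "real^2 \<Rightarrow> real^2"
  assumes U: "U \<in> sets borel" and U0: "U0 \<in> sets borel" "U0 \<subseteq> U" "negligible (U - U0)"
    and meas [measurable]: "F \<in> borel_measurable borel" "G \<in> borel_measurable borel"
    and FU: "\<And>p. p \<in> U0 \<Longrightarrow> F p \<in> U" and GU: "\<And>p. p \<in> U0 \<Longrightarrow> G p \<in> U"
    and GF: "\<And>p. p \<in> U0 \<Longrightarrow> G (F p) = p" and FG: "\<And>p. p \<in> U0 \<Longrightarrow> F (G p) = p"
    and dG: "\<And>p. p \<in> U0 \<Longrightarrow> G differentiable (at (F p))" and dF: "\<And>p. p \<in> U0 \<Longrightarrow> F differentiable (at (G p))"
  obtains X where "X \<in> sets borel" "X \<subseteq> U0" "negligible (U - X)"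
    "\<And>p. p \<in> X \<Longrightarrow> F p \<in> X" "\<And>p. p \<in> X \<Longrightarrow> G p \<in> X"
proof -
  define N where "N = rec_nat (U - U0) (\<lambda>_ A. A \<union> {p \<in> U0. F p \<in> A} \<union> {p \<in> U0. G p \<in> A})"
  have N0: "N 0 = U - U0"
    and NS: "N (Suc k) = N k \<union> {p \<in> U0. F p \<in> N k} \<union> {p \<in> U0. G p \<in> N k}" for k
    by (simp_all add: N_def)
  have Nb: "N k \<in> sets borel" for k
  proof (induction k)
    case (Suc k)
    note Suc[measurable] U0(1)[measurable]
    have "{p \<in> U0. F p \<in> N k} \<in> sets borel" "{p \<in> U0. G p \<in> N k} \<in> sets borel" by measurable
    thus ?case unfolding NS using Suc by auto
  qed (use U U0 in \<open>auto simp: N0\<close>)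
  have pull: "negligible {p \<in> U0. \<phi> p \<in> A}"
    if A: "negligible A" and inv: "\<And>p. p \<in> U0 \<Longrightarrow> \<psi> (\<phi> p) = p"
      and d: "\<And>p. p \<in> U0 \<Longrightarrow> \<psi> differentiable (at (\<phi> p))" for A and \<phi> \<psi> :: "real^2 \<Rightarrow> real^2"
  proof (rule negligible_subset)
    show "negligible (\<psi> ` (A \<inter> \<phi> ` U0))"
    proof (rule negligible_differentiable_image_negligible)
      show "negligible (A \<inter> \<phi> ` U0)" by (rule negligible_subset[OF A]) blast
      show "\<psi> differentiable_on A \<inter> \<phi> ` U0"
        unfolding differentiable_on_def using d differentiable_at_withinI by blast
    qed simp
    show "{p \<in> U0. \<phi> p \<in> A} \<subseteq> \<psi> ` (A \<inter> \<phi> ` U0)"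
    proof
      fix p assume "p \<in> {p \<in> U0. \<phi> p \<in> A}"
      thus "p \<in> \<psi> ` (A \<inter> \<phi> ` U0)" using inv[of p] by (intro image_eqI[of _ _ "\<phi> p"]) auto
    qed
  qed
  have Nn: "negligible (N k)" for k
  proof (induction k)
    case (Suc k)
    thus ?case unfolding NS using pull[OF Suc, of G F] pull[OF Suc, of F G] GF FG dG dF by simp
  qed (use U0 in \<open>simp add: N0\<close>)
  define X where "X = U - (\<Union>k. N k)"
  show ?thesis
  proof
    show "X \<in> sets borel" unfolding X_def using U Nb by auto
    show "X \<subseteq> U0" unfolding X_def using N0 by blast
    have "negligible (\<Union>k. N k)" using Nn by (intro negligible_countable_Union) auto
    thus "negligible (U - X)" by (rule negligible_subset) (auto simp: X_def)
    show "F p \<in> X" if p: "p \<in> X" for p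
    proof -
      have "p \<in> U0" using p N0 unfolding X_def by blast
      moreover have "F p \<notin> N k" for k using p NS[of k] \<open>p \<in> U0\<close> unfolding X_def by blast
      ultimately show ?thesis unfolding X_def using FU by blast
    qed
    show "G p \<in> X" if p: "p \<in> X" for p
    proof -
      have "p \<in> U0" using p N0 unfolding X_def by blast
      moreover have "G p \<notin> N k" for k using p NS[of k] \<open>p \<in> U0\<close> unfolding X_def by blast
      ultimately show ?thesis unfolding X_def using GU by blast
    qed
  qed
qed

text \<open>The polynomials \<open>Q1\<close> and \<open>Q2\<close> cut out the points where \<open>G\<close> and \<open>F\<close> fail to be mutually inverse. The
  \<open>j\<close>-th coordinate is the one used as a parameter on the level curves. Off the zeros of \<open>W\<close> its derivative
  along the curve does not vanish.\<close>

locale birational_integral =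
  fixes F G :: ratmap and V :: ratfun and H :: "real set" and U :: "(real^2) set"
    and Q1 Q2 W :: "real poly poly" and j :: 2
  assumes Q1: "Q1 \<noteq> 0" "\<And>p. evp Q1 p \<noteq> 0 \<Longrightarrow>
      p \<in> rm_domain G \<and> rm_eval G p \<in> rm_domain F \<and> rm_eval F (rm_eval G p) = p"
    and Q2: "Q2 \<noteq> 0" "\<And>p. evp Q2 p \<noteq> 0 \<Longrightarrow>
      p \<in> rm_domain F \<and> rm_eval F p \<in> rm_domain G \<and> rm_eval G (rm_eval F p) = p"
    and V: "first_integral F V"
    and U: "open U" "U = {p. rf_eval V p \<in> H} \<inter> good_set F"
    and W: "W \<noteq> 0" "\<And>p. p \<in> rf_domain V \<Longrightarrow> evp W p \<noteq> 0 \<Longrightarrow> vector [rY V p, - rX V p] $ j \<noteq> (0::real)"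
begin

text \<open>The Hamiltonian vector field of \<open>V\<close>, tangent to the level curves, and the derivative of the
  \<open>j\<close>-th coordinate along it.\<close>

definition tan :: "real^2 \<Rightarrow> real^2" where "tan p = vector [rY V p, - rX V p]"

definition dens :: "real^2 \<Rightarrow> real" where "dens p = \<bar>tan p $ j\<bar> / (1 + (p$j)\<^sup>2)"

lemma U_domain: "p \<in> U \<Longrightarrow> p \<in> rm_domain F" "p \<in> U \<Longrightarrow> p \<in> rf_domain V"
proof -
  assume p: "p \<in> U"
  have "(rm_eval F ^^ 0) p \<in> rm_domain F" using p unfolding U(2) good_set_def by blast
  thus "p \<in> rm_domain F" by simp
  show "p \<in> rf_domain V" using p V unfolding U(2) first_integral_def by blast
qed

lemma V_F: "p \<in> U \<Longrightarrow> rf_eval V (rm_eval F p) = rf_eval V p"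
  using V unfolding U(2) first_integral_def by blast

lemma U_H: "p \<in> U \<Longrightarrow> rf_eval V p \<in> H"
  unfolding U(2) by blast

lemma F_U: assumes "p \<in> U" shows "rm_eval F p \<in> U"
proof -
  have "(rm_eval F ^^ n) (rm_eval F p) \<in> rm_domain F" for n
  proof -
    have "(rm_eval F ^^ Suc n) p \<in> rm_domain F" using assms unfolding U(2) good_set_def by blast
    thus ?thesis by (simp add: funpow_swap1)
  qed
  hence "rm_eval F p \<in> good_set F" unfolding good_set_def by blast
  moreover have "rf_eval V (rm_eval F p) \<in> H" using V_F[OF assms] U_H[OF assms] by simp
  ultimately show ?thesis unfolding U(2) by blast
qed

lemma G_U: assumes p: "p \<in> U" "evp Q1 p \<noteq> 0" shows "rm_eval G p \<in> U" "rf_eval V (rm_eval G p) = rf_eval V p"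
proof -
  define q where "q = rm_eval G p"
  have q: "q \<in> rm_domain F" "rm_eval F q = p" using Q1(2)[OF p(2)] unfolding q_def by auto
  have "(rm_eval F ^^ n) q \<in> rm_domain F" for n
  proof (cases n)
    case (Suc k)
    have "(rm_eval F ^^ k) p \<in> rm_domain F" using p(1) unfolding U(2) good_set_def by blast
    thus ?thesis unfolding Suc by (simp add: funpow_swap1 q(2))
  qed (use q in simp)
  hence g: "q \<in> good_set F" unfolding good_set_def by blast
  hence Vq: "rf_eval V q = rf_eval V p" using V q(2) unfolding first_integral_def by metis
  show "rm_eval G p \<in> U" "rf_eval V (rm_eval G p) = rf_eval V p"
    using g Vq U_H[OF p(1)] unfolding q_def[symmetric] U(2) by auto
qed

definition U0 where "U0 = {p \<in> U. evp (Q1 * Q2 * W) p \<noteq> 0}"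

lemma U0D: assumes "p \<in> U0"
  shows "p \<in> U" "evp Q1 p \<noteq> 0" "evp Q2 p \<noteq> 0" "evp W p \<noteq> 0"
  using assms unfolding U0_def by auto

definition X where "X = (SOME X. X \<in> sets borel \<and> X \<subseteq> U0 \<and> negligible (U - X) \<and>
    (\<forall>p\<in>X. rm_eval F p \<in> X) \<and> (\<forall>p\<in>X. rm_eval G p \<in> X))"

lemma X: "X \<in> sets borel" "X \<subseteq> U0" "negligible (U - X)"
  "p \<in> X \<Longrightarrow> rm_eval F p \<in> X" "p \<in> X \<Longrightarrow> rm_eval G p \<in> X"
proof -
  have Ub: "U \<in> sets borel" using U(1) by simp
  have "U0 = U \<inter> {p. evp (Q1 * Q2 * W) p \<noteq> 0}" unfolding U0_def by blast
  moreover have "{p. evp (Q1 * Q2 * W) p \<noteq> (0::real)} \<in> sets borel"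
    using borel_measurable_evp[of "Q1 * Q2 * W"] by measurable
  ultimately have U0b: "U0 \<in> sets borel" using Ub by auto
  have "negligible {p. evp (Q1 * Q2 * W) p = (0::real)}" using Q1 Q2 W by (intro negligible_zero_set) simp
  hence neg: "negligible (U - U0)" by (rule negligible_subset) (auto simp: U0_def)
  have dif: "rm_eval A differentiable (at p)" if "p \<in> rm_domain A" for A p
    using rm_eval_has_derivative[OF that] unfolding differentiable_def by blast
  obtain X' where X': "X' \<in> sets borel" "X' \<subseteq> U0" "negligible (U - X')"
    "\<And>p. p \<in> X' \<Longrightarrow> rm_eval F p \<in> X'" "\<And>p. p \<in> X' \<Longrightarrow> rm_eval G p \<in> X'"
  proof (rule exists_invariant_conull_set[OF Ub U0b _ neg borel_measurable_rm_eval[of F] borel_measurable_rm_eval[of G]])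
    show "U0 \<subseteq> U" unfolding U0_def by blast
    fix p assume "p \<in> U0"
    note p = U0D[OF this]
    show "rm_eval F p \<in> U" "rm_eval G p \<in> U" using F_U G_U p by auto
    show "rm_eval G (rm_eval F p) = p" "rm_eval F (rm_eval G p) = p" using Q1(2) Q2(2) p by auto
    show "rm_eval G differentiable at (rm_eval F p)" "rm_eval F differentiable at (rm_eval G p)"
      using Q1(2) Q2(2) p by (auto intro: dif)
  qed blast
  have "X \<in> sets borel \<and> X \<subseteq> U0 \<and> negligible (U - X) \<and>
    (\<forall>p\<in>X. rm_eval F p \<in> X) \<and> (\<forall>p\<in>X. rm_eval G p \<in> X)"
    unfolding X_def by (rule someI[of _ X']) (use X' in blast)
  thus "X \<in> sets borel" "X \<subseteq> U0" "negligible (U - X)"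
    "p \<in> X \<Longrightarrow> rm_eval F p \<in> X" "p \<in> X \<Longrightarrow> rm_eval G p \<in> X" by auto
qed

lemma X_U: "p \<in> X \<Longrightarrow> p \<in> U" and X_U0: "p \<in> X \<Longrightarrow> p \<in> U0"
  using X(2) U0D by blast+

lemma GF: "p \<in> X \<Longrightarrow> rm_eval G (rm_eval F p) = p" and FG: "p \<in> X \<Longrightarrow> rm_eval F (rm_eval G p) = p"
  using Q1(2) Q2(2) U0D X_U0 by blast+

lemma G_domain: "p \<in> X \<Longrightarrow> p \<in> rm_domain G"
  using Q1(2) U0D X_U0 by blast

lemma jac_inverse:
  assumes p: "p \<in> X"
  shows "rm_jac G (rm_eval F p) * rm_jac F p = 1"
proof -
  have d: "((\<lambda>p. rm_eval G (rm_eval F p)) has_derivative (\<lambda>v. rm_deriv G (rm_eval F p) (rm_deriv F p v))) (at p)"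
    using has_derivative_compose[OF rm_eval_has_derivative[OF U_domain(1)[OF X_U[OF p]]]
      rm_eval_has_derivative[OF G_domain[OF X(4)[OF p]]]] by simp
  have op: "open {p. evp Q2 p \<noteq> (0::real)}" by (simp add: open_Collect_neq continuous_on_evp)
  have "((\<lambda>p. p) has_derivative (\<lambda>v. rm_deriv G (rm_eval F p) (rm_deriv F p v))) (at p)"
    by (rule has_derivative_transform_within_open[OF d op]) (use U0D(3)[OF X_U0[OF p]] Q2(2) in auto)
  hence "(\<lambda>v. rm_deriv G (rm_eval F p) (rm_deriv F p v)) = (\<lambda>v. v)"
    using has_derivative_unique[OF _ has_derivative_ident] by blast
  hence e: "rm_deriv G (rm_eval F p) \<circ> rm_deriv F p = id" by (simp add: fun_eq_iff)
  have lin: "linear (rm_deriv A q)" if "q \<in> rm_domain A" for A q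
    using rm_eval_has_derivative[OF that] has_derivative_bounded_linear bounded_linear.linear by blast
  have m: "matrix (rm_deriv G (rm_eval F p) \<circ> rm_deriv F p)
      = matrix (rm_deriv G (rm_eval F p)) ** matrix (rm_deriv F p)"
    by (rule matrix_compose[OF lin lin]) (use U_domain X_U p G_domain X in auto)
  have "det (matrix (rm_deriv G (rm_eval F p)) ** matrix (rm_deriv F p)) = 1"
    unfolding m[symmetric] e by (simp add: matrix_id_mat_1)
  thus ?thesis by (simp add: det_mul rm_jac_det)
qed

text \<open>Invariance of \<open>V\<close> makes the differential of \<open>F\<close> transport the Hamiltonian vector field,
  multiplied by the Jacobian determinant.\<close>

lemma tan_transport:
  assumes p: "p \<in> U"
  shows "rm_deriv F p (tan p) = rm_jac F p *\<^sub>R tan (rm_eval F p)"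
proof -
  define q where "q = rm_eval F p"
  have d: "((\<lambda>p. rf_eval V (rm_eval F p)) has_derivative
      (\<lambda>v. rm_deriv F p v $ 1 * rX V q + rm_deriv F p v $ 2 * rY V q)) (at p)"
    unfolding q_def using has_derivative_compose[OF rm_eval_has_derivative[OF U_domain(1)[OF p]]
      rf_eval_has_derivative[OF U_domain(2)[OF F_U[OF p]]]] by simp
  have "(rf_eval V has_derivative (\<lambda>v. rm_deriv F p v $ 1 * rX V q + rm_deriv F p v $ 2 * rY V q)) (at p)"
    by (rule has_derivative_transform_within_open[OF d U(1) p]) (use V_F in auto)
  hence e: "(\<lambda>v. rm_deriv F p v $ 1 * rX V q + rm_deriv F p v $ 2 * rY V q) = (\<lambda>v. v$1 * rX V p + v$2 * rY V p)"
    using has_derivative_unique[OF _ rf_eval_has_derivative[OF U_domain(2)[OF p]]] by blast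
  have 1: "rX (fst F) p * rX V q + rX (snd F) p * rY V q = rX V p"
    using fun_cong[OF e, of "vector [1, 0]"] by (simp add: rm_deriv_def)
  have 2: "rY (fst F) p * rX V q + rY (snd F) p * rY V q = rY V p"
    using fun_cong[OF e, of "vector [0, 1]"] by (simp add: rm_deriv_def)
  show ?thesis unfolding q_def[symmetric]
    by (simp add: vec_eq_iff forall_2 rm_deriv_def tan_def rm_jac_def flip: 1 2) (simp add: algebra_simps)
qed

sublocale PD: plane_dynamics "rm_eval F" "rm_eval G" "rm_deriv F" "rm_jac F" "rm_jac G" dens U X
proof
  have "X \<subseteq> U" using X_U by blast
  thus "X \<subseteq> U" .
  show "dens \<in> borel_measurable borel"
  proof -
    have [measurable]: "(\<lambda>p. tan p $ j) \<in> borel_measurable borel"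
      using exhaust_2[of j] by (auto simp: tan_def)
    have "(\<lambda>p. p $ j) \<in> borel_measurable (borel :: (real^2) measure)"
      by (intro borel_measurable_continuous_onI continuous_intros)
    thus ?thesis unfolding dens_def[abs_def] by measurable
  qed
  fix p assume p: "p \<in> X"
  show "(rm_eval F has_derivative rm_deriv F p) (at p)"
    by (rule rm_eval_has_derivative[OF U_domain(1)[OF X_U[OF p]]])
  show "rm_eval G differentiable at p"
    using rm_eval_has_derivative[OF G_domain[OF p]] unfolding differentiable_def by blast
  show "\<bar>rm_jac G (rm_eval F p)\<bar> * \<bar>rm_jac F p\<bar> = 1"
    using jac_inverse[OF p] by (metis abs_mult abs_one)
  have "tan p $ j \<noteq> 0" unfolding tan_def
    by (rule W(2)[OF U_domain(2)[OF X_U[OF p]] U0D(4)[OF X_U0[OF p]]])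
  thus "0 < dens p" unfolding dens_def by (simp add: divide_pos_pos add_pos_nonneg)
qed (use U X F_U GF FG in \<open>auto simp: rm_jac_det\<close>)

lemma V_FX: "p \<in> X \<Longrightarrow> rf_eval V (rm_eval F p) = rf_eval V p"
  and V_GX: "p \<in> X \<Longrightarrow> rf_eval V (rm_eval G p) = rf_eval V p"
  using V_F X_U G_U(2) U0D(2) X_U0 by blast+

lemma V_orbit: "p \<in> X \<Longrightarrow> rf_eval V ((rm_eval F ^^ n) p) = rf_eval V p"
   "p \<in> X \<Longrightarrow> rf_eval V ((rm_eval G ^^ n) p) = rf_eval V p"
  by (induction n) (simp_all add: V_FX V_GX PD.funpow_FX PD.funpow_GX)

text \<open>At a point of infinite supremum the orbit has to meet the exceptional set \<open>Z\<close> of its level curve.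
  There are countably many such points on each curve.\<close>

theorem preserves_if_fibres:
  assumes fib: "\<And>p0. p0 \<in> X \<Longrightarrow> \<exists>Z \<kappa> C. countable Z \<and>
    (\<forall>p\<in>X - Z. rf_eval V p = rf_eval V p0 \<longrightarrow> dens p \<le> C * \<kappa> p \<and>
      (rm_eval F p \<notin> Z \<longrightarrow> \<bar>rm_jac F p\<bar> * \<kappa> (rm_eval F p) = \<kappa> p))"
  shows "preserves_ac_measure_on (rm_eval F) U"
proof (rule PD.finite_osup_preserves_ac_measure)
  define E where "E = {p \<in> X. PD.osup p = \<infinity>}"
  define g where "g = (\<lambda>p. vector [rf_eval V p, p $ j] :: real^2)"
  define g' where "g' = (\<lambda>p v. vector [v$1 * rX V p + v$2 * rY V p, v $ j] :: real^2)"
  define D where "D = (\<lambda>p. det (matrix (g' p)))"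
  have D: "D p = - (vector [rY V p, - rX V p] $ j)" for p
    using exhaust_2[of j] by (auto simp: D_def det_2 matrix_def g'_def axis_def)
  have "negligible E"
  proof (rule negligible_countable_fibres[of E "rf_domain V" g g' D])
    show "E \<in> sets borel" unfolding E_def using X(1) PD.osup_measurable by measurable
    show "open (rf_domain V)" by (rule open_rf_domain)
    show "E \<subseteq> rf_domain V" unfolding E_def using U_domain X_U by blast
    show "(g has_derivative g' p) (at p)" if "p \<in> rf_domain V" for p
    proof -
      have "g = (\<lambda>p. rf_eval V p *\<^sub>R axis 1 1 + (p$j) *\<^sub>R axis 2 1)" by (simp add: g_def fun_eq_iff vector2_eq)
      moreover have "g' p = (\<lambda>v. (v$1 * rX V p + v$2 * rY V p) *\<^sub>R axis 1 1 + (v$j) *\<^sub>R axis 2 1)"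
        by (simp add: g'_def fun_eq_iff vector2_eq)
      moreover have "((\<lambda>p::real^2. p$j) has_derivative (\<lambda>v. v$j)) (at p)"
        by (rule bounded_linear_imp_has_derivative[OF bounded_linear_vec_nth])
      ultimately show ?thesis
        by (auto intro!: has_derivative_add has_derivative_scaleR_left rf_eval_has_derivative that)
    qed
    show "continuous_on (rf_domain V) (\<lambda>p. g' p v)" for v
      unfolding g'_def vector2_eq
      by (intro continuous_intros continuous_on_qX continuous_on_qY) (simp_all add: rf_domain_evp)
    show "det (matrix (g' p)) = D p" for p by (simp add: D_def)
    show "D \<in> borel_measurable borel"
      unfolding D[abs_def] using exhaust_2[of j] by auto
    show "D p \<noteq> 0" if "p \<in> E" for p
    proof -
      have "p \<in> X" using that unfolding E_def by blast
      thus ?thesis unfolding D using W(2)[OF U_domain(2)[OF X_U] U0D(4)[OF X_U0]] by simp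
    qed
    fix h
    show "countable {p \<in> E. g p $ 1 = h}"
    proof (cases "\<exists>p0\<in>X. rf_eval V p0 = h")
      case False
      hence "{p \<in> E. g p $ 1 = h} = {}" unfolding E_def g_def by auto
      thus ?thesis by (simp only: countable_empty)
    next
      case True
      then obtain p0 where p0: "p0 \<in> X" "rf_eval V p0 = h" by blast
      then obtain Z \<kappa> C where Z: "countable Z"
        and \<kappa>: "\<And>p. p \<in> X \<Longrightarrow> p \<notin> Z \<Longrightarrow> rf_eval V p = h \<Longrightarrow> dens p \<le> C * \<kappa> p"
          "\<And>p. p \<in> X \<Longrightarrow> p \<notin> Z \<Longrightarrow> rf_eval V p = h \<Longrightarrow> rm_eval F p \<notin> Z \<Longrightarrow>
            \<bar>rm_jac F p\<bar> * \<kappa> (rm_eval F p) = \<kappa> p"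
        using fib[OF p0(1)] by (metis DiffI)
      define Ob where "Ob = {p \<in> X. rf_eval V p = h \<and> p \<notin> Z}"
      have "{p \<in> E. g p $ 1 = h} \<subseteq> {p \<in> X. \<exists>n. (rm_eval F ^^ n) p \<in> Z \<or> (rm_eval G ^^ n) p \<in> Z}"
      proof (rule subsetI, rule ccontr)
        fix p assume p: "p \<in> {p \<in> E. g p $ 1 = h}"
          and no: "p \<notin> {p \<in> X. \<exists>n. (rm_eval F ^^ n) p \<in> Z \<or> (rm_eval G ^^ n) p \<in> Z}"
        have pX: "p \<in> X" "rf_eval V p = h" and inf: "PD.osup p = \<infinity>"
          using p unfolding E_def g_def by auto
        have "PD.osup p \<noteq> \<infinity>"
        proof (rule PD.osup_finite[OF pX(1), of Ob C \<kappa>])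
          show "(rm_eval F ^^ n) p \<in> Ob" "(rm_eval G ^^ n) p \<in> Ob" for n
            using no pX V_orbit[OF pX(1)] PD.funpow_FX[OF pX(1)] PD.funpow_GX[OF pX(1)] unfolding Ob_def by auto
        qed (use \<kappa> in \<open>auto simp: Ob_def\<close>)
        thus False using inf by simp
      qed
      thus ?thesis using PD.countable_orbits[OF Z] by (rule countable_subset)
    qed
  qed
  thus "negligible {p \<in> X. PD.osup p = \<infinity>}" unfolding E_def .
qed

end

section \<open>Values of rational functions at real points\<close>

text \<open>The relation holds if some representation of \<open>r\<close> as a fraction is defined at \<open>p\<close>. It is single
  valued and compatible with the field operations.\<close>

definition val :: "complex poly poly fract \<Rightarrow> real^2 \<Rightarrow> complex \<Rightarrow> bool" where
  "val r p z \<longleftrightarrow> (\<exists>a b. r = Fract a b \<and> evp b p \<noteq> 0 \<and> z = evp a p / evp b p)"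

lemma valE:
  assumes "val r p z"
  obtains a b where "r = Fract a b" "b \<noteq> 0" "evp b p \<noteq> 0" "z = evp a p / evp b p"
  using assms unfolding val_def by force

lemma val_Fract: "evp b p \<noteq> 0 \<Longrightarrow> val (Fract a b) p (evp a p / evp b p)"
  unfolding val_def by blast

lemma val_poly: "val (Fract a 1) p (evp a p)"
  using val_Fract[of 1 p a] by simp

lemma val_unique_Fract:
  assumes "val (Fract a b) p z" "b \<noteq> 0"
  shows "z * evp b p = evp a p"
proof -
  obtain c d where cd: "Fract a b = Fract c d" "d \<noteq> 0" "evp d p \<noteq> 0" "z = evp c p / evp d p"
    using assms(1) by (rule valE)
  have "a * d = c * b" using cd assms(2) by (simp add: eq_fract)
  hence e: "evp (a * d) p = evp (c * b) p" by simp
  have "z * evp d p = evp c p" using cd by simp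
  hence "(z * evp b p) * evp d p = evp a p * evp d p" using e by (simp add: mult_ac)
  thus ?thesis using cd(3) by simp
qed

lemma val_unique: assumes "val r p z" "val r p w" shows "z = w"
proof -
  obtain a b where ab: "r = Fract a b" "b \<noteq> 0" "evp b p \<noteq> 0" "z = evp a p / evp b p"
    using assms(1) by (rule valE)
  have "w * evp b p = evp a p" using val_unique_Fract assms(2) ab by blast
  hence "w = evp a p / evp b p" using ab(3) by (simp add: eq_divide_eq)
  thus ?thesis using ab(4) by simp
qed

lemma val_add: assumes "val r p z" "val s p w" shows "val (r + s) p (z + w)"
proof -
  obtain a b where ab: "r = Fract a b" "b \<noteq> 0" "evp b p \<noteq> 0" "z = evp a p / evp b p"
    using assms(1) by (rule valE)
  obtain c d where cd: "s = Fract c d" "d \<noteq> 0" "evp d p \<noteq> 0" "w = evp c p / evp d p"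
    using assms(2) by (rule valE)
  have "r + s = Fract (a * d + c * b) (b * d)" using ab cd by simp
  moreover have "z + w = evp (a * d + c * b) p / evp (b * d) p" using ab cd by (simp add: add_frac_eq)
  ultimately show ?thesis using ab cd val_Fract[of "b * d" p "a * d + c * b"] by simp
qed

lemma val_mult: assumes "val r p z" "val s p w" shows "val (r * s) p (z * w)"
proof -
  obtain a b where ab: "r = Fract a b" "b \<noteq> 0" "evp b p \<noteq> 0" "z = evp a p / evp b p"
    using assms(1) by (rule valE)
  obtain c d where cd: "s = Fract c d" "d \<noteq> 0" "evp d p \<noteq> 0" "w = evp c p / evp d p"
    using assms(2) by (rule valE)
  show ?thesis using ab cd val_Fract[of "b * d" p "a * c"] by simp
qed

lemma val_uminus: assumes "val r p z" shows "val (- r) p (- z)"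
proof -
  obtain a b where ab: "r = Fract a b" "b \<noteq> 0" "evp b p \<noteq> 0" "z = evp a p / evp b p"
    using assms(1) by (rule valE)
  show ?thesis using ab val_Fract[of b p "- a"] by simp
qed

lemma val_diff: "val r p z \<Longrightarrow> val s p w \<Longrightarrow> val (r - s) p (z - w)"
  using val_add[OF _ val_uminus] by fastforce

lemma val_divide: assumes "val r p z" "val s p w" "w \<noteq> 0" shows "val (r / s) p (z / w)"
proof -
  obtain a b where ab: "r = Fract a b" "b \<noteq> 0" "evp b p \<noteq> 0" "z = evp a p / evp b p"
    using assms(1) by (rule valE)
  obtain c d where cd: "s = Fract c d" "d \<noteq> 0" "evp d p \<noteq> 0" "w = evp c p / evp d p"
    using assms(2) by (rule valE)
  have "evp c p \<noteq> 0" using assms(3) cd by auto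
  thus ?thesis using ab cd val_Fract[of "b * c" p "a * d"] by simp
qed

lemma val_eqI:
  assumes S: "\<not> negligible S" and v: "\<And>p. p \<in> S \<Longrightarrow> \<exists>z. val r p z \<and> val s p z"
  shows "r = s"
proof -
  obtain a b where ab: "r = Fract a b" "b \<noteq> 0" by (cases r) auto
  obtain c d where cd: "s = Fract c d" "d \<noteq> 0" by (cases s) auto
  have "evp (a * d - c * b) p = 0" if p: "p \<in> S" for p
  proof -
    obtain z where "val r p z" "val s p z" using v[OF p] by blast
    hence "z * evp b p = evp a p" "z * evp d p = evp c p"
      using val_unique_Fract ab cd by blast+
    thus ?thesis by (simp flip: \<open>z * evp b p = evp a p\<close> \<open>z * evp d p = evp c p\<close>)
  qed
  hence "a * d - c * b = 0" by (rule evp_identity[OF S])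
  thus ?thesis using ab cd by (simp add: eq_fract)
qed

definition cx :: "real poly poly \<Rightarrow> complex poly poly" where
  "cx P = map_poly (map_poly complex_of_real) P"

lemma cx_0 [simp]: "cx 0 = 0"
  by (simp add: cx_def)

lemma cx_pCons [simp]: "cx (pCons c P) = pCons (map_poly complex_of_real c) (cx P)"
  by (simp add: cx_def map_poly_pCons)

lemma poly_map_of_real: "poly (map_poly complex_of_real c) (complex_of_real x) = complex_of_real (poly c x)"
  by (induction c) (simp_all add: map_poly_pCons)

lemma pderiv_map_of_real: "pderiv (map_poly complex_of_real c) = map_poly complex_of_real (pderiv c)"
  by (rule poly_eqI) (simp add: coeff_map_poly coeff_pderiv)

lemma evp_cx [simp]: "evp (cx P) p = complex_of_real (evp P p)"
  by (induction P) (simp_all add: poly_map_of_real)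

lemma evp_dX_cx [simp]: "evp (dX (cx P)) p = complex_of_real (evp (dX P) p)"
  by (induction P) (simp_all add: poly_map_of_real pderiv_map_of_real)

lemma evp_pderiv_cx [simp]: "evp (pderiv (cx P)) p = complex_of_real (evp (pderiv P) p)"
  by (induction P) (simp_all add: pderiv_pCons)

lemma map_of_real_diff: "map_poly complex_of_real (p - q) = map_poly complex_of_real p - map_poly complex_of_real q"
  by (rule poly_eqI) (simp add: coeff_map_poly)

lemma level_curve_eq: "level_curve V h = cx (rf_numer V) - Polynomial.smult [:complex_of_real h:] (cx (rf_denom V))"
proof -
  have m: "map_poly complex_of_real (Polynomial.smult h q) = Polynomial.smult (complex_of_real h) (map_poly complex_of_real q)" for q
    by (rule poly_eqI) (simp add: coeff_map_poly)
  show ?thesis unfolding level_curve_def cx_def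
    by (rule poly_eqI) (simp add: coeff_map_poly map_of_real_diff m)
qed

lemma evp_level_curve: "evp (level_curve V h) p = complex_of_real (evp (rf_numer V) p - h * evp (rf_denom V) p)"
  by (simp add: level_curve_eq)

definition cxr :: "ratfun \<Rightarrow> complex poly poly fract" where
  "cxr r = Fract (cx (rf_numer r)) (cx (rf_denom r))"

lemma val_cxr: "p \<in> rf_domain r \<Longrightarrow> val (cxr r) p (complex_of_real (rf_eval r p))"
  using val_Fract[of "cx (rf_denom r)" p "cx (rf_numer r)"]
  unfolding cxr_def rf_domain_evp rf_eval_evp by simp

section \<open>The automorphism of the function field induced by a birational map\<close>

context prime_curve begin

text \<open>The polynomial \<open>a (A, B)\<close>.\<close>

definition subst :: "complex poly poly fract \<Rightarrow> complex poly poly fract \<Rightarrow> complex poly poly \<Rightarrow> complex poly poly fract" where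
  "subst A B a = poly (map_poly (\<lambda>c. cpoly c A) a) B"

lemma subst_0 [simp]: "subst A B 0 = 0"
  by (simp add: subst_def)

lemma subst_pCons [simp]: "subst A B (pCons c a) = cpoly c A + B * subst A B a"
  by (simp add: subst_def map_poly_pCons)

lemma subst_add [simp]: "subst A B (a + b) = subst A B a + subst A B b"
proof (induction a arbitrary: b)
  case (pCons c a)
  show ?case
  proof (cases b)
    case (pCons d b')
    show ?thesis unfolding pCons add_pCons subst_pCons cpoly_add \<open>\<And>b. subst A B (a + b) = subst A B a + subst A B b\<close>
      by (simp only: distrib_left add_ac)
  qed
qed simp

lemma subst_smult [simp]: "subst A B (Polynomial.smult c a) = cpoly c A * subst A B a"
  by (induction a) (simp_all add: algebra_simps)

lemma subst_mult [simp]: "subst A B (a * b) = subst A B a * subst A B b"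
  by (induction a) (simp_all add: algebra_simps)

lemma subst_diff [simp]: "subst A B (a - b) = subst A B a - subst A B b"
  using subst_add[of A B "a - b" b] by simp

lemma subst_1 [simp]: "subst A B 1 = 1"
  by (simp add: one_pCons)

lemma val_const: "val (const c) p c"
  using val_poly[of "[:[:c:]:]" p] by (simp add: const_def)

lemma val_cpoly: "val A p z \<Longrightarrow> val (cpoly c A) p (poly c z)"
proof (induction c)
  case 0
  show ?case using val_const[of 0 p] by simp
next
  case (pCons a c)
  thus ?case using val_add[OF val_const val_mult] by simp
qed

lemma val_subst:
  assumes "val A p (of_real (q$1))" "val B p (of_real (q$2))"
  shows "val (subst A B a) p (evp a q)"
proof (induction a)
  case 0
  show ?case using val_const[of 0 p] by simp
next
  case (pCons c a)
  show ?case using val_add[OF val_cpoly[OF assms(1)] val_mult[OF assms(2) pCons(2)]] by simp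
qed

lemma val_loc_ring:
  assumes "val r p z" "evp f p = 0"
  shows "r \<in> loc_ring" "r \<in> max_ideal \<Longrightarrow> z = 0"
proof -
  obtain a b where ab: "r = Fract a b" "b \<noteq> 0" "evp b p \<noteq> 0" "z = evp a p / evp b p"
    using assms(1) by (rule valE)
  have b: "\<not> f dvd b" using ab(3) assms(2) by (auto elim!: dvdE)
  show "r \<in> loc_ring" using ab b by blast
  assume "r \<in> max_ideal"
  hence "f dvd a" using ab b Fract_max_ideal_iff by blast
  hence "evp a p = 0" using assms(2) by (auto elim!: dvdE)
  thus "z = 0" using ab by simp
qed

end

text \<open>The pairs \<open>(A1, A2)\<close> and \<open>(B1, B2)\<close> are the components of the maps \<open>Fm\<close> and \<open>Gm\<close> as rational
  functions. These maps are mutually inverse on \<open>S\<close>, a set large enough to decide identities between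
  rational functions, and preserve \<open>N / D\<close>. The curve \<open>f = 0\<close> is a level curve of \<open>N / D\<close>.\<close>

locale curve_substitution = prime_curve f for f +
  fixes A1 A2 B1 B2 :: "complex poly poly fract" and Fm Gm :: "real^2 \<Rightarrow> real^2" and S :: "(real^2) set"
    and p0 :: "real^2" and N D :: "complex poly poly" and h :: complex
  assumes S: "\<not> negligible S"
    and FS: "\<And>p. p \<in> S \<Longrightarrow> Fm p \<in> S" and GS: "\<And>p. p \<in> S \<Longrightarrow> Gm p \<in> S"
    and GF: "\<And>p. p \<in> S \<Longrightarrow> Gm (Fm p) = p" and FG: "\<And>p. p \<in> S \<Longrightarrow> Fm (Gm p) = p"
    and A: "\<And>p. p \<in> S \<Longrightarrow> val A1 p (of_real (Fm p $ 1))" "\<And>p. p \<in> S \<Longrightarrow> val A2 p (of_real (Fm p $ 2))"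
    and B: "\<And>p. p \<in> S \<Longrightarrow> val B1 p (of_real (Gm p $ 1))" "\<And>p. p \<in> S \<Longrightarrow> val B2 p (of_real (Gm p $ 2))"
    and f: "f = N - Polynomial.smult [:h:] D"
    and D: "\<And>p. p \<in> S \<Longrightarrow> evp D p \<noteq> 0"
    and ND: "\<And>p. p \<in> S \<Longrightarrow> evp N (Fm p) * evp D p = evp N p * evp D (Fm p)"
    and p0: "p0 \<in> S" "evp f p0 = 0"
begin

lemma ND_G: "p \<in> S \<Longrightarrow> evp N (Gm p) * evp D p = evp N p * evp D (Gm p)"
  using ND[of "Gm p"] GS FG by (simp add: mult.commute)

lemma swapped: "curve_substitution f B1 B2 A1 A2 Gm Fm S p0 N D h"
  by unfold_locales (use S FS GS GF FG A B f D ND_G p0 in auto)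

lemma Fp0: "evp f (Fm p0) = 0"
proof -
  have N0: "evp N p0 = h * evp D p0" using p0(2) unfolding f by simp
  have "evp N (Fm p0) * evp D p0 = (h * evp D (Fm p0)) * evp D p0"
    using ND[OF p0(1)] unfolding N0 by (simp add: mult_ac)
  hence "evp N (Fm p0) = h * evp D (Fm p0)" using D[OF p0(1)] by simp
  thus ?thesis unfolding f by simp
qed

abbreviation SF where "SF \<equiv> subst A1 A2"
abbreviation SG where "SG \<equiv> subst B1 B2"

lemma val_SF: "p \<in> S \<Longrightarrow> val (SF a) p (evp a (Fm p))"
  by (rule val_subst[OF A])

lemma val_SG: "p \<in> S \<Longrightarrow> val (SG a) p (evp a (Gm p))"
  by (rule val_subst[OF B])

lemma SF_loc: "SF a \<in> loc_ring"
  using val_loc_ring(1)[OF val_SF p0(2)] p0(1) by blast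

lemma SF_nz: assumes "b \<noteq> 0" shows "SF b \<noteq> 0"
proof
  assume 0: "SF b = 0"
  have "evp b p = 0" if p: "p \<in> S" for p
  proof -
    have "val (SF b) (Gm p) (evp b p)" using val_SF[OF GS[OF p]] FG[OF p] by simp
    moreover have "val (SF b) (Gm p) 0" unfolding 0 using val_const[of 0 "Gm p"] by simp
    ultimately show ?thesis by (rule val_unique)
  qed
  thus False using evp_identity[OF S] assms by blast
qed

text \<open>Invariance of \<open>N / D\<close> is the identity \<open>N(F) D = N D(F)\<close>, so \<open>f(F) D = f D(F)\<close>. The denominator \<open>D\<close> is
  prime to \<open>f\<close>.\<close>

lemma SF_f: "SF f \<in> max_ideal"
proof -
  have "SF N * Fract D 1 = Fract N 1 * SF D"
  proof (rule val_eqI[OF S])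
    fix p assume p: "p \<in> S"
    show "\<exists>z. val (SF N * Fract D 1) p z \<and> val (Fract N 1 * SF D) p z"
      using val_mult[OF val_SF[OF p, of N] val_poly[of D p]] val_mult[OF val_poly[of N p] val_SF[OF p, of D]]
      unfolding ND[OF p] by blast
  qed
  note e1 = this
  have e2: "SF f = SF N - const h * SF D" by (subst f) simp
  have e3: "Fract f 1 = Fract N 1 - const h * Fract D 1"
    by (subst f) (simp add: const_def)
  have "SF f * Fract D 1 = SF N * Fract D 1 - const h * SF D * Fract D 1"
    unfolding e2 by (rule left_diff_distrib)
  also have "\<dots> = (Fract N 1 - const h * Fract D 1) * SF D"
    by (simp only: left_diff_distrib e1 mult.assoc) (simp only: mult.commute)
  finally have eq: "SF f * Fract D 1 = Fract f 1 * SF D" unfolding e3 .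
  have "Fract f 1 \<in> max_ideal" by (simp add: Fract_max_ideal_iff not_dvd_1)
  hence "SF f * Fract D 1 \<in> max_ideal" unfolding eq using max_ideal_mult_iff SF_loc loc_ring_poly by blast
  moreover have "Fract D 1 \<notin> max_ideal"
  proof
    assume "Fract D 1 \<in> max_ideal"
    hence "evp D p0 = 0" using val_loc_ring(2)[OF val_poly p0(2)] by blast
    thus False using D p0 by blast
  qed
  ultimately show ?thesis using max_ideal_mult_iff SF_loc loc_ring_poly by blast
qed

lemma SG_SF: assumes "SF a = Fract c d" "d \<noteq> 0" shows "SG c = Fract a 1 * SG d"
proof (rule val_eqI[OF S])
  fix p assume p: "p \<in> S"
  have "val (Fract c d) (Gm p) (evp a p)"
    using val_SF[OF GS[OF p], of a] FG[OF p] unfolding assms(1) by simp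
  hence "evp a p * evp d (Gm p) = evp c (Gm p)" by (rule val_unique_Fract[OF _ assms(2)])
  thus "\<exists>z. val (SG c) p z \<and> val (Fract a 1 * SG d) p z"
    using val_SG[OF p, of c] val_mult[OF val_poly[of a p] val_SG[OF p, of d]] by metis
qed

definition \<sigma> where "\<sigma> r = SF (fst (quot_of_fract r)) / SF (snd (quot_of_fract r))"

end

context curve_substitution begin

interpretation sw: curve_substitution f B1 B2 A1 A2 Gm Fm S p0 N D h by (rule swapped)

text \<open>Otherwise apply the inverse substitution to a fraction representing \<open>b(F)\<close> whose denominator does not
  vanish at \<open>p0\<close>. The transformed denominator is then a unit, as its value at \<open>F p0\<close> shows, and \<open>f\<close> would divide \<open>b\<close>.\<close>

lemma SF_notin: assumes "\<not> f dvd b" shows "SF b \<notin> max_ideal"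
proof
  assume I: "SF b \<in> max_ideal"
  obtain c d where cd: "SF b = Fract c d" "d \<noteq> 0" "evp d p0 \<noteq> 0"
    using val_SF[OF p0(1), of b] by (elim valE)
  have "\<not> f dvd d" using cd(3) p0(2) by (auto elim!: dvdE)
  hence "f dvd c" using I cd(1) Fract_max_ideal_iff by simp
  then obtain c' where "c = f * c'" by (elim dvdE)
  hence "SG c \<in> max_ideal" using max_ideal_mult_iff[OF sw.SF_loc sw.SF_loc] sw.SF_f by simp
  hence "Fract b 1 * SG d \<in> max_ideal" using SG_SF[OF cd(1,2)] by simp
  hence "SG d \<in> max_ideal"
    using assms max_ideal_mult_iff[OF loc_ring_poly sw.SF_loc] by (simp add: Fract_max_ideal_iff not_dvd_1)
  hence "evp d (Gm (Fm p0)) = 0"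
    using val_loc_ring(2)[OF val_SG[OF FS[OF p0(1)]] Fp0] by blast
  thus False using cd(3) GF[OF p0(1)] by simp
qed

lemma \<sigma>_Fract: assumes "b \<noteq> 0" shows "\<sigma> (Fract a b) = SF a / SF b"
proof -
  define c d where "c = fst (quot_of_fract (Fract a b))" and "d = snd (quot_of_fract (Fract a b))"
  have d0: "d \<noteq> 0" unfolding d_def by simp
  have "Fract a b = Fract c d" unfolding c_def d_def by (metis Fract_quot_of_fract)
  hence "a * d = c * b" using assms d0 by (simp add: eq_fract)
  hence "SF a * SF d = SF c * SF b" by (metis subst_mult)
  thus ?thesis unfolding \<sigma>_def c_def[symmetric] d_def[symmetric]
    using SF_nz[OF assms] SF_nz[OF d0] by (simp add: frac_eq_eq)
qed

lemma \<sigma>_add: "\<sigma> (r + s) = \<sigma> r + \<sigma> s"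
proof -
  obtain a b where ab: "r = Fract a b" "b \<noteq> 0" by (cases r) auto
  obtain c d where cd: "s = Fract c d" "d \<noteq> 0" by (cases s) auto
  show ?thesis unfolding ab(1) cd(1) using ab cd SF_nz
    by (simp add: \<sigma>_Fract add_frac_eq)
qed

lemma \<sigma>_mult: "\<sigma> (r * s) = \<sigma> r * \<sigma> s"
proof -
  obtain a b where ab: "r = Fract a b" "b \<noteq> 0" by (cases r) auto
  obtain c d where cd: "s = Fract c d" "d \<noteq> 0" by (cases s) auto
  show ?thesis unfolding ab(1) cd(1) using ab cd by (simp add: \<sigma>_Fract)
qed

lemma \<sigma>_const: "\<sigma> (const c) = const c"
  unfolding const_def by (subst \<sigma>_Fract) (simp_all add: const_def)

lemma \<sigma>_loc: assumes "r \<in> loc_ring" shows "\<sigma> r \<in> loc_ring"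
proof -
  obtain a b where ab: "r = Fract a b" "\<not> f dvd b" using assms by (rule loc_ringE)
  have "b \<noteq> 0" using ab by auto
  thus ?thesis unfolding ab(1) using SF_loc inverse_loc_ring[OF SF_loc SF_notin[OF ab(2)]]
    by (auto simp: \<sigma>_Fract divide_inverse)
qed

lemma \<sigma>_ideal: assumes "r \<in> max_ideal" shows "\<sigma> r \<in> max_ideal"
proof -
  obtain a b where ab: "r = Fract a b" "f dvd a" "\<not> f dvd b" using assms max_ideal_iff by blast
  have b0: "b \<noteq> 0" using ab by auto
  obtain a' where a': "a = f * a'" using ab(2) by (elim dvdE)
  have "SF a \<in> max_ideal" unfolding a' subst_mult using max_ideal_mult_iff[OF SF_loc SF_loc] SF_f by simp
  thus ?thesis unfolding ab(1) \<sigma>_Fract[OF b0] divide_inverse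
    using max_ideal_mult_iff[OF SF_loc inverse_loc_ring[OF SF_loc SF_notin[OF ab(3)]]] by simp
qed

end

context curve_substitution begin

interpretation sw: curve_substitution f B1 B2 A1 A2 Gm Fm S p0 N D h by (rule swapped)

lemma sw_\<sigma>_SF: "sw.\<sigma> (SF a) = Fract a 1"
proof -
  obtain c d where cd: "SF a = Fract c d" "d \<noteq> 0" by (cases "SF a") auto
  have "sw.\<sigma> (SF a) = SG c / SG d" unfolding cd(1) by (rule sw.\<sigma>_Fract[OF cd(2)])
  also have "\<dots> = Fract a 1" unfolding SG_SF[OF cd] using sw.SF_nz[OF cd(2)] by simp
  finally show ?thesis .
qed

lemma sw_\<sigma>_\<sigma>: "sw.\<sigma> (\<sigma> r) = r"
proof -
  obtain a b where ab: "r = Fract a b" "b \<noteq> 0" by (cases r) auto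
  have "\<sigma> r * SF b = SF a" unfolding ab(1) \<sigma>_Fract[OF ab(2)] using SF_nz[OF ab(2)] by simp
  hence "sw.\<sigma> (\<sigma> r) * Fract b 1 = Fract a 1" by (metis sw.\<sigma>_mult sw_\<sigma>_SF)
  moreover have "Fract a 1 = r * Fract b 1" unfolding ab(1) using ab(2) by (simp add: eq_fract)
  moreover have "Fract b 1 \<noteq> 0" using ab(2) by (simp add: Zero_fract_def eq_fract)
  ultimately show ?thesis by simp
qed

lemma val_\<sigma>:
  assumes "val A1 p (of_real (q$1))" "val A2 p (of_real (q$2))" "val t q z"
  shows "val (\<sigma> t) p z"
proof -
  obtain a b where ab: "t = Fract a b" "b \<noteq> 0" "evp b q \<noteq> 0" "z = evp a q / evp b q"
    using assms(3) by (rule valE)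
  show ?thesis unfolding ab(1) \<sigma>_Fract[OF ab(2)] ab(4)
    by (rule val_divide[OF val_subst[OF assms(1,2)] val_subst[OF assms(1,2)] ab(3)])
qed

end

lemma (in smooth_point) substitution_moebius:
  assumes "curve_substitution f A1 A2 B1 B2 Fm Gm S p0 N D h"
    and genus: "curve_has_genus f 0"
    and t: "t \<in> loc_ring" "\<And>c. t - const c \<notin> max_ideal" "pole_le 1 t"
  shows "\<exists>a b c d s. a * d - b * c \<noteq> 0 \<and> (const c * t + const d) * s - (const a * t + const b) \<in> max_ideal \<and>
    (\<forall>p q z. val A1 p (of_real (q$1)) \<longrightarrow> val A2 p (of_real (q$2)) \<longrightarrow> val t q z \<longrightarrow> val s p z)"
proof -
  interpret cs: curve_substitution f A1 A2 B1 B2 Fm Gm S p0 N D h by fact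
  interpret sw: curve_substitution f B1 B2 A1 A2 Gm Fm S p0 N D h by (rule cs.swapped)
  obtain a b c d where "a * d - b * c \<noteq> 0"
    "(const c * t + const d) * cs.\<sigma> t - (const a * t + const b) \<in> max_ideal"
    using automorphism_moebius[OF genus t, of cs.\<sigma> sw.\<sigma>, OF cs.\<sigma>_add sw.\<sigma>_add cs.\<sigma>_mult sw.\<sigma>_mult
      cs.\<sigma>_const sw.\<sigma>_const cs.\<sigma>_loc sw.\<sigma>_loc cs.\<sigma>_ideal sw.\<sigma>_ideal cs.sw_\<sigma>_\<sigma> sw.sw_\<sigma>_\<sigma>] by blast
  thus ?thesis using cs.val_\<sigma> by blast
qed

section \<open>Differentiating identities on a level curve\<close>

lemma level_curve_derivative:
  assumes p: "p \<in> rf_domain V" "rf_eval V p = h"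
  shows "evp (dX (level_curve V h)) p = complex_of_real (evp (rf_denom V) p * rX V p)"
    "evp (pderiv (level_curve V h)) p = complex_of_real (evp (rf_denom V) p * rY V p)"
    "evp (level_curve V h) p = 0"
proof -
  define N D where "N = rf_numer V" and "D = rf_denom V"
  have D0: "evp D p \<noteq> 0" using p(1) by (simp add: rf_domain_evp D_def)
  have N: "evp N p = h * evp D p" using p(2) D0 by (auto simp: rf_eval_evp N_def D_def)
  have dXs: "dX (P - Polynomial.smult [:c:] Q) = dX P - Polynomial.smult [:c:] (dX Q)" for P Q :: "complex poly poly" and c
    unfolding dX_def by (rule poly_eqI) (simp add: coeff_map_poly pderiv_diff pderiv_smult)
  have "evp D p * rX V p = evp (dX N) p - h * evp (dX D) p"
    unfolding qX_def N_def[symmetric] D_def[symmetric] N using D0 by (simp add: field_simps power2_eq_square)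
  thus "evp (dX (level_curve V h)) p = complex_of_real (evp (rf_denom V) p * rX V p)"
    unfolding level_curve_eq dXs N_def[symmetric] D_def[symmetric] by simp
  have "evp D p * rY V p = evp (pderiv N) p - h * evp (pderiv D) p"
    unfolding qY_def N_def[symmetric] D_def[symmetric] N using D0 by (simp add: field_simps power2_eq_square)
  thus "evp (pderiv (level_curve V h)) p = complex_of_real (evp (rf_denom V) p * rY V p)"
    unfolding level_curve_eq N_def[symmetric] D_def[symmetric] by (simp add: pderiv_diff pderiv_smult)
  show "evp (level_curve V h) p = 0"
    unfolding evp_level_curve N_def[symmetric] D_def[symmetric] N by simp
qed

text \<open>Near \<open>p\<close> the function \<open>E\<close> is the product of the equation of the curve with a smooth function, so at \<open>p\<close>
  its differential is a multiple of the differential of \<open>V\<close>.\<close>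

lemma level_tangent:
  assumes p: "p \<in> rf_domain V" "rf_eval V p = h"
    and b: "evp b p \<noteq> 0" and S: "open S" "p \<in> S"
    and E: "\<And>q. q \<in> S \<Longrightarrow> val (Fract (level_curve V h * c) b) q (E q)"
    and E': "(E has_derivative E') (at p)"
  shows "E p = 0" "E' (vector [rY V p, - rX V p]) = 0"
proof -
  define f where "f = level_curve V h"
  note f = level_curve_derivative[OF p, folded f_def]
  define T where "T = S \<inter> {q. evp b q \<noteq> 0}"
  have T: "open T" "p \<in> T" unfolding T_def using S b by (auto simp: open_Collect_neq continuous_on_evp)
  have ET: "E q = evp f q * (evp c q / evp b q)" if q: "q \<in> T" for q
  proof -
    have "val (Fract (f * c) b) q (evp (f * c) q / evp b q)" using q unfolding T_def by (intro val_Fract) simp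
    moreover have "val (Fract (f * c) b) q (E q)" using E q unfolding T_def f_def by blast
    ultimately show ?thesis using val_unique by fastforce
  qed
  show "E p = 0" using ET[OF T(2)] f(3) by simp
  have d: "((\<lambda>q. evp f q * (evp c q / evp b q)) has_derivative
      (\<lambda>v. evp f p * (of_real (v$1) * qX c b p + of_real (v$2) * qY c b p)
        + (of_real (v$1) * evp (dX f) p + of_real (v$2) * evp (pderiv f) p) * (evp c p / evp b p))) (at p)"
    by (rule has_derivative_mult[OF evp_has_derivative quotient_has_derivative[OF b]])
  have "(E has_derivative
      (\<lambda>v. evp f p * (of_real (v$1) * qX c b p + of_real (v$2) * qY c b p)
        + (of_real (v$1) * evp (dX f) p + of_real (v$2) * evp (pderiv f) p) * (evp c p / evp b p))) (at p)"
    by (rule has_derivative_transform_within_open[OF d T]) (simp add: ET)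
  hence "E' = (\<lambda>v. evp f p * (of_real (v$1) * qX c b p + of_real (v$2) * qY c b p)
        + (of_real (v$1) * evp (dX f) p + of_real (v$2) * evp (pderiv f) p) * (evp c p / evp b p))"
    by (rule has_derivative_unique[OF E'])
  thus "E' (vector [rY V p, - rX V p]) = 0" by (simp add: f algebra_simps)
qed

lemma (in prime_curve) finite_real_common_zeros:
  assumes "degree f > 0" "\<not> f dvd b"
  shows "finite {p. evp f p = 0 \<and> evp b p = 0}"
proof (rule finite_imageD)
  define e where "e = (\<lambda>p::real^2. (complex_of_real (p$1), complex_of_real (p$2)))"
  show "finite (e ` {p. evp f p = 0 \<and> evp b p = 0})"
    by (rule finite_subset[OF _ finite_common_zeros[OF prime assms]]) (auto simp: e_def evp_def)
  show "inj_on e {p. evp f p = 0 \<and> evp b p = 0}"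
    by (auto simp: inj_on_def e_def vec_eq_iff forall_2)
qed

lemma (in smooth_point) x_rational_in_t_coprime:
  assumes genus: "curve_has_genus f 0"
    and t: "t \<in> loc_ring" "\<And>c. t - const c \<notin> max_ideal" "pole_le 1 t"
  shows "\<exists>P Q. (\<forall>z. poly P z \<noteq> 0 \<or> poly Q z \<noteq> 0) \<and> cpoly Q t * xT - cpoly P t \<in> max_ideal"
proof -
  obtain p q where pq: "q \<noteq> 0" "cpoly q t * xT - cpoly p t \<in> max_ideal"
    using x_rational_in_t[OF genus t] by blast
  define g where "g = gcd p q"
  define P Q where "P = p div g" and "Q = q div g"
  have g0: "g \<noteq> 0" using pq(1) by (simp add: g_def)
  have PQ: "p = g * P" "q = g * Q" by (simp_all add: P_def Q_def g_def)
  have "coprime P Q" unfolding P_def Q_def g_def using pq(1) by (intro div_gcd_coprime) simp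
  have nz: "poly P z \<noteq> 0 \<or> poly Q z \<noteq> 0" for z
  proof (rule ccontr)
    assume "\<not> ?thesis"
    hence "[:-z,1:] dvd P" "[:-z,1:] dvd Q" by (simp_all add: poly_eq_0_iff_dvd)
    hence "is_unit [:-z,1:]" using \<open>coprime P Q\<close> by (rule coprime_common_divisor[rotated])
    thus False by (simp add: is_unit_iff_degree)
  qed
  have "cpoly g t * (cpoly Q t * xT - cpoly P t) \<in> max_ideal"
    using pq(2) unfolding PQ by (simp add: algebra_simps)
  moreover have "cpoly g t \<notin> max_ideal" using cpoly_transcendental[OF t(1,2) g0] .
  ultimately have "cpoly Q t * xT - cpoly P t \<in> max_ideal"
    using max_ideal_mult_iff[of "cpoly g t" "cpoly Q t * xT - cpoly P t"] t(1) by blast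
  thus ?thesis using nz by blast
qed

context birational_integral begin

lemma X_not_negligible: assumes "p0 \<in> X" shows "\<not> negligible X"
proof
  assume "negligible X"
  hence "negligible (X \<union> (U - X))" using X(3) by (rule negligible_Un)
  hence "negligible U" by (rule negligible_subset) blast
  thus False using open_not_negligible[OF U(1)] X_U[OF assms] by blast
qed

text \<open>On a level curve which is not a vertical line, the abstract coordinate \<open>t\<close> of the function
  field supplies the data of \<open>moebius_transport\<close>. The relations between \<open>x\<close>, \<open>t\<close> and the image of \<open>t\<close> hold modulo the
  equation of the curve. Differentiated along the curve they become relations between derivatives.\<close>

lemma fibre_nonvertical:
  assumes j: "j = 1" and p0: "p0 \<in> X"
    and irr: "Factorial_Ring.irreducible (level_curve V (rf_eval V p0))"
    and genus: "curve_has_genus (level_curve V (rf_eval V p0)) 0"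
  shows "\<exists>Z \<kappa> C. countable Z \<and>
    (\<forall>p\<in>X - Z. rf_eval V p = rf_eval V p0 \<longrightarrow> dens p \<le> C * \<kappa> p \<and>
      (rm_eval F p \<notin> Z \<longrightarrow> \<bar>rm_jac F p\<bar> * \<kappa> (rm_eval F p) = \<kappa> p))"
proof -
  define h where "h = rf_eval V p0"
  define f where "f = level_curve V h"
  have lev: "p \<in> rf_domain V" "evp f p = 0" "rf_eval V p = h" if "p \<in> X" "rf_eval V p = h" for p
    using U_domain(2)[OF X_U[OF that(1)]] level_curve_derivative(3)[of p V h] that unfolding f_def by auto
  have tan_nz: "tan p $ j \<noteq> 0" if "p \<in> X" for p
    unfolding tan_def by (rule W(2)[OF U_domain(2)[OF X_U[OF that]] U0D(4)[OF X_U0[OF that]]])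
  interpret SP: smooth_point f "complex_of_real (p0$1)" "complex_of_real (p0$2)"
  proof
    show "prime_elem f" using irr unfolding f_def h_def by (rule irreducible_imp_prime_elem)
    show "eval2 f (complex_of_real (p0$1)) (complex_of_real (p0$2)) = 0"
      using lev(2)[OF p0] by (simp add: evp_def h_def)
    have "evp (rf_denom V) p0 \<noteq> 0" using lev(1)[OF p0] by (simp add: rf_domain_evp h_def)
    hence "evp (pderiv f) p0 \<noteq> 0"
      using level_curve_derivative(2)[OF lev(1)[OF p0]] tan_nz[OF p0] by (simp add: f_def h_def j tan_def)
    thus "eval2 (pderiv f) (complex_of_real (p0$1)) (complex_of_real (p0$2)) \<noteq> 0" by (simp add: evp_def)
  qed
  have gen: "curve_has_genus f 0" using genus by (simp add: f_def h_def)
  obtain t where t: "t \<in> SP.loc_ring" "\<And>c. t - const c \<notin> SP.max_ideal" "SP.pole_le 1 t"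
    using SP.genus0_coordinate[OF gen] by blast
  obtain P Q where PQ: "\<And>z. poly P z \<noteq> 0 \<or> poly Q z \<noteq> 0"
    and e1: "prime_curve.cpoly Q t * prime_curve.xT - prime_curve.cpoly P t \<in> SP.max_ideal"
    using SP.x_rational_in_t_coprime[OF gen t] by blast
  define A1 A2 where "A1 = cxr (fst F)" and "A2 = cxr (snd F)"
  have vA: "val A1 p (complex_of_real (rm_eval F p $ 1))" "val A2 p (complex_of_real (rm_eval F p $ 2))"
    if "p \<in> U" for p
    using U_domain(1)[OF that] unfolding A1_def A2_def rm_domain_def rm_eval_def by (auto intro: val_cxr)
  have cs: "curve_substitution f A1 A2 (cxr (fst G)) (cxr (snd G)) (rm_eval F) (rm_eval G) X p0
      (cx (rf_numer V)) (cx (rf_denom V)) (complex_of_real h)"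
  proof
    show "\<not> negligible X" by (rule X_not_negligible[OF p0])
    show "f = cx (rf_numer V) - Polynomial.smult [:complex_of_real h:] (cx (rf_denom V))"
      unfolding f_def by (rule level_curve_eq)
    show "evp f p0 = 0" using lev(2)[OF p0] by (simp add: h_def)
    fix p assume p: "p \<in> X"
    show "val A1 p (complex_of_real (rm_eval F p $ 1))" "val A2 p (complex_of_real (rm_eval F p $ 2))"
      using vA[OF X_U[OF p]] by auto
    show "val (cxr (fst G)) p (complex_of_real (rm_eval G p $ 1))"
      "val (cxr (snd G)) p (complex_of_real (rm_eval G p $ 2))"
      using G_domain[OF p] unfolding rm_domain_def rm_eval_def by (auto intro: val_cxr)
    have D: "evp (rf_denom V) p \<noteq> 0" "evp (rf_denom V) (rm_eval F p) \<noteq> 0"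
      using U_domain(2)[OF X_U[OF p]] U_domain(2)[OF X_U[OF X(4)[OF p]]] by (auto simp: rf_domain_evp)
    show "evp (cx (rf_denom V)) p \<noteq> 0" using D by simp
    have "evp (rf_numer V) (rm_eval F p) * evp (rf_denom V) p = evp (rf_numer V) p * evp (rf_denom V) (rm_eval F p)"
      using V_FX[OF p] D unfolding rf_eval_evp by (simp add: frac_eq_eq)
    thus "evp (cx (rf_numer V)) (rm_eval F p) * evp (cx (rf_denom V)) p
        = evp (cx (rf_numer V)) p * evp (cx (rf_denom V)) (rm_eval F p)"
      by (simp flip: of_real_mult)
  qed (use X GF FG p0 in auto)
  obtain a b c d s where det: "a * d - b * c \<noteq> 0"
    and e2: "(const c * t + const d) * s - (const a * t + const b) \<in> SP.max_ideal"
    and vs: "\<And>p q z. val A1 p (of_real (q$1)) \<Longrightarrow> val A2 p (of_real (q$2)) \<Longrightarrow> val t q z \<Longrightarrow> val s p z"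
    using SP.substitution_moebius[OF cs gen t] by blast
  obtain A B where AB: "t = Fract A B" "\<not> f dvd B" using t(1) by (rule SP.loc_ringE)
  obtain c1 b1 where e1': "prime_curve.cpoly Q t * prime_curve.xT - prime_curve.cpoly P t = Fract (f * c1) b1" "\<not> f dvd b1"
    using e1 unfolding SP.max_ideal_iff by (auto elim!: dvdE)
  obtain c2 b2 where e2': "(const c * t + const d) * s - (const a * t + const b) = Fract (f * c2) b2" "\<not> f dvd b2"
    using e2 unfolding SP.max_ideal_iff by (auto elim!: dvdE)
  define \<phi> where "\<phi> = (\<lambda>p. evp A p / evp B p)"
  define \<phi>' where "\<phi>' = (\<lambda>p (v::real^2). of_real (v$1) * qX A B p + of_real (v$2) * qY A B p)"
  define d\<phi> where "d\<phi> = (\<lambda>p. \<phi>' p (tan p))"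
  have \<phi>der: "(\<phi> has_derivative \<phi>' p) (at p)" if "evp B p \<noteq> 0" for p
    unfolding \<phi>_def \<phi>'_def by (rule quotient_has_derivative[OF that])
  have vt: "val t p (\<phi> p)" if "evp B p \<noteq> 0" for p
    unfolding AB(1) \<phi>_def by (rule val_Fract[OF that])
  \<comment> \<open>the points where one of the three fractions representing the relations is not defined\<close>
  define Z0 where "Z0 = {p. evp f p = 0 \<and> evp (B * b1 * b2) p = 0}"
  have "\<not> f dvd B * b1 * b2" using AB(2) e1'(2) e2'(2) by (simp add: SP.dvd_mult_iff)
  hence Z0: "finite Z0" unfolding Z0_def by (rule SP.finite_real_common_zeros[OF SP.degree_pos])
  define Ob where "Ob = {p \<in> X. rf_eval V p = h \<and> p \<notin> Z0}"
  have ObD: "p \<in> X" "p \<in> U" "rf_eval V p = h" "p \<in> rf_domain V" "evp B p \<noteq> 0" "evp b1 p \<noteq> 0" "evp b2 p \<noteq> 0"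
    if "p \<in> Ob" for p
    using that lev(1,2)[of p] X_U[of p] unfolding Ob_def Z0_def by auto
  have opB: "open {p. evp B p \<noteq> 0}" by (simp add: open_Collect_neq continuous_on_evp)
  have part1: "complex_of_real (p$1) * poly Q (\<phi> p) = poly P (\<phi> p)"
      "complex_of_real (tan p $ 1) * (poly Q (\<phi> p))\<^sup>2 = poly (pderiv P * Q - P * pderiv Q) (\<phi> p) * d\<phi> p"
    if p: "p \<in> Ob" for p
  proof -
    note o = ObD[OF p]
    define E where "E = (\<lambda>q. poly Q (\<phi> q) * complex_of_real (q$1) - poly P (\<phi> q))"
    have vE: "val (Fract (level_curve V h * c1) b1) q (E q)" if q: "q \<in> {q. evp B q \<noteq> 0}" for q
    proof -
      have "val prime_curve.xT q (complex_of_real (q$1))"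
        using val_poly[of "[:[:0,1:]:]" q] unfolding SP.xT_def by simp
      thus ?thesis unfolding E_def f_def[symmetric] e1'(1)[symmetric] using q vt
        by (intro val_diff val_mult SP.val_cpoly) auto
    qed
    have po: "((\<lambda>q. poly R (\<phi> q)) has_derivative (\<lambda>v. poly (pderiv R) (\<phi> p) * \<phi>' p v)) (at p)" for R
      using has_derivative_compose[OF \<phi>der[OF o(5)] has_field_derivative_imp_has_derivative[OF poly_DERIV[of R]]] by simp
    have x: "((\<lambda>q::real^2. complex_of_real (q$1)) has_derivative (\<lambda>v. complex_of_real (v$1))) (at p)"
      by (rule bounded_linear_imp_has_derivative, rule bounded_linear_compose[OF bounded_linear_of_real bounded_linear_vec_nth])
    have dE: "(E has_derivative (\<lambda>v. (poly Q (\<phi> p) * complex_of_real (v$1)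
        + poly (pderiv Q) (\<phi> p) * \<phi>' p v * complex_of_real (p$1)) - poly (pderiv P) (\<phi> p) * \<phi>' p v)) (at p)"
      unfolding E_def by (rule has_derivative_diff[OF has_derivative_mult[OF po x] po])
    note lt = level_tangent[OF o(4,3,6) opB _ vE dE]
    have "E p = 0" using lt(1) o(5) by simp
    thus 1: "complex_of_real (p$1) * poly Q (\<phi> p) = poly P (\<phi> p)"
      unfolding E_def by (simp add: mult.commute)
    have "(poly Q (\<phi> p) * complex_of_real (tan p$1)
        + poly (pderiv Q) (\<phi> p) * d\<phi> p * complex_of_real (p$1)) - poly (pderiv P) (\<phi> p) * d\<phi> p = 0"
      using lt(2) o(5) unfolding d\<phi>_def tan_def by simp
    hence "poly Q (\<phi> p) * complex_of_real (tan p$1)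
        = poly (pderiv P) (\<phi> p) * d\<phi> p - poly (pderiv Q) (\<phi> p) * d\<phi> p * complex_of_real (p$1)"
      by (simp add: algebra_simps)
    from arg_cong[OF this, of "(*) (poly Q (\<phi> p))"] have "poly Q (\<phi> p) * (poly Q (\<phi> p) * complex_of_real (tan p$1))
        = poly Q (\<phi> p) * (poly (pderiv P) (\<phi> p) * d\<phi> p) - poly (pderiv Q) (\<phi> p) * d\<phi> p * (complex_of_real (p$1) * poly Q (\<phi> p))"
      by (simp add: algebra_simps)
    thus "complex_of_real (tan p $ 1) * (poly Q (\<phi> p))\<^sup>2 = poly (pderiv P * Q - P * pderiv Q) (\<phi> p) * d\<phi> p"
      unfolding 1 by (simp add: algebra_simps power2_eq_square)
  qed
  have part2: "(c * \<phi> p + d) * \<phi> (rm_eval F p) = a * \<phi> p + b"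
      "complex_of_real (rm_jac F p) * d\<phi> (rm_eval F p) * (c * \<phi> p + d)\<^sup>2 = (a * d - b * c) * d\<phi> p"
    if p: "p \<in> Ob" "rm_eval F p \<in> Ob" for p
  proof -
    note o = ObD[OF p(1)] and o' = ObD[OF p(2)]
    define w where "w = \<phi> (rm_eval F p)"
    define E where "E = (\<lambda>q. (c * \<phi> q + d) * \<phi> (rm_eval F q) - (a * \<phi> q + b))"
    define S where "S = {q. evp B q \<noteq> 0} \<inter> (U \<inter> rm_eval F -` {q. evp B q \<noteq> 0})"
    have "continuous_on U (rm_eval F)"
    proof (rule continuous_at_imp_continuous_on, rule ballI)
      fix q assume "q \<in> U"
      thus "isCont (rm_eval F) q" by (rule has_derivative_continuous[OF rm_eval_has_derivative[OF U_domain(1)]])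
    qed
    hence S: "open S" unfolding S_def by (intro open_Int opB continuous_open_preimage U(1))
    have pS: "p \<in> S" unfolding S_def using o o' by auto
    have vE: "val (Fract (level_curve V h * c2) b2) q (E q)" if q: "q \<in> S" for q
    proof -
      have q': "evp B q \<noteq> 0" "q \<in> U" "evp B (rm_eval F q) \<noteq> 0" using q unfolding S_def by auto
      have "val s q (\<phi> (rm_eval F q))" by (rule vs[OF vA[OF q'(2)] vt[OF q'(3)]])
      thus ?thesis unfolding E_def f_def[symmetric] e2'(1)[symmetric] using vt[OF q'(1)]
        by (intro val_diff val_mult val_add SP.val_const)
    qed
    have dF: "((\<lambda>q. \<phi> (rm_eval F q)) has_derivative (\<lambda>v. \<phi>' (rm_eval F p) (rm_deriv F p v))) (at p)"
      using has_derivative_compose[OF rm_eval_has_derivative[OF U_domain(1)[OF o(2)]] \<phi>der[OF o'(5)]] by simp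
    have lin: "((\<lambda>q. x * \<phi> q + y) has_derivative (\<lambda>v. x * \<phi>' p v)) (at p)" for x y
      by (rule has_derivative_add_const[OF has_derivative_mult_right[OF \<phi>der[OF o(5)]]])
    have dE: "(E has_derivative (\<lambda>v. ((c * \<phi> p + d) * \<phi>' (rm_eval F p) (rm_deriv F p v)
        + c * \<phi>' p v * \<phi> (rm_eval F p)) - a * \<phi>' p v)) (at p)"
      unfolding E_def by (rule has_derivative_diff[OF has_derivative_mult[OF lin dF] lin])
    note lt = level_tangent[OF o(4,3,7) S pS vE dE]
    show 1: "(c * \<phi> p + d) * \<phi> (rm_eval F p) = a * \<phi> p + b"
      using lt(1) unfolding E_def by simp
    have dp: "\<phi>' p (tan p) = d\<phi> p" by (simp add: d\<phi>_def)
    have "\<phi>' (rm_eval F p) (rm_deriv F p (tan p)) = complex_of_real (rm_jac F p) * d\<phi> (rm_eval F p)"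
      unfolding tan_transport[OF o(2)] d\<phi>_def \<phi>'_def by (simp add: algebra_simps)
    hence "(c * \<phi> p + d) * (complex_of_real (rm_jac F p) * d\<phi> (rm_eval F p)) = a * d\<phi> p - c * w * d\<phi> p"
      using lt(2) unfolding tan_def[symmetric] w_def by (simp add: algebra_simps dp)
    from arg_cong[OF this, of "(*) (c * \<phi> p + d)"] have "(c * \<phi> p + d) * ((c * \<phi> p + d) * (complex_of_real (rm_jac F p) * d\<phi> (rm_eval F p)))
        = (c * \<phi> p + d) * (a * d\<phi> p) - c * d\<phi> p * ((c * \<phi> p + d) * w)"
      by (simp add: algebra_simps)
    thus "complex_of_real (rm_jac F p) * d\<phi> (rm_eval F p) * (c * \<phi> p + d)\<^sup>2 = (a * d - b * c) * d\<phi> p"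
      unfolding 1[folded w_def] by (simp add: algebra_simps power2_eq_square)
  qed
  obtain C \<kappa> Bf where Bf: "finite Bf"
    and \<kappa>: "\<And>p. p \<in> Ob \<Longrightarrow> \<phi> p \<notin> Bf \<Longrightarrow> \<bar>tan p $ 1\<bar> / (1 + (p$1)\<^sup>2) \<le> C * \<kappa> p"
      "\<And>p. p \<in> Ob \<Longrightarrow> rm_eval F p \<in> Ob \<Longrightarrow> \<phi> p \<notin> Bf \<Longrightarrow> \<phi> (rm_eval F p) \<notin> Bf \<Longrightarrow>
        \<bar>rm_jac F p\<bar> * \<kappa> (rm_eval F p) = \<kappa> p"
    using moebius_transport[where Ob = Ob and u = "\<lambda>p. p$1" and du = "\<lambda>p. tan p $ 1" and \<phi> = \<phi>
      and d\<phi> = d\<phi> and F = "rm_eval F" and J = "rm_jac F", OF det PQ part1 part2] by blast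
  define Z where "Z = Z0 \<union> (\<Union>z\<in>Bf. {p. evp f p = 0 \<and> evp (A - Polynomial.smult [:z:] B) p = 0})"
  have "\<not> f dvd A - Polynomial.smult [:z:] B" for z
  proof
    assume dv: "f dvd A - Polynomial.smult [:z:] B"
    have "B \<noteq> 0" using AB(2) by auto
    hence "t - const z = Fract (A - Polynomial.smult [:z:] B) B" unfolding AB(1) const_def by simp
    thus False using dv t(2)[of z] SP.Fract_max_ideal_iff[OF AB(2)] by simp
  qed
  hence "finite Z" unfolding Z_def using Z0 Bf SP.finite_real_common_zeros[OF SP.degree_pos] by blast
  hence Z: "countable Z" by (rule countable_finite)
  have out: "p \<in> Ob \<and> \<phi> p \<notin> Bf" if p: "p \<in> X" "p \<notin> Z" "rf_eval V p = h" for p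
  proof -
    have ob: "p \<in> Ob" using p unfolding Ob_def Z_def by blast
    have "\<phi> p \<notin> Bf"
    proof
      assume "\<phi> p \<in> Bf"
      moreover have "evp (A - Polynomial.smult [:\<phi> p:] B) p = 0"
        using ObD(5)[OF ob] by (simp add: \<phi>_def)
      ultimately show False using p(2) lev(2)[OF p(1,3)] unfolding Z_def by blast
    qed
    thus ?thesis using ob by blast
  qed
  have "dens p \<le> C * \<kappa> p \<and> (rm_eval F p \<notin> Z \<longrightarrow> \<bar>rm_jac F p\<bar> * \<kappa> (rm_eval F p) = \<kappa> p)"
    if p: "p \<in> X - Z" "rf_eval V p = rf_eval V p0" for p
  proof -
    have p': "p \<in> X" "p \<notin> Z" "rf_eval V p = h" using p by (auto simp: h_def)
    note o = out[OF p']
    have "dens p \<le> C * \<kappa> p" using \<kappa>(1)[of p] o unfolding dens_def by (simp add: j)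
    moreover have "\<bar>rm_jac F p\<bar> * \<kappa> (rm_eval F p) = \<kappa> p" if FZ: "rm_eval F p \<notin> Z"
    proof -
      have "rf_eval V (rm_eval F p) = h" using V_FX[OF p'(1)] p'(3) by simp
      hence "rm_eval F p \<in> Ob \<and> \<phi> (rm_eval F p) \<notin> Bf" by (rule out[OF X(4)[OF p'(1)] FZ])
      thus ?thesis using \<kappa>(2)[of p] o by simp
    qed
    ultimately show ?thesis by simp
  qed
  thus ?thesis using Z by blast
qed

end

section \<open>Rational functions of one variable with a rational left inverse\<close>

text \<open>By coprimality each polynomial divides its own derivative, which is zero or has smaller degree.\<close>

lemma wronskian_eq_0:
  fixes p q :: "'a::{factorial_ring_gcd,semiring_gcd_mult_normalize,semiring_char_0} poly"
  assumes cop: "coprime p q" and W: "pderiv p * q = p * pderiv q"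
  shows "pderiv p = 0" "pderiv q = 0"
proof -
  have *: "pderiv b = 0" if "b dvd pderiv b" for b :: "'a poly"
  proof (rule ccontr)
    assume n: "pderiv b \<noteq> 0"
    hence "degree b \<le> degree (pderiv b)" using that by (intro dvd_imp_degree_le)
    moreover have "degree b \<noteq> 0" using n by (simp add: pderiv_eq_0_iff)
    ultimately show False by (simp add: degree_pderiv)
  qed
  have "q dvd p * pderiv q" unfolding W[symmetric] by simp
  hence "q dvd pderiv q" using cop by (simp add: coprime_dvd_mult_right_iff coprime_commute)
  thus "pderiv q = 0" by (rule *)
  have "p dvd pderiv p * q" unfolding W by simp
  hence "p dvd pderiv p" using cop by (simp add: coprime_dvd_mult_left_iff)
  thus "pderiv p = 0" by (rule *)
qed

text \<open>For all but finitely many values \<open>w\<close> the roots of \<open>n - w d\<close> are simple, and the left inverse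
  leaves room for one root only; so \<open>n\<close> and \<open>d\<close> have degree at most one.\<close>

lemma rational_left_inverse_moebius:
  fixes n d n' d' :: "complex poly"
  assumes Y: "infinite Y"
    and inv: "\<And>y. y \<in> Y \<Longrightarrow> poly d y \<noteq> 0 \<and> poly d' (poly n y / poly d y) \<noteq> 0 \<and>
      poly n' (poly n y / poly d y) = y * poly d' (poly n y / poly d y)"
  obtains a b c e where "a * e - b * c \<noteq> 0"
    "\<And>y. poly d y \<noteq> 0 \<Longrightarrow> (c * y + e) * (poly n y / poly d y) = a * y + b"
proof -
  obtain y0 where y0: "y0 \<in> Y" using Y by (metis finite.emptyI ex_in_conv)
  have d0: "d \<noteq> 0" using inv[OF y0] by auto
  define g where "g = gcd n d"
  define n1 d1 where "n1 = n div g" and "d1 = d div g"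
  have nd: "n = g * n1" "d = g * d1" by (simp_all add: n1_def d1_def g_def)
  have cop: "coprime n1 d1" unfolding n1_def d1_def g_def using d0 by (intro div_gcd_coprime) simp
  have d1y: "poly d1 y \<noteq> 0" "poly n y / poly d y = poly n1 y / poly d1 y" if "poly d y \<noteq> 0" for y
    using that unfolding nd by auto
  have nocommon: "poly n1 y \<noteq> 0 \<or> poly d1 y \<noteq> 0" for y
  proof (rule ccontr)
    assume "\<not> ?thesis"
    hence "[:-y,1:] dvd n1" "[:-y,1:] dvd d1" by (simp_all add: poly_eq_0_iff_dvd)
    hence "is_unit [:-y,1:]" using cop by (rule coprime_common_divisor[rotated])
    thus False by (simp add: is_unit_iff_degree)
  qed
  define m where "m = max (degree n') (degree d')"
  \<comment> \<open>homogenization turns the left inverse into a polynomial identity valid at all points\<close>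
  define Hom where "Hom = (\<lambda>p. \<Sum>i\<le>m. Polynomial.smult (poly.coeff p i) (n1 ^ i * d1 ^ (m - i)))"
  have Hom: "poly (Hom p) y = poly d1 y ^ m * poly p (poly n1 y / poly d1 y)"
    if "degree p \<le> m" "poly d1 y \<noteq> 0" for p y
  proof -
    have "poly (Hom p) y = (\<Sum>i\<le>m. poly.coeff p i * (poly n1 y ^ i * poly d1 y ^ (m - i)))"
      unfolding Hom_def by (simp add: poly_sum)
    also have "\<dots> = (\<Sum>i\<le>m. poly d1 y ^ m * (poly.coeff p i * (poly n1 y / poly d1 y) ^ i))"
    proof (intro sum.cong refl)
      fix i assume "i \<in> {..m}"
      hence "poly d1 y ^ m = poly d1 y ^ i * poly d1 y ^ (m - i)" by (simp flip: power_add)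
      thus "poly.coeff p i * (poly n1 y ^ i * poly d1 y ^ (m - i))
          = poly d1 y ^ m * (poly.coeff p i * (poly n1 y / poly d1 y) ^ i)"
        using that(2) by (simp add: power_divide)
    qed
    also have "\<dots> = poly d1 y ^ m * (\<Sum>i\<le>m. poly.coeff p i * (poly n1 y / poly d1 y) ^ i)"
      by (simp add: sum_distrib_left)
    also have "(\<Sum>i\<le>m. poly.coeff p i * (poly n1 y / poly d1 y) ^ i) = poly p (poly n1 y / poly d1 y)"
    proof -
      have "p = (\<Sum>i\<le>m. Polynomial.monom (poly.coeff p i) i)"
        by (rule poly_as_sum_of_monoms'[OF that(1), symmetric])
      hence "poly p z = poly (\<Sum>i\<le>m. Polynomial.monom (poly.coeff p i) i) z" for z by simp
      thus ?thesis by (simp add: poly_sum poly_monom)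
    qed
    finally show ?thesis .
  qed
  have md: "degree n' \<le> m" "degree d' \<le> m" by (simp_all add: m_def)
  have "Hom n' - [:0,1:] * Hom d' = 0"
  proof (rule ccontr)
    assume "Hom n' - [:0,1:] * Hom d' \<noteq> 0"
    hence "finite {y. poly (Hom n' - [:0,1:] * Hom d') y = 0}" by (rule poly_roots_finite)
    moreover have "Y \<subseteq> {y. poly (Hom n' - [:0,1:] * Hom d') y = 0}"
    proof
      fix y assume y: "y \<in> Y"
      have "poly d1 y \<noteq> 0" and r: "poly n y / poly d y = poly n1 y / poly d1 y" using d1y inv[OF y] by auto
      thus "y \<in> {y. poly (Hom n' - [:0,1:] * Hom d') y = 0}"
        using inv[OF y] md unfolding r by (simp add: Hom)
    qed
    ultimately show False using Y finite_subset by blast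
  qed
  hence id: "poly n' (poly n1 y / poly d1 y) = y * poly d' (poly n1 y / poly d1 y)" if "poly d1 y \<noteq> 0" for y
  proof -
    have "poly (Hom n') y = y * poly (Hom d') y"
      using arg_cong[OF \<open>Hom n' - [:0,1:] * Hom d' = 0\<close>, of "\<lambda>p. poly p y"] by simp
    hence "poly d1 y ^ m * poly n' (poly n1 y / poly d1 y) = poly d1 y ^ m * (y * poly d' (poly n1 y / poly d1 y))"
      unfolding Hom[OF md(1) that] Hom[OF md(2) that] by (simp add: mult_ac)
    thus ?thesis using that by simp
  qed
  have d'0: "d' \<noteq> 0" using inv[OF y0] by auto
  define W where "W = pderiv n1 * d1 - n1 * pderiv d1"
  have W0: "W \<noteq> 0"
  proof
    assume "W = 0"
    hence "pderiv n1 = 0" "pderiv d1 = 0" using wronskian_eq_0[OF cop] unfolding W_def by auto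
    then obtain \<alpha> \<beta> where c: "n1 = [:\<alpha>:]" "d1 = [:\<beta>:]"
      by (metis degree_eq_zeroE pderiv_eq_0_iff)
    have "y = poly n' (\<alpha> / \<beta>) / poly d' (\<alpha> / \<beta>)" if "y \<in> Y" for y
    proof -
      have "poly n y / poly d y = \<alpha> / \<beta>" using d1y(2)[of y] inv[OF that] unfolding c by simp
      thus ?thesis using inv[OF that] by simp
    qed
    hence "Y \<subseteq> {poly n' (\<alpha> / \<beta>) / poly d' (\<alpha> / \<beta>)}" by blast
    thus False using Y finite_subset by blast
  qed
  define Bad where "Bad = {w. poly d' w = 0} \<union> (\<lambda>y. poly n1 y / poly d1 y) ` {y. poly W y = 0}"
  have Bad: "finite Bad" unfolding Bad_def using poly_roots_finite[OF d'0] poly_roots_finite[OF W0] by simp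
  have deg: "degree (n1 - Polynomial.smult w d1) \<le> 1" if w: "w \<notin> Bad" for w
  proof (rule ccontr)
    assume big: "\<not> ?thesis"
    define q where "q = n1 - Polynomial.smult w d1"
    have root: "poly d1 y \<noteq> 0" "w = poly n1 y / poly d1 y" "y = poly n' w / poly d' w" if "poly q y = 0" for y
    proof -
      have e: "poly n1 y = w * poly d1 y" using that unfolding q_def by simp
      show 1: "poly d1 y \<noteq> 0" using e nocommon[of y] by auto
      thus 2: "w = poly n1 y / poly d1 y" using e by simp
      have "poly d' w \<noteq> 0" using w unfolding Bad_def by blast
      thus "y = poly n' w / poly d' w" using id[OF 1] unfolding 2[symmetric] by simp
    qed
    have "degree q \<noteq> 0" using big unfolding q_def by simp
    then obtain y1 where y1: "poly q y1 = 0"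
      using fundamental_theorem_of_algebra_alt[of q] by (metis degree_pCons_0)
    then obtain q1 where q1: "q = [:-y1,1:] * q1" by (auto simp: poly_eq_0_iff_dvd elim: dvdE)
    have "q1 \<noteq> 0" using big q1 unfolding q_def by auto
    hence "degree q = Suc (degree q1)" unfolding q1 by (subst degree_mult_eq) auto
    hence "degree q1 \<noteq> 0" using big unfolding q_def by simp
    then obtain y2 where y2: "poly q1 y2 = 0"
      using fundamental_theorem_of_algebra_alt[of q1] by (metis degree_pCons_0)
    have "poly q y2 = 0" unfolding q1 using y2 by simp
    hence "y2 = y1" using root(3) y1 by metis
    hence "poly (pderiv q) y1 = 0" unfolding q1 using y2 by (simp add: pderiv_mult pderiv_pCons del: mult_pCons_left)
    hence "poly (pderiv n1) y1 = w * poly (pderiv d1) y1" unfolding q_def by (simp add: pderiv_diff pderiv_smult)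
    moreover have "poly n1 y1 = w * poly d1 y1" using y1 unfolding q_def by simp
    ultimately have "poly W y1 = 0" unfolding W_def by simp
    hence "w \<in> Bad" unfolding Bad_def using root(2)[OF y1] by blast
    thus False using w by blast
  qed
  obtain w1 where w1: "w1 \<notin> Bad" using Bad ex_new_if_finite infinite_UNIV_char_0 by blast
  obtain w2 where w2: "w2 \<notin> insert w1 Bad" using Bad ex_new_if_finite infinite_UNIV_char_0 by (metis finite_insert)
  have "Polynomial.smult (w2 - w1) d1 = (n1 - Polynomial.smult w1 d1) - (n1 - Polynomial.smult w2 d1)"
    by (simp add: smult_diff_left)
  also have "degree \<dots> \<le> 1" using w2 by (intro degree_diff_le[OF deg[OF w1] deg]) simp
  finally have dd: "degree d1 \<le> 1" using w2 by (simp add: degree_smult_eq)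
  have "n1 = (n1 - Polynomial.smult w1 d1) + Polynomial.smult w1 d1" by simp
  also have "degree \<dots> \<le> 1" using deg[OF w1] dd by (intro degree_add_le) (auto intro: order_trans[OF degree_smult_le])
  finally have dn: "degree n1 \<le> 1" .
  define a b c e where "a = poly.coeff n1 1" and "b = poly.coeff n1 0" and "c = poly.coeff d1 1" and "e = poly.coeff d1 0"
  have lin: "p = [:poly.coeff p 0, poly.coeff p 1:]" if "degree p \<le> 1" for p :: "complex poly"
  proof (rule poly_eqI)
    fix i show "poly.coeff p i = poly.coeff [:poly.coeff p 0, poly.coeff p 1:] i"
      using that by (cases i; cases "i - 1") (auto simp: coeff_eq_0 coeff_pCons split: nat.split)
  qed
  have n1: "n1 = [:b, a:]" and d1: "d1 = [:e, c:]" unfolding a_def b_def c_def e_def using lin dn dd by blast+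
  have "W = [:a * e - b * c:]" unfolding W_def n1 d1 by (simp add: pderiv_pCons algebra_simps)
  hence det: "a * e - b * c \<noteq> 0" using W0 by auto
  have "(c * y + e) * (poly n y / poly d y) = a * y + b" if "poly d y \<noteq> 0" for y
  proof -
    have "c * y + e \<noteq> 0" "poly n y / poly d y = (a * y + b) / (c * y + e)"
      using d1y[OF that] unfolding n1 d1 by (simp_all add: add.commute mult.commute)
    thus ?thesis by simp
  qed
  thus ?thesis using det that by blast
qed

lemma evp_vertical: "poly (map_poly (\<lambda>c. poly c (complex_of_real x)) (cx P)) (complex_of_real y)
    = complex_of_real (evp P (vector [x, y]))"
proof -
  have "evp (cx P) (vector [x, y]) = poly (map_poly (\<lambda>c. poly c (complex_of_real x)) (cx P)) (complex_of_real y)"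
    unfolding evp_def eval2_eq_poly by simp
  thus ?thesis by (metis evp_cx)
qed

context birational_integral begin

text \<open>If \<open>V\<close> depends on \<open>x\<close> only, an irreducible level curve is a vertical line, on which the map is
  a rational function of \<open>y\<close> with a rational inverse.\<close>

lemma fibre_vertical:
  assumes j: "j = 2" and p0: "p0 \<in> X"
    and ND: "pderiv (rf_numer V) = 0" "pderiv (rf_denom V) = 0"
    and irr: "Factorial_Ring.irreducible (level_curve V (rf_eval V p0))"
  shows "\<exists>Z \<kappa> C. countable Z \<and>
    (\<forall>p\<in>X - Z. rf_eval V p = rf_eval V p0 \<longrightarrow> dens p \<le> C * \<kappa> p \<and>
      (rm_eval F p \<notin> Z \<longrightarrow> \<bar>rm_jac F p\<bar> * \<kappa> (rm_eval F p) = \<kappa> p))"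
proof -
  define h where "h = rf_eval V p0"
  define f where "f = level_curve V h"
  define x0 where "x0 = p0 $ 1"
  obtain nn where nn: "rf_numer V = [:nn:]" using ND(1) by (metis degree_eq_zeroE pderiv_eq_0_iff)
  obtain dd where dd: "rf_denom V = [:dd:]" using ND(2) by (metis degree_eq_zeroE pderiv_eq_0_iff)
  define g where "g = map_poly complex_of_real nn - Polynomial.smult (complex_of_real h) (map_poly complex_of_real dd)"
  have fg: "f = [:g:]" unfolding f_def level_curve_eq nn dd g_def by simp
  have irrg: "Factorial_Ring.irreducible g"
    using irr unfolding f_def[symmetric] h_def[symmetric] fg by (simp add: irreducible_const_poly_iff)
  have uniq: "x = y" if x: "poly g x = 0" and y: "poly g y = 0" for x y
  proof -
    obtain u where u: "g = [:-x,1:] * u" using x by (auto simp: poly_eq_0_iff_dvd elim: dvdE)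
    have "\<not> is_unit [:-x,1:]" by (simp add: is_unit_iff_degree)
    hence "is_unit u" using irreducibleD[OF irrg u] by blast
    then obtain c where c: "u = [:c:]" "is_unit c" by (auto simp: is_unit_poly_iff)
    hence "c \<noteq> 0" by auto
    thus ?thesis using y c(1) unfolding u by simp
  qed
  have on: "p $ 1 = x0" if "p \<in> U" "rf_eval V p = h" for p
  proof -
    have "poly g (complex_of_real (p$1)) = 0"
      using level_curve_derivative(3)[OF U_domain(2)[OF that(1)] that(2)] unfolding f_def[symmetric] fg by simp
    moreover have "poly g (complex_of_real x0) = 0"
      using level_curve_derivative(3)[OF U_domain(2)[OF X_U[OF p0]] refl]
      unfolding h_def[symmetric] f_def[symmetric] fg x0_def by simp
    ultimately show ?thesis using uniq of_real_eq_iff by blast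
  qed
  have Vx: "rf_eval V (vector [x0, y]) = h" for y
    unfolding h_def rf_eval_evp nn dd x0_def by simp
  have eta: "vector [p $ 1, p $ 2] = p" for p :: "real^2" by (simp add: vec_eq_iff forall_2)
  have tan1: "tan p $ 1 = 0" for p
    unfolding tan_def qY_def ND by simp
  define n d where "n = map_poly (\<lambda>c. poly c (complex_of_real x0)) (cx (rf_numer (snd F)))"
    and "d = map_poly (\<lambda>c. poly c (complex_of_real x0)) (cx (rf_denom (snd F)))"
  define n' d' where "n' = map_poly (\<lambda>c. poly c (complex_of_real x0)) (cx (rf_numer (snd G)))"
    and "d' = map_poly (\<lambda>c. poly c (complex_of_real x0)) (cx (rf_denom (snd G)))"
  have F2: "poly d (complex_of_real y) \<noteq> 0"
      "poly n (complex_of_real y) / poly d (complex_of_real y) = complex_of_real (rm_eval F (vector [x0,y]) $ 2)"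
    if "vector [x0,y] \<in> rm_domain F" for y
    using that unfolding n_def d_def evp_vertical rm_domain_def rm_eval_def by (auto simp: rf_domain_evp rf_eval_evp)
  have G2: "poly d' (complex_of_real y) \<noteq> 0"
      "poly n' (complex_of_real y) / poly d' (complex_of_real y) = complex_of_real (rm_eval G (vector [x0,y]) $ 2)"
    if "vector [x0,y] \<in> rm_domain G" for y
    using that unfolding n'_def d'_def evp_vertical rm_domain_def rm_eval_def by (auto simp: rf_domain_evp rf_eval_evp)
  have line: "((\<lambda>y. vector [x0, y] :: real^2) has_derivative (\<lambda>y. vector [0, y])) (at y)" for y
    unfolding vector2_eq by (auto intro!: derivative_eq_intros)
  have cont: "continuous_on UNIV (\<lambda>y. vector [x0, y] :: real^2)"
    unfolding vector2_eq by (intro continuous_intros)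
  have opl: "open {y. vector [x0, y] \<in> T}" if "open T" for T :: "(real^2) set"
    using open_vimage[OF that cont] by (simp add: vimage_def)
  define Y where "Y = {y. vector [x0, y] \<in> U \<inter> {p. evp Q2 p \<noteq> (0::real)}}"
  have "open Y" unfolding Y_def by (intro opl open_Int U(1)) (simp add: open_Collect_neq continuous_on_evp)
  moreover have "p0 $ 2 \<in> Y"
    using X_U[OF p0] U0D(3)[OF X_U0[OF p0]] unfolding Y_def x0_def by (simp add: eta)
  ultimately have "infinite Y" using finite_imp_not_open by blast
  hence "infinite (complex_of_real ` Y)" by (simp add: finite_image_iff inj_on_def)
  moreover have "poly d y \<noteq> 0 \<and> poly d' (poly n y / poly d y) \<noteq> 0 \<and>
      poly n' (poly n y / poly d y) = y * poly d' (poly n y / poly d y)" if "y \<in> complex_of_real ` Y" for y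
  proof -
    obtain s where s: "y = complex_of_real s" "vector [x0, s] \<in> U" "evp Q2 (vector [x0, s]) \<noteq> 0"
      using \<open>y \<in> complex_of_real ` Y\<close> unfolding Y_def by auto
    define p q where "p = (vector [x0, s] :: real^2)" and "q = rm_eval F p"
    have q: "q \<in> U" "rf_eval V q = h" "q \<in> rm_domain G" "rm_eval G q = p"
      using F_U V_F Vx Q2(2) s unfolding q_def p_def by auto
    have q2: "vector [x0, q $ 2] = q" using on[OF q(1,2)] eta[of q] by simp
    have "poly d y \<noteq> 0" and r: "poly n y / poly d y = complex_of_real (q $ 2)"
      using F2[of s] U_domain(1)[OF s(2)] unfolding s(1) q_def p_def by auto
    moreover have "poly d' (complex_of_real (q $ 2)) \<noteq> 0"
      "poly n' (complex_of_real (q $ 2)) / poly d' (complex_of_real (q $ 2)) = complex_of_real (p $ 2)"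
      using G2[of "q $ 2"] q(3,4) unfolding q2 by auto
    ultimately show ?thesis unfolding r s(1) by (auto simp: p_def divide_eq_eq)
  qed
  ultimately obtain a b c e where det: "a * e - b * c \<noteq> 0"
    and mo: "\<And>y. poly d y \<noteq> 0 \<Longrightarrow> (c * y + e) * (poly n y / poly d y) = a * y + b"
    using rational_left_inverse_moebius[of "complex_of_real ` Y" d d' n n'] by metis
  have moF: "(c * complex_of_real y + e) * complex_of_real (rm_eval F (vector [x0,y]) $ 2) = a * complex_of_real y + b"
    if "vector [x0,y] \<in> U" for y
    using mo[OF F2(1)] F2(2) U_domain(1)[OF that] by metis
  define Ob where "Ob = {p \<in> X. rf_eval V p = h}"
  have ObD: "p \<in> X" "p \<in> U" "rf_eval V p = h" "p = vector [x0, p $ 2]" if "p \<in> Ob" for p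
    using that X_U[of p] on[of p] eta[of p] unfolding Ob_def by auto
  have part1: "complex_of_real (p $ 2) * poly 1 (complex_of_real (p$2)) = poly [:0,1:] (complex_of_real (p$2))"
    "complex_of_real (tan p $ 2) * (poly 1 (complex_of_real (p$2)))\<^sup>2
      = poly (pderiv [:0,1:] * 1 - [:0,1:] * pderiv 1) (complex_of_real (p$2)) * complex_of_real (tan p $ 2)" for p
    by (simp_all add: pderiv_pCons)
  have part2: "(c * complex_of_real (p$2) + e) * complex_of_real (rm_eval F p $ 2) = a * complex_of_real (p$2) + b"
    "complex_of_real (rm_jac F p) * complex_of_real (tan (rm_eval F p) $ 2) * (c * complex_of_real (p$2) + e)\<^sup>2
      = (a * e - b * c) * complex_of_real (tan p $ 2)"
    if p: "p \<in> Ob" for p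
  proof -
    note o = ObD[OF p]
    define y where "y = p $ 2"
    have py: "p = vector [x0, y]" using o(4) by (simp add: y_def)
    define r where "r = rY (snd F) p"
    show 1: "(c * complex_of_real (p$2) + e) * complex_of_real (rm_eval F p $ 2) = a * complex_of_real (p$2) + b"
      using moF[of y] o(2) unfolding py by simp
    have dr: "((\<lambda>s. rf_eval (snd F) (vector [x0, s])) has_derivative (\<lambda>v. v * r)) (at y)"
    proof -
      have "(rf_eval (snd F) has_derivative (\<lambda>v. v$1 * rX (snd F) p + v$2 * r)) (at (vector [x0, y]))"
        using rf_eval_has_derivative[of p "snd F"] U_domain(1)[OF o(2)]
        unfolding rm_domain_def r_def py by simp
      from has_derivative_compose[OF line[of y] this] show ?thesis by simp
    qed
    have of: "((\<lambda>s. complex_of_real (u s)) has_derivative (\<lambda>v. complex_of_real (u' v))) (at y)"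
      if "(u has_derivative u') (at y)" for u u' :: "real \<Rightarrow> real"
      using bounded_linear.has_derivative[OF bounded_linear_of_real that] .
    have idc: "((\<lambda>s. \<alpha> * complex_of_real s + \<beta>) has_derivative (\<lambda>v. \<alpha> * complex_of_real v)) (at y)" for \<alpha> \<beta>
      by (rule has_derivative_add_const[OF has_derivative_mult_right[OF of[OF has_derivative_ident]]])
    define E where "E = (\<lambda>s. (c * complex_of_real s + e) * complex_of_real (rf_eval (snd F) (vector [x0, s])) - (a * complex_of_real s + b))"
    have dE: "(E has_derivative (\<lambda>v. ((c * complex_of_real y + e) * complex_of_real (v * r)
        + c * complex_of_real v * complex_of_real (rf_eval (snd F) (vector [x0, y]))) - a * complex_of_real v)) (at y)"
      unfolding E_def by (rule has_derivative_diff[OF has_derivative_mult[OF idc of[OF dr]] idc])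
    have "((\<lambda>_. 0) has_derivative (\<lambda>v. ((c * complex_of_real y + e) * complex_of_real (v * r)
        + c * complex_of_real v * complex_of_real (rf_eval (snd F) (vector [x0, y]))) - a * complex_of_real v)) (at y)"
    proof (rule has_derivative_transform_within_open[OF dE opl[OF U(1)]])
      show "y \<in> {y. vector [x0, y] \<in> U}" using o(2) py by simp
      fix s assume "s \<in> {y. vector [x0, y] \<in> U}"
      thus "E s = 0" using moF[of s] unfolding E_def rm_eval_def by simp
    qed
    hence "(\<lambda>v. ((c * complex_of_real y + e) * complex_of_real (v * r)
        + c * complex_of_real v * complex_of_real (rf_eval (snd F) (vector [x0, y]))) - a * complex_of_real v) = (\<lambda>_. 0)"
      by (rule has_derivative_unique) simp
    from fun_cong[OF this, of 1] have 2: "(c * complex_of_real y + e) * complex_of_real r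
        = a - c * complex_of_real (rm_eval F p $ 2)"
      unfolding py rm_eval_def by (simp add: algebra_simps)
    have "rm_deriv F p (tan p) $ 2 = rm_jac F p * tan (rm_eval F p) $ 2"
      unfolding tan_transport[OF o(2)] by simp
    hence 3: "rm_jac F p * tan (rm_eval F p) $ 2 = tan p $ 2 * r"
      unfolding rm_deriv_def r_def by (simp add: tan1)
    define s where "s = c * complex_of_real y + e"
    have "s * (s * complex_of_real r) = a * s - c * (s * complex_of_real (rm_eval F p $ 2))"
      unfolding 2[folded s_def] by (simp add: algebra_simps)
    also have "\<dots> = a * e - b * c"
      unfolding 1[folded y_def, folded s_def] by (simp add: s_def algebra_simps)
    finally have 4: "s * (s * complex_of_real r) = a * e - b * c" .
    have "complex_of_real (rm_jac F p) * complex_of_real (tan (rm_eval F p) $ 2) * s\<^sup>2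
        = complex_of_real (tan p $ 2) * (s * (s * complex_of_real r))"
      unfolding of_real_mult[symmetric] 3 by (simp add: power2_eq_square mult_ac)
    thus "complex_of_real (rm_jac F p) * complex_of_real (tan (rm_eval F p) $ 2) * (c * complex_of_real (p$2) + e)\<^sup>2
      = (a * e - b * c) * complex_of_real (tan p $ 2)"
      unfolding 4 by (simp add: s_def y_def mult.commute)
  qed
  have PQ: "poly [:0,1:] z \<noteq> 0 \<or> poly 1 z \<noteq> 0" for z :: complex by simp
  obtain C \<kappa> Bf where Bf: "finite Bf"
    and \<kappa>: "\<And>p. p \<in> Ob \<Longrightarrow> complex_of_real (p$2) \<notin> Bf \<Longrightarrow> \<bar>tan p $ 2\<bar> / (1 + (p$2)\<^sup>2) \<le> C * \<kappa> p"
      "\<And>p. p \<in> Ob \<Longrightarrow> rm_eval F p \<in> Ob \<Longrightarrow> complex_of_real (p$2) \<notin> Bf \<Longrightarrow>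
        complex_of_real (rm_eval F p $ 2) \<notin> Bf \<Longrightarrow> \<bar>rm_jac F p\<bar> * \<kappa> (rm_eval F p) = \<kappa> p"
    using moebius_transport[where Ob = Ob and u = "\<lambda>p. p$2" and du = "\<lambda>p. tan p $ 2" and \<phi> = "\<lambda>p. complex_of_real (p$2)"
      and d\<phi> = "\<lambda>p. complex_of_real (tan p $ 2)" and F = "rm_eval F" and J = "rm_jac F", OF det PQ part1 part2] by blast
  define Z where "Z = {p :: real^2. p $ 1 = x0 \<and> complex_of_real (p$2) \<in> Bf}"
  have "Z \<subseteq> (\<lambda>z. vector [x0, Re z]) ` Bf"
  proof
    fix p assume "p \<in> Z"
    thus "p \<in> (\<lambda>z. vector [x0, Re z]) ` Bf" unfolding Z_def
      by (intro image_eqI[of _ _ "complex_of_real (p$2)"]) (auto simp: vec_eq_iff forall_2)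
  qed
  hence "finite Z" using Bf finite_subset by blast
  hence Z: "countable Z" by (rule countable_finite)
  have out: "p \<in> Ob \<and> complex_of_real (p$2) \<notin> Bf" if p: "p \<in> X" "p \<notin> Z" "rf_eval V p = h" for p
    using p on[OF X_U[OF p(1)] p(3)] unfolding Ob_def Z_def by blast
  have "dens p \<le> C * \<kappa> p \<and> (rm_eval F p \<notin> Z \<longrightarrow> \<bar>rm_jac F p\<bar> * \<kappa> (rm_eval F p) = \<kappa> p)"
    if p: "p \<in> X - Z" "rf_eval V p = rf_eval V p0" for p
  proof -
    have p': "p \<in> X" "p \<notin> Z" "rf_eval V p = h" using p by (auto simp: h_def)
    note o = out[OF p']
    have "dens p \<le> C * \<kappa> p" using \<kappa>(1)[of p] o unfolding dens_def by (simp add: j)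
    moreover have "\<bar>rm_jac F p\<bar> * \<kappa> (rm_eval F p) = \<kappa> p" if FZ: "rm_eval F p \<notin> Z"
    proof -
      have "rf_eval V (rm_eval F p) = h" using V_FX[OF p'(1)] p'(3) by simp
      hence "rm_eval F p \<in> Ob \<and> complex_of_real (rm_eval F p $ 2) \<notin> Bf" by (rule out[OF X(4)[OF p'(1)] FZ])
      thus ?thesis using \<kappa>(2)[of p] o by simp
    qed
    ultimately show ?thesis by simp
  qed
  thus ?thesis using Z by blast
qed

end

text \<open>The coordinate \<open>x\<close> is a parameter on the level curves unless \<open>V\<^sub>y\<close> vanishes identically. In that case
  \<open>V\<^sub>x\<close> does not, because \<open>V\<close> is not constant.\<close>

lemma birational_preserves_ac_measure:
  assumes bir: "birational F" and V: "first_integral F V"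
    and U: "open U" "U = {p. rf_eval V p \<in> H} \<inter> good_set F"
    and irr: "\<And>h. h \<in> H \<Longrightarrow> Factorial_Ring.irreducible (level_curve V h)"
    and genus: "\<And>h. h \<in> H \<Longrightarrow> curve_has_genus (level_curve V h) 0"
  shows "preserves_ac_measure_on (rm_eval F) U"
proof -
  obtain G and Q1 Q2 :: "real poly poly" where Q: "Q1 \<noteq> 0" "\<And>p. evp Q1 p \<noteq> 0 \<Longrightarrow>
      p \<in> rm_domain G \<and> rm_eval G p \<in> rm_domain F \<and> rm_eval F (rm_eval G p) = p"
    "Q2 \<noteq> 0" "\<And>p. evp Q2 p \<noteq> 0 \<Longrightarrow>
      p \<in> rm_domain F \<and> rm_eval F p \<in> rm_domain G \<and> rm_eval G (rm_eval F p) = p"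
  proof -
    have *: "\<exists>Q :: real poly poly. Q \<noteq> 0 \<and> (\<forall>p. evp Q p \<noteq> 0 \<longrightarrow> p \<in> rm_domain B \<and> rm_eval B p \<in> rm_domain A \<and>
        rm_eval A (rm_eval B p) = p)" if "rm_comp_is_id A B" for A B
      using that unfolding rm_comp_is_id_def evp_real .
    obtain G where G: "rm_comp_is_id F G" "rm_comp_is_id G F" using bir unfolding birational_def by blast
    obtain Q1 :: "real poly poly" where Q1: "Q1 \<noteq> 0" "\<forall>p. evp Q1 p \<noteq> 0 \<longrightarrow>
        p \<in> rm_domain G \<and> rm_eval G p \<in> rm_domain F \<and> rm_eval F (rm_eval G p) = p" using *[OF G(1)] by blast
    obtain Q2 :: "real poly poly" where Q2: "Q2 \<noteq> 0" "\<forall>p. evp Q2 p \<noteq> 0 \<longrightarrow>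
        p \<in> rm_domain F \<and> rm_eval F p \<in> rm_domain G \<and> rm_eval G (rm_eval F p) = p" using *[OF G(2)] by blast
    show ?thesis by (rule that[OF Q1(1) Q1(2)[rule_format] Q2(1) Q2(2)[rule_format]])
  qed
  define N D where "N = rf_numer V" and "D = rf_denom V"
  have cop: "coprime N D" unfolding N_def D_def rf_numer_def rf_denom_def by (rule coprime_quot_of_fract)
  define WX WY where "WX = dX N * D - N * dX D" and "WY = pderiv N * D - N * pderiv D"
  have rXY: "rX V p = evp WX p / (evp D p)\<^sup>2" "rY V p = evp WY p / (evp D p)\<^sup>2" for p
    unfolding qX_def qY_def WX_def WY_def N_def D_def by simp_all
  show ?thesis
  proof (cases "WY = 0")
    case False
    interpret birational_integral F G V H U Q1 Q2 WY 1
    proof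
      show "(vector [rY V p, - rX V p] :: real^2) $ 1 \<noteq> 0" if "p \<in> rf_domain V" "evp WY p \<noteq> 0" for p
        using that unfolding rXY by (simp add: rf_domain_evp D_def)
    qed (use Q V U False in auto)
    show ?thesis
    proof (rule preserves_if_fibres)
      fix p0 assume p0: "p0 \<in> X"
      show "\<exists>Z \<kappa> C. countable Z \<and> (\<forall>p\<in>X - Z. rf_eval V p = rf_eval V p0 \<longrightarrow> dens p \<le> C * \<kappa> p \<and>
          (rm_eval F p \<notin> Z \<longrightarrow> \<bar>rm_jac F p\<bar> * \<kappa> (rm_eval F p) = \<kappa> p))"
        by (rule fibre_nonvertical[OF refl p0 irr genus]) (use U_H[OF X_U[OF p0]] in auto)
    qed
  next
    case True
    have ND: "pderiv N = 0" "pderiv D = 0" using wronskian_eq_0[OF cop] True unfolding WY_def by auto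
    have "WX \<noteq> 0"
    proof
      assume WX: "WX = 0"
      obtain nn where nn: "N = [:nn:]" using ND(1) by (metis degree_eq_zeroE pderiv_eq_0_iff)
      obtain dd where dd: "D = [:dd:]" using ND(2) by (metis degree_eq_zeroE pderiv_eq_0_iff)
      have "coprime nn dd"
      proof (rule coprimeI)
        fix k assume "k dvd nn" "k dvd dd"
        hence "[:k:] dvd N" "[:k:] dvd D" unfolding nn dd
          by (auto simp: const_poly_dvd_iff coeff_pCons split: nat.split)
        hence "is_unit [:k:]" using cop by (rule coprime_common_divisor[rotated])
        thus "is_unit k" by (simp add: is_unit_const_poly_iff)
      qed
      moreover have "pderiv nn * dd = nn * pderiv dd" using WX unfolding WX_def nn dd by (simp add: mult.commute)
      ultimately have "pderiv nn = 0" "pderiv dd = 0" by (rule wronskian_eq_0)+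
      then obtain \<alpha> \<beta> where "nn = [:\<alpha>:]" "dd = [:\<beta>:]" by (metis degree_eq_zeroE pderiv_eq_0_iff)
      hence "rf_eval V p = \<alpha> / \<beta>" for p
        unfolding rf_eval_evp N_def[symmetric] D_def[symmetric] nn dd by simp
      hence "rf_eval V constant_on good_set F" unfolding constant_on_def by blast
      thus False using V unfolding first_integral_def by blast
    qed
    interpret birational_integral F G V H U Q1 Q2 WX 2
    proof
      show "(vector [rY V p, - rX V p] :: real^2) $ 2 \<noteq> 0" if "p \<in> rf_domain V" "evp WX p \<noteq> 0" for p
        using that unfolding rXY by (simp add: rf_domain_evp D_def)
    qed (use Q V U \<open>WX \<noteq> 0\<close> in auto)
    show ?thesis
    proof (rule preserves_if_fibres)
      fix p0 assume p0: "p0 \<in> X"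
      show "\<exists>Z \<kappa> C. countable Z \<and> (\<forall>p\<in>X - Z. rf_eval V p = rf_eval V p0 \<longrightarrow> dens p \<le> C * \<kappa> p \<and>
          (rm_eval F p \<notin> Z \<longrightarrow> \<bar>rm_jac F p\<bar> * \<kappa> (rm_eval F p) = \<kappa> p))"
        by (rule fibre_vertical[OF refl p0 ND[unfolded N_def D_def] irr]) (use U_H[OF X_U[OF p0]] in auto)
    qed
  qed
qed

theorem corollary5:
  fixes F :: ratmap and V :: ratfun and H :: "real set" and U :: "(real^2) set"
  assumes "birational F"
    and "open (good_set F)"
    and "first_integral F V"
    and "H \<subseteq> rf_eval V ` rf_domain V"
    and "U = {p. rf_eval V p \<in> H} \<inter> good_set F"
    and "open U" and "U \<noteq> {}"
    and "\<And>h. h \<in> H \<Longrightarrow> Factorial_Ring.irreducible (level_curve V h)"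
    and "\<And>h. h \<in> H \<Longrightarrow> curve_has_genus (level_curve V h) 0"
  shows "\<exists>Up Um. open Up \<and> open Um \<and> Up \<inter> Um = {} \<and> Up \<subseteq> U \<and> Um \<subseteq> U \<and> (Up \<noteq> {} \<or> Um \<noteq> {}) \<and>
    (preserves_orientation_on (rm_eval F) U \<longrightarrow>
       preserves_ac_measure_on (rm_eval F) Up \<and> preserves_ac_measure_on (rm_eval F) Um) \<and>
    preserves_ac_measure_on (rm_eval F \<circ> rm_eval F) Up \<and>
    preserves_ac_measure_on (rm_eval F \<circ> rm_eval F) Um"
proof -
  have "preserves_ac_measure_on (rm_eval F) U"
    by (rule birational_preserves_ac_measure[OF assms(1,3,6,5,8,9)])
  thus ?thesis
    using assms(6,7) preserves_ac_measure_on_compose preserves_ac_measure_on_empty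
    by (intro exI[of _ U] exI[of _ "{}"]) simp
qed

end
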